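(* Let $d\ge2$, let $X=\{x_1,\ldots,x_N\}\subset\mathbb S^{d-1}$ be a node-transitive spherical $2$-design, let its Steiner-normalized Minkowski polytope satisfy $P_X^\circ=cUP_X$ for some $c>0$, $U\in O(d)$, and let $r$ and $R$ be the centered inradius and circumradius of $P_X$. Then $$\frac rR\ge\frac1d.$$ Equality holds only for the regular simplex, in which case each facet has $d$ vertices and the Gauss--Radau weights (for $\mu_d$, with prescribed node $-1$, exact through degree $2$) are $$\frac1{d+1}\ \text{ at the node }-1,\qquad\frac d{d+1}\ \text{ at the node }\frac1d.$$
   Context: $\sigma$ is the normalized (probability) surface measure on the unit sphere $\mathbb S^{d-1}\subset\mathbb R^d$, and $\omega_{d-1}$ is the total $(d-1)$-area of $\mathbb S^{d-1}$. A finite set $X=\{x_1,\ldots,x_N\}\subset\mathbb S^{d-1}$ of $N$ distinct points is a spherical $t$-design if $\frac1N\sum_i p(x_i)=\int p\,d\sigma$ for every polynomial $p$ of total degree at most $t$. It is node-transitive if some subgroup $G\le O(d)$ preserves $X$ and acts transitively on it. For $t\ge2$, the Minkowski polytope $P_X\subset\mathbb R^d$ is the full-dimensional convex polytope, unique up to translation, whose surface area measure is $\frac{\omega_{d-1}}N\sum_i\delta_{x_i}$: it has exactly $N$ facets, with outer unit normals $x_1,\ldots,x_N$, each of $(d-1)$-area $\omega_{d-1}/N$. It is Steiner-normalized: the translate is chosen so that the Steiner point $d\int_{\mathbb S^{d-1}}h_{P_X}(u)u\,d\sigma(u)$ is $0$, which implies $0\in\operatorname{int}P_X$. Here $h_P(u)=\max_{y\in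 P}\langle u,y\rangle$ and $P^\circ=\{z:\langle z,y\rangle\le1\ \forall y\in P\}$. The centered inradius $r$ is the largest radius of an origin-centered ball contained in $P_X$ and the centered circumradius $R$ is the smallest radius of an origin-centered ball containing $P_X$. "Equality only for the regular simplex" means: if $r/R=1/d$ then $N=d+1$ and $X$ is the vertex set of a regular simplex (so $P_X$ is a regular simplex). $\mu_d$ is the distribution of the first coordinate of a uniform random point of $\mathbb S^{d-1}$. The Gauss--Radau rule meant here is the two-node rule with nodes $-1$ and the zero $1/d$ of the degree-one orthogonal polynomial for $(1+s)\,d\mu_d(s)$, integrating all polynomials of degree $\le2$ exactly against $\mu_d$. *)

theory Defs
  imports "HOL-Analysis.Analysis" "HOL-Computational_Algebra.Polynomial"
begin

section \<open>Surface measure on the unit sphere\<close>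

text \<open>
  The surface measure of a Borel set \<open>A\<close> of the unit sphere is taken to be \<open>d\<close> times the volume of
  the cone \<open>{t a | a \<in> A, 0 < t \<le> 1}\<close>, i.e. \<open>d\<close> times the image of Lebesgue measure on the unit
  ball under radial projection \<open>sgn x = x / |x|\<close>.  The measure lives on the ambient Borel
  sets; it is concentrated on the sphere, since \<open>sgn 0 = 0\<close> affects only a null set.
\<close>

definition sphere_measure :: "(real^'n) measure" where
  "sphere_measure =
     distr (density lborel (\<lambda>x. ennreal (real CARD('n)) * indicator (cball 0 1) x)) borel sgn"

definition sphere_area :: "'n::finite itself \<Rightarrow> real" where
  "sphere_area _ = measure (sphere_measure :: (real^'n) measure) (sphere 0 1)"

definition sphere_prob :: "(real^'n) measure" where
  "sphere_prob = uniform_measure sphere_measure (sphere 0 1)"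

definition coordinate_distr :: "'n::finite \<Rightarrow> real measure" where
  "coordinate_distr i = distr (sphere_prob :: (real^'n) measure) borel (\<lambda>x. x $ i)"

section \<open>Spherical designs\<close>

definition polynomial_fun :: "nat \<Rightarrow> (real^'n \<Rightarrow> real) \<Rightarrow> bool" where
  "polynomial_fun t p \<longleftrightarrow>
     (\<exists>c :: ('n \<Rightarrow> nat) \<Rightarrow> real.
        \<forall>x. p x = (\<Sum>\<alpha> | (\<Sum>i\<in>UNIV. \<alpha> i) \<le> t. c \<alpha> * (\<Prod>i\<in>UNIV. x $ i ^ \<alpha> i)))"

definition spherical_design :: "nat \<Rightarrow> (real^'n) set \<Rightarrow> bool" where
  "spherical_design t X \<longleftrightarrow>
     finite X \<and> X \<noteq> {} \<and> X \<subseteq> sphere 0 1 \<and>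
     (\<forall>p. polynomial_fun t p \<longrightarrow>
        (\<Sum>x\<in>X. p x) / real (card X) = (LINT x|sphere_prob. p x))"

definition orthogonal_subgroup :: "(real^'n \<Rightarrow> real^'n) set \<Rightarrow> bool" where
  "orthogonal_subgroup G \<longleftrightarrow>
     (\<forall>g\<in>G. orthogonal_transformation g) \<and> id \<in> G \<and>
     (\<forall>g\<in>G. \<forall>h\<in>G. g \<circ> h \<in> G) \<and> (\<forall>g\<in>G. inv g \<in> G)"

definition node_transitive :: "(real^'n) set \<Rightarrow> bool" where
  "node_transitive X \<longleftrightarrow>
     (\<exists>G. orthogonal_subgroup G \<and> (\<forall>g\<in>G. g ` X = X) \<and>
          (\<forall>x\<in>X. \<forall>y\<in>X. \<exists>g\<in>G. g x = y))"

section \<open>Minkowski polytopes\<close>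

definition support_function :: "(real^'n) set \<Rightarrow> real^'n \<Rightarrow> real" where
  "support_function P u = (SUP y\<in>P. u \<bullet> y)"

definition support_face :: "(real^'n) set \<Rightarrow> real^'n \<Rightarrow> (real^'n) set" where
  "support_face P u = {y\<in>P. u \<bullet> y = support_function P u}"

definition facet_normals :: "(real^'n) set \<Rightarrow> (real^'n) set" where
  "facet_normals P = {u. norm u = 1 \<and> support_face P u facet_of P}"

text \<open>
  The \<open>(d-1)\<close>-area of a set \<open>F\<close> lying in a hyperplane with unit normal \<open>u\<close>, as the volume of
  the right prism of height 1 over \<open>F\<close>.
\<close>

definition area :: "real^'n \<Rightarrow> (real^'n) set \<Rightarrow> real" where
  "area u F = measure lborel {y + s *\<^sub>R u | y s. y \<in> F \<and> 0 \<le> s \<and> s \<le> 1}"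

text \<open>
  For a full-dimensional polytope, distinct facets have distinct outer unit normals and the facet
  with outer unit normal \<open>u\<close> is \<open>support_face P u\<close>.  The conditions below hence say that the surface
  area measure of \<open>P\<close> has atoms exactly at the points of \<open>X\<close>, all of mass \<open>\<omega> / N\<close>.
\<close>

definition minkowski_polytope :: "(real^'n) set \<Rightarrow> (real^'n) set \<Rightarrow> bool" where
  "minkowski_polytope X P \<longleftrightarrow>
     polytope P \<and> interior P \<noteq> {} \<and> facet_normals P = X \<and>
     (\<forall>x\<in>X. area x (support_face P x) = sphere_area TYPE('n) / real (card X))"

definition steiner_point :: "(real^'n) set \<Rightarrow> real^'n" where
  "steiner_point P = real CARD('n) *\<^sub>R (LINT u|sphere_prob. support_function P u *\<^sub>R u)"

definition polar :: "(real^'n) set \<Rightarrow> (real^'n) set" where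
  "polar P = {z. \<forall>y\<in>P. z \<bullet> y \<le> 1}"

definition centered_inradius :: "(real^'n) set \<Rightarrow> real" where
  "centered_inradius P = Sup {\<rho>. 0 \<le> \<rho> \<and> cball 0 \<rho> \<subseteq> P}"

definition centered_circumradius :: "(real^'n) set \<Rightarrow> real" where
  "centered_circumradius P = Inf {\<rho>. 0 \<le> \<rho> \<and> P \<subseteq> cball 0 \<rho>}"

definition regular_simplex_vertices :: "(real^'n) set \<Rightarrow> bool" where
  "regular_simplex_vertices V \<longleftrightarrow>
     card V = CARD('n) + 1 \<and> \<not> affine_dependent V \<and>
     (\<exists>l. \<forall>x\<in>V. \<forall>y\<in>V. x \<noteq> y \<longrightarrow> dist x y = l)"

definition regular_simplex :: "(real^'n) set \<Rightarrow> bool" where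
  "regular_simplex P \<longleftrightarrow> (\<exists>V. regular_simplex_vertices V \<and> P = convex hull V)"

section \<open>The two-node Gauss--Radau rule with prescribed node \<open>-1\<close>\<close>

text \<open>
  The free node \<open>\<xi>\<close> is the zero of the degree-one orthogonal polynomial for the measure
  \<open>(1 + s) d\<mu>(s)\<close>; \<open>v\<close> and \<open>w\<close> are the weights at \<open>-1\<close> and \<open>\<xi>\<close>.
\<close>

definition gauss_radau_rule :: "real measure \<Rightarrow> real \<Rightarrow> real \<Rightarrow> real \<Rightarrow> bool" where
  "gauss_radau_rule \<mu> \<xi> v w \<longleftrightarrow>
     (\<exists>q :: real poly. degree q = 1 \<and> (LINT s|\<mu>. poly q s * (1 + s)) = 0 \<and> poly q \<xi> = 0) \<and>
     (\<forall>p :: real poly. degree p \<le> 2 \<longrightarrow>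
        (LINT s|\<mu>. poly p s) = v * poly p (-1) + w * poly p \<xi>)"

end

theory Submission
  imports Defs
begin

text \<open>
  Let \<open>h\<close> be the support function of \<open>P\<close>, \<open>d\<close> the dimension and \<open>N\<close> the number of points of \<open>X\<close>. The proof
  has two halves: the symmetry of \<open>X\<close> makes \<open>h\<close> constant on \<open>X\<close>, and then the design property applied
  to one farthest point of \<open>P\<close> gives everything.

  Constancy of \<open>h\<close> is the uniqueness part of Minkowski's problem. Let \<open>g\<close> be an orthogonal map that
  permutes \<open>X\<close>. The averaged support numbers \<open>k u = (h u + h (inv g u)) / 2\<close> have the same sum over \<open>X\<close>
  as \<open>h\<close>, because \<open>g\<close> only permutes the terms. All facets of \<open>P\<close> have the same area, so Minkowski's
  first inequality (\<open>minkowski_first_inequality\<close>) says that the polytope \<open>M\<close> with the support numbers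
  \<open>k\<close> has at most the volume of \<open>P\<close>. On the other hand \<open>M\<close> contains the midpoints of \<open>P\<close> and \<open>g ` P\<close>,
  which have equal volumes, so \<open>M\<close> has at least that volume by Brunn and Minkowski. The equality case
  (\<open>brunn_minkowski_equality\<close>) shows that \<open>P\<close> is a translate of \<open>g ` P\<close>, and as both have Steiner point
  \<open>0\<close>, they coincide (\<open>support_function_invariant\<close>). By transitivity \<open>h\<close> has a single value \<open>\<rho>\<close> on \<open>X\<close>.

  The equality case is obtained by slicing two bodies of equal volume and their midpoint body by
  hyperplanes orthogonal to a unit vector \<open>u\<close>. Cutting both bodies at the levels below which they have
  volume \<open>p\<close> and applying the inequality to the two parts separately shows that the quantile functions
  of the midpoint body are the averages of those of the two bodies. The derivative of a quantile function
  is the reciprocal of a slice area, and slice areas of the midpoint body dominate geometric means;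
  by the inequality of the arithmetic and geometric means both quantile functions have the same
  derivative, so the two bodies have the same slice areas up to a shift of the level. Comparing centroids
  shows that the shift is linear in \<open>u\<close>.

  For the second half, the origin is an interior point of \<open>P\<close>, because the polar of \<open>P\<close>, a rotated and
  dilated copy of \<open>P\<close>, is bounded; hence \<open>\<rho> > 0\<close>. As \<open>P\<close> consists of the \<open>y\<close> with \<open>x \<bullet> y \<le> \<rho>\<close> for all
  \<open>x \<in> X\<close>, its inradius \<open>r\<close> is \<open>\<rho>\<close>. If \<open>v \<in> P\<close> has norm \<open>R\<close>, then the sum over \<open>X\<close> of the nonnegative
  terms \<open>(x \<bullet> v + R) * (\<rho> - x \<bullet> v)\<close> is
  \<open>N * R * (\<rho> - R / d)\<close> by the first two moments of \<open>X\<close>; this is Gauss--Radau positivity and proves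
  \<open>r / R \<ge> 1 / d\<close>. In case of equality every \<open>x \<bullet> v\<close> is \<open>- R\<close> or \<open>\<rho>\<close>, the first value is taken only by
  \<open>x = - v / R\<close>, and the vanishing first moment yields \<open>N = d + 1\<close>. The second moment of a design of this
  size leaves no room for inner products other than \<open>- 1 / d\<close>, so \<open>X\<close> is a regular simplex and \<open>P\<close> is
  its dual simplex.
\<close>

section \<open>The inequalities of Prekopa--Leindler and Brunn--Minkowski\<close>

text \<open>
  One translate of each set fits into the dilated target: with \<open>b\<close> close to the infimum of \<open>B\<close> and \<open>a\<close>
  close to the supremum of \<open>A\<close>, both \<open>A + b\<close> and \<open>a + B\<close> lie in \<open>2 C\<close>, and they overlap at most in a short
  interval.
\<close>

lemma emeasure_midpoint_real:
  fixes A B C :: "real set"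
  assumes [measurable]: "A \<in> sets borel" "B \<in> sets borel" "C \<in> sets borel"
    and ne: "A \<noteq> {}" "B \<noteq> {}"
    and mid: "\<And>a b. a \<in> A \<Longrightarrow> b \<in> B \<Longrightarrow> (a + b) / 2 \<in> C"
  shows "emeasure lborel A + emeasure lborel B \<le> 2 * emeasure lborel C"
proof -
  have half: "emeasure lborel ((\<lambda>x. (x + c) / 2) -` D) = 2 * emeasure lborel D"
    if [measurable]: "D \<in> sets borel" for D :: "real set" and c
  proof -
    have "emeasure lborel D = (\<integral>\<^sup>+x. indicator D x \<partial>lborel)" by simp
    also have "\<dots> = ennreal (1/2) * (\<integral>\<^sup>+x. indicator D (c/2 + (1/2) * x) \<partial>lborel)"
      by (subst nn_integral_real_affine[where c="1/2" and t="c/2"]) auto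
    also have "(\<integral>\<^sup>+x. indicator D (c/2 + (1/2) * x) \<partial>lborel)
        = (\<integral>\<^sup>+x. indicator ((\<lambda>x. (x + c) / 2) -` D) x \<partial>(lborel::real measure))"
      by (intro nn_integral_cong) (auto simp: indicator_def add_divide_distrib add.commute)
    also have "\<dots> = emeasure lborel ((\<lambda>x. (x + c) / 2) -` D)"
      by (subst nn_integral_indicator) (auto intro!: measurable_sets_borel[where M=borel])
    finally have e: "emeasure lborel D = ennreal (1/2) * emeasure lborel ((\<lambda>x. (x + c) / 2) -` D)" .
    have "2 * emeasure lborel D = (2 * ennreal (1/2)) * emeasure lborel ((\<lambda>x. (x + c) / 2) -` D)"
      unfolding e by (simp add: mult.assoc)
    also have "2 * ennreal (1/2) = 1"
      by (metis ennreal_numeral ennreal_mult' ennreal_1 mult_2 field_sum_of_halves zero_le_numeral)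
    finally show ?thesis by simp
  qed
  have bounded_case: "emeasure lborel (A \<inter> {-n..n}) + emeasure lborel (B \<inter> {-n..n}) \<le> 2 * emeasure lborel C"
    if neA: "A \<inter> {-n..n} \<noteq> {}" and neB: "B \<inter> {-n..n} \<noteq> {}" for n
  proof (rule ennreal_le_epsilon)
    fix e :: real assume e: "e > 0"
    let ?A = "A \<inter> {-n..n}" and ?B = "B \<inter> {-n..n}"
    have bA: "bdd_above ?A" by (rule bdd_above_mono[of "{-n..n}"]) auto
    have bB: "bdd_below ?B" by (rule bdd_below_mono[of "{-n..n}"]) auto
    \<comment> \<open>Supremum and infimum need not be attained, hence the error \<open>e\<close>.\<close>
    obtain a where a: "a \<in> ?A" "Sup ?A - e/2 < a"
      using less_cSup_iff[OF neA bA, of "Sup ?A - e/2"] e by auto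
    obtain b where b: "b \<in> ?B" "b < Inf ?B + e/2"
      using cInf_less_iff[OF neB bB, of "Inf ?B + e/2"] e by auto
    define C' where "C' = (\<lambda>x. x / 2) -` C"
    have C'[measurable]: "C' \<in> sets borel"
      unfolding C'_def by (auto intro!: measurable_sets_borel[where M=borel])
    have em: "emeasure lborel C' = 2 * emeasure lborel C"
      using half[of C 0] by (simp add: C'_def)
    define A' where "A' = (\<lambda>x. x - b) -` ?A"
    define B' where "B' = (\<lambda>x. x - a) -` ?B"
    have shift: "emeasure lborel ((\<lambda>x. x - c) -` D) = emeasure lborel D"
      if [measurable]: "D \<in> sets borel" for D :: "real set" and c
    proof -
      have "emeasure lborel D = emeasure (distr lborel borel ((+) (-c))) D"
        by (subst lborel_distr_plus) simp
      also have "\<dots> = emeasure lborel ((\<lambda>x. x - c) -` D)"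
        by (subst emeasure_distr) (auto simp: vimage_def)
      finally show ?thesis by simp
    qed
    have A'[measurable]: "A' \<in> sets borel" and B'[measurable]: "B' \<in> sets borel"
      unfolding A'_def B'_def by (auto intro!: measurable_sets_borel[where M=borel])
    have sub: "A' \<union> B' \<subseteq> C'"
      using mid a(1) b(1) unfolding A'_def B'_def C'_def by fastforce
    have inter: "A' \<inter> B' \<subseteq> {Inf ?B + a .. Sup ?A + b}"
    proof
      fix x assume x: "x \<in> A' \<inter> B'"
      have "x - b \<le> Sup ?A" using x bA by (intro cSup_upper) (auto simp: A'_def)
      moreover have "Inf ?B \<le> x - a" using x bB by (intro cInf_lower) (auto simp: B'_def)
      ultimately show "x \<in> {Inf ?B + a .. Sup ?A + b}" by auto
    qed
    have small: "emeasure lborel (A' \<inter> B') \<le> ennreal e"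
    proof -
      have "emeasure lborel (A' \<inter> B') \<le> emeasure lborel {Inf ?B + a .. Sup ?A + b}"
        by (rule emeasure_mono[OF inter]) simp
      also have "\<dots> \<le> ennreal e"
        unfolding emeasure_lborel_Icc_eq using a b e by (intro ennreal_leI) auto
      finally show ?thesis .
    qed
    have "emeasure lborel ?A + emeasure lborel ?B = emeasure lborel A' + emeasure lborel B'"
      unfolding A'_def B'_def by (subst (1 2) shift) auto
    also have "\<dots> = emeasure lborel (A' \<union> B') + emeasure lborel (A' \<inter> B')"
      by (rule emeasure_Un_Int) auto
    also have "\<dots> \<le> emeasure lborel C' + ennreal e"
      by (intro add_mono emeasure_mono sub small) auto
    finally show "emeasure lborel ?A + emeasure lborel ?B \<le> 2 * emeasure lborel C + ennreal e"
      by (simp add: em)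
  qed
  obtain a0 b0 where ab: "a0 \<in> A" "b0 \<in> B" using ne by auto
  define k where "k = nat \<lceil>max \<bar>a0\<bar> \<bar>b0\<bar>\<rceil>"
  have k: "\<bar>a0\<bar> \<le> real k" "\<bar>b0\<bar> \<le> real k" unfolding k_def by linarith+
  have lim: "(\<lambda>n. emeasure lborel (D \<inter> {-real (k+n)..real (k+n)})) \<longlonglongrightarrow> emeasure lborel D"
    if D: "D \<in> sets borel" for D :: "real set"
  proof -
    have "(\<Union>n. D \<inter> {-real (k+n)..real (k+n)}) = D"
    proof (intro equalityI subsetI)
      fix x assume "x \<in> D"
      moreover obtain n where "\<bar>x\<bar> \<le> real n" using real_arch_simple by blast
      ultimately show "x \<in> (\<Union>n. D \<inter> {-real (k+n)..real (k+n)})" by (auto intro!: exI[of _ n])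
    qed auto
    then show ?thesis
      using Lim_emeasure_incseq[of "\<lambda>n. D \<inter> {-real (k+n)..real (k+n)}" lborel] D
      by (force simp: incseq_def)
  qed
  have "(\<lambda>n. emeasure lborel (A \<inter> {-real (k+n)..real (k+n)}) + emeasure lborel (B \<inter> {-real (k+n)..real (k+n)}))
      \<longlonglongrightarrow> emeasure lborel A + emeasure lborel B"
    by (intro tendsto_add lim) auto
  then show ?thesis
  proof (rule tendsto_upperbound)
    have "a0 \<in> A \<inter> {-real (k+n)..real (k+n)}" "b0 \<in> B \<inter> {-real (k+n)..real (k+n)}" for n
      using ab k by auto
    then show "\<forall>\<^sub>F n in sequentially. emeasure lborel (A \<inter> {-real (k+n)..real (k+n)}) +
        emeasure lborel (B \<inter> {-real (k+n)..real (k+n)}) \<le> 2 * emeasure lborel C"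
      by (intro always_eventually allI bounded_case) blast+
  qed simp
qed

lemma emeasure_below_ennreal: "emeasure lborel {t::real. 0 < t \<and> ennreal t < a} = a"
proof (cases a)
  case (real r)
  then have "{t::real. 0 < t \<and> ennreal t < a} = {0<..<r}"
    by (auto simp: ennreal_less_iff)
  then show ?thesis using real by simp
next
  case top
  then have *: "{t::real. 0 < t \<and> ennreal t < a} = {0<..}" by auto
  have "ennreal (real n) \<le> emeasure lborel {0::real<..}" for n :: nat
    using emeasure_mono[of "{0<..<real n}" "{0::real<..}" lborel] by (simp add: subset_eq)
  then have "(SUP n::nat. of_nat n) \<le> emeasure lborel {0::real<..}"
    by (intro SUP_least) (simp add: ennreal_of_nat_eq_real_of_nat)
  then have "emeasure lborel {0::real<..} = \<infinity>"
    by (simp add: ennreal_SUP_of_nat_eq_top top_unique)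
  then show ?thesis using * top by simp
qed

text \<open>
  The integral as the area under the graph, read off from the superlevel sets.
\<close>

lemma nn_integral_layer_cake:
  fixes f :: "'a \<Rightarrow> ennreal"
  assumes "sigma_finite_measure M" and [measurable]: "f \<in> borel_measurable M"
  shows "(\<integral>\<^sup>+x. f x \<partial>M) = (\<integral>\<^sup>+t. indicator {0<..} t * emeasure M {x\<in>space M. ennreal t < f x} \<partial>lborel)"
proof -
  interpret M: sigma_finite_measure M by fact
  interpret pair_sigma_finite M lborel by standard
  have "(\<integral>\<^sup>+x. f x \<partial>M) = (\<integral>\<^sup>+x. (\<integral>\<^sup>+t. indicator {t::real. 0 < t \<and> ennreal t < f x} t \<partial>lborel) \<partial>M)"
    by (intro nn_integral_cong) (simp add: emeasure_below_ennreal)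
  also have "\<dots> = (\<integral>\<^sup>+t. (\<integral>\<^sup>+x. indicator {t::real. 0 < t \<and> ennreal t < f x} t \<partial>M) \<partial>lborel)"
    by (rule Fubini'[symmetric]) measurable
  also have "\<dots> = (\<integral>\<^sup>+t. indicator {0<..} t * emeasure M {x\<in>space M. ennreal t < f x} \<partial>lborel)"
  proof (rule nn_integral_cong)
    fix t :: real
    have "(\<integral>\<^sup>+x. indicator {t::real. 0 < t \<and> ennreal t < f x} t \<partial>M) =
        (\<integral>\<^sup>+x. indicator {0<..} t * indicator {x\<in>space M. ennreal t < f x} x \<partial>M)"
      by (intro nn_integral_cong) (auto simp: indicator_def)
    then show "(\<integral>\<^sup>+x. indicator {t::real. 0 < t \<and> ennreal t < f x} t \<partial>M) = indicator {0<..} t * emeasure M {x\<in>space M. ennreal t < f x}"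
      by (simp add: nn_integral_cmult)
  qed
  finally show ?thesis .
qed

lemma four_mult_le_sum_sq_ennreal: "4 * (x * y) \<le> (x + y)^2" for x y :: ennreal
proof (cases "x = top \<or> y = top")
  case True
  then show ?thesis by (auto simp: power2_eq_square ennreal_top_mult)
next
  case False
  then obtain a b where ab: "x = ennreal a" "y = ennreal b" "0 \<le> a" "0 \<le> b"
    by (metis ennreal_cases)
  have "4 * (a * b) \<le> (a + b)^2"
    using zero_le_square[of "a - b"] by (simp add: power2_eq_square algebra_simps)
  then have "ennreal (4 * (a * b)) \<le> ennreal ((a + b)^2)" by (rule ennreal_leI)
  then show ?thesis using ab by (simp add: ennreal_mult ennreal_plus ennreal_power[symmetric] del: ennreal_plus add: ennreal_plus[symmetric])
qed

text \<open>
  When both suprema are \<open>1\<close>, every level \<open>t < 1\<close> is exceeded by both \<open>f\<close> and \<open>g\<close>, so the one-dimensional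
  midpoint inequality applies to their superlevel sets at the same level \<open>t\<close>. Integrating over \<open>t\<close> gives an
  arithmetic mean, which is stronger than the geometric mean claimed. The inequality is stated with
  squares so that it makes sense for values in \<open>ennreal\<close> without roots.
\<close>

lemma prekopa_leindler_normalized:
  fixes f g m :: "real \<Rightarrow> ennreal"
  assumes [measurable]: "f \<in> borel_measurable borel" "g \<in> borel_measurable borel" "m \<in> borel_measurable borel"
    and mid: "\<And>x y. f x * g y \<le> (m ((x + y) / 2))^2"
    and sup: "(SUP x. f x) = 1" "(SUP x. g x) = 1"
  shows "(\<integral>\<^sup>+x. f x \<partial>lborel) * (\<integral>\<^sup>+x. g x \<partial>lborel) \<le> (\<integral>\<^sup>+x. m x \<partial>lborel)^2"
proof -
  let ?I = "\<lambda>h. \<integral>\<^sup>+x. h x \<partial>(lborel::real measure)"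
  let ?E = "\<lambda>h t. emeasure lborel {x::real. ennreal t < h x}"
  have sf: "sigma_finite_measure (lborel::real measure)" by (rule sigma_finite_lborel)
  have lc: "?I h = (\<integral>\<^sup>+t. indicator {0<..} t * ?E h t \<partial>lborel)" if "h \<in> borel_measurable borel" for h
    using nn_integral_layer_cake[OF sf, of h] that by simp
  have "?I f + ?I g = (\<integral>\<^sup>+t. indicator {0<..} t * ?E f t + indicator {0<..} t * ?E g t \<partial>lborel)"
    by (subst (1 2) lc) (simp_all add: nn_integral_add)
  also have "\<dots> \<le> (\<integral>\<^sup>+t. 2 * (indicator {0<..} t * ?E m t) \<partial>lborel)"
  proof (rule nn_integral_mono)
    fix t :: real
    show "indicator {0<..} t * ?E f t + indicator {0<..} t * ?E g t \<le> 2 * (indicator {0<..} t * ?E m t)"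
    proof (cases "0 < t \<and> t < 1")
      case True
      have ne: "{x. ennreal t < f x} \<noteq> {}" "{x. ennreal t < g x} \<noteq> {}"
        using sup less_SUP_iff[of "ennreal t" f UNIV] less_SUP_iff[of "ennreal t" g UNIV] True
        by (auto simp: ennreal_less_one_iff)
      have "?E f t + ?E g t \<le> 2 * ?E m t"
      proof (rule emeasure_midpoint_real)
        fix a b assume "a \<in> {x. ennreal t < f x}" "b \<in> {x. ennreal t < g x}"
        then have "ennreal t < min (f a) (g b)" by simp
        then obtain z where z: "ennreal t < z" "z < min (f a) (g b)" using dense by blast
        then obtain t' where t': "z = ennreal t'" "0 \<le> t'"
          by (cases z) (auto simp: less_top[symmetric])
        then have "t < t'" using z(1) True by (simp add: ennreal_less_iff)
        then have "t * t < t' * t'" using True by (intro mult_strict_mono) auto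
        then have "ennreal t * ennreal t < z * z"
          using True t' by (simp add: ennreal_mult[symmetric] ennreal_less_iff)
        also have "z * z \<le> f a * g b" using z(2) by (intro mult_mono) auto
        also have "\<dots> \<le> (m ((a + b) / 2))^2" by (rule mid)
        finally have "(ennreal t)^2 < (m ((a + b) / 2))^2" by (simp add: power2_eq_square)
        then show "(a + b) / 2 \<in> {x. ennreal t < m x}"
          using power_mono[of "m ((a + b) / 2)" "ennreal t" 2] by (force simp: not_less[symmetric])
      qed (use ne in auto)
      then show ?thesis using True by simp
    next
      case False
      have "{x. ennreal t < f x} = {}" "{x. ennreal t < g x} = {}" if "t \<ge> 1"
      proof -
        have "1 \<le> ennreal t" using ennreal_leI[OF that] by simp
        then have "f x \<le> ennreal t" "g x \<le> ennreal t" for x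
          using order_trans[OF SUP_upper[of x UNIV f]] order_trans[OF SUP_upper[of x UNIV g]]
          unfolding sup by simp_all
        then show "{x. ennreal t < f x} = {}" "{x. ennreal t < g x} = {}"
          by (simp_all add: not_less)
      qed
      then show ?thesis using False by (auto simp: indicator_def)
    qed
  qed
  also have "\<dots> = 2 * ?I m" by (subst lc[of m], simp) (rule nn_integral_cmult, simp)
  finally have le: "?I f + ?I g \<le> 2 * ?I m" .
  have "4 * (?I f * ?I g) \<le> (?I f + ?I g)^2" by (rule four_mult_le_sum_sq_ennreal)
  also have "\<dots> \<le> (2 * ?I m)^2" by (rule power_mono[OF le]) simp
  also have "\<dots> = 4 * (?I m)^2" by (simp add: power_mult_distrib)
  finally show ?thesis by (simp add: ennreal_mult_le_mult_iff)
qed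

text \<open>
  Both sides scale in the same way, so bounded functions can be normalized; truncation at \<open>n\<close> and
  monotone convergence remove the bound.
\<close>

lemma prekopa_leindler_real:
  fixes f g m :: "real \<Rightarrow> ennreal"
  assumes [measurable]: "f \<in> borel_measurable borel" "g \<in> borel_measurable borel" "m \<in> borel_measurable borel"
    and mid: "\<And>x y. f x * g y \<le> (m ((x + y) / 2))^2"
  shows "(\<integral>\<^sup>+x. f x \<partial>lborel) * (\<integral>\<^sup>+x. g x \<partial>lborel) \<le> (\<integral>\<^sup>+x. m x \<partial>lborel)^2"
proof -
  let ?I = "\<lambda>h. \<integral>\<^sup>+x. h x \<partial>(lborel::real measure)"
  have bounded_case: "?I f * ?I g \<le> (?I m)^2"
    if [measurable]: "f \<in> borel_measurable borel" "g \<in> borel_measurable borel"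
      and fg: "\<And>x. f x \<le> of_nat n" "\<And>x. g x \<le> of_nat n"
      and mid: "\<And>x y. f x * g y \<le> (m ((x + y) / 2))^2" for f g n
  proof (cases "(SUP x. f x) = 0 \<or> (SUP x. g x) = 0")
    case True
    then have "(\<forall>x. f x = 0) \<or> (\<forall>x. g x = 0)"
      by (metis SUP_upper UNIV_I le_zero_eq)
    then show ?thesis by auto
  next
    case False
    have "(SUP x. f x) \<le> of_nat n" "(SUP x. g x) \<le> of_nat n" using fg by (auto intro: SUP_least)
    then have "(SUP x. f x) < top" "(SUP x. g x) < top"
      by (auto intro: le_less_trans of_nat_less_top)
    then obtain a b where ab: "(SUP x. f x) = ennreal a" "(SUP x. g x) = ennreal b" "a > 0" "b > 0"
      using False by (metis ennreal_cases ennreal_0 less_irrefl order_le_less)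
    define c where "c = sqrt (a * b)"
    have c: "c > 0" "c^2 = a * b" using ab by (auto simp: c_def)
    let ?s = "\<lambda>r. ennreal (1 / r)"
    have sq: "(?s c)^2 = ?s a * ?s b"
      using ab c by (simp add: ennreal_power ennreal_mult[symmetric] power_one_over power_divide)
    have "?I (\<lambda>x. ?s a * f x) * ?I (\<lambda>x. ?s b * g x) \<le> (?I (\<lambda>x. ?s c * m x))^2"
    proof (rule prekopa_leindler_normalized)
      fix x y
      have "?s a * f x * (?s b * g y) = (?s c)^2 * (f x * g y)" by (simp add: sq ac_simps)
      also have "\<dots> \<le> (?s c)^2 * (m ((x + y) / 2))^2" by (intro mult_left_mono mid) simp
      finally show "?s a * f x * (?s b * g y) \<le> (?s c * m ((x + y) / 2))^2"
        by (simp add: power_mult_distrib)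
    next
      show "(SUP x. ?s a * f x) = 1"
        using ab by (simp add: SUP_mult_left_ennreal[symmetric] ennreal_mult[symmetric])
      show "(SUP x. ?s b * g x) = 1"
        using ab by (simp add: SUP_mult_left_ennreal[symmetric] ennreal_mult[symmetric])
    qed auto
    moreover have "?I (\<lambda>x. e * h x) = e * ?I h" if "h \<in> borel_measurable borel" for e h
      using that by (intro nn_integral_cmult) simp
    ultimately have "?s a * ?I f * (?s b * ?I g) \<le> (?s c * ?I m)^2" using that(1,2) assms(3) by simp
    then have "(?s c)^2 * (?I f * ?I g) \<le> (?s c)^2 * (?I m)^2"
      by (simp add: power_mult_distrib sq ac_simps)
    moreover have "(?s c)^2 \<noteq> 0" "(?s c)^2 \<noteq> top" using c by (auto simp: ennreal_power)
    ultimately show ?thesis by (simp add: ennreal_mult_le_mult_iff)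
  qed
  have lim: "?I h = (SUP n. ?I (\<lambda>x. min (h x) (of_nat n)))"
    and inc: "incseq (\<lambda>n. ?I (\<lambda>x. min (h x) (of_nat n)))"
    if [measurable]: "h \<in> borel_measurable borel" for h
  proof -
    have "h x = (SUP n. min (h x) (of_nat n))" for x
    proof -
      have "(SUP n::nat. min (h x) (of_nat n)) = min (h x) (SUP n. of_nat n)"
        by (simp add: inf_min[symmetric] inf_SUP)
      then show ?thesis by (simp add: ennreal_SUP_of_nat_eq_top)
    qed
    then have "?I h = ?I (\<lambda>x. SUP n. min (h x) (of_nat n))" by simp
    also have "\<dots> = (SUP n. ?I (\<lambda>x. min (h x) (of_nat n)))"
      by (rule nn_integral_monotone_convergence_SUP) (auto simp: incseq_def le_fun_def min.coboundedI2)
    finally show "?I h = (SUP n. ?I (\<lambda>x. min (h x) (of_nat n)))" .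
    show "incseq (\<lambda>n. ?I (\<lambda>x. min (h x) (of_nat n)))"
      by (intro monoI nn_integral_mono min.mono order_refl of_nat_mono)
  qed
  have trunc: "?I (\<lambda>x. min (f x) (of_nat n)) * ?I (\<lambda>x. min (g x) (of_nat n)) \<le> (?I m)^2" for n :: nat
  proof (rule bounded_case[of _ _ n])
    fix x y
    have "min (f x) (of_nat n) * min (g y) (of_nat n) \<le> f x * g y" by (intro mult_mono) auto
    then show "min (f x) (of_nat n) * min (g y) (of_nat n) \<le> (m ((x + y) / 2))^2"
      using mid[of x y] by (rule order_trans)
  qed auto
  have "?I (\<lambda>x. min (f x) (of_nat n)) * ?I (\<lambda>x. min (g x) (of_nat k)) \<le> (?I m)^2" for n k :: nat
  proof -
    have "?I (\<lambda>x. min (f x) (of_nat n)) * ?I (\<lambda>x. min (g x) (of_nat k)) \<le>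
        ?I (\<lambda>x. min (f x) (of_nat (max n k))) * ?I (\<lambda>x. min (g x) (of_nat (max n k)))"
      using incseqD[OF inc[OF assms(1)], of n "max n k"] incseqD[OF inc[OF assms(2)], of k "max n k"]
      by (intro mult_mono) auto
    then show ?thesis using trunc[of "max n k"] by (rule order_trans)
  qed
  then have "?I (\<lambda>x. min (f x) (of_nat n)) * ?I g \<le> (?I m)^2" for n :: nat
    by (subst lim[OF assms(2)], subst SUP_mult_left_ennreal) (rule SUP_least)
  then show ?thesis
    by (subst lim[OF assms(1)], subst SUP_mult_right_ennreal) (rule SUP_least)
qed

text \<open>
  The inequality tensorizes: integrating out the coordinates in \<open>I\<close> produces three functions of the
  remaining coordinate that satisfy the hypothesis of the one-dimensional case, by induction.
\<close>

lemma prekopa_leindler_PiM: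
  fixes f g m :: "('i \<Rightarrow> real) \<Rightarrow> ennreal"
  assumes "finite I"
    and "f \<in> borel_measurable (PiM I (\<lambda>_. lborel))" "g \<in> borel_measurable (PiM I (\<lambda>_. lborel))"
      "m \<in> borel_measurable (PiM I (\<lambda>_. lborel))"
    and "\<And>x y. x \<in> extensional I \<Longrightarrow> y \<in> extensional I \<Longrightarrow> f x * g y \<le> (m (\<lambda>i\<in>I. (x i + y i) / 2))^2"
  shows "(\<integral>\<^sup>+x. f x \<partial>PiM I (\<lambda>_. lborel)) * (\<integral>\<^sup>+x. g x \<partial>PiM I (\<lambda>_. lborel))
    \<le> (\<integral>\<^sup>+x. m x \<partial>PiM I (\<lambda>_. lborel))^2"
  using assms
proof (induction I arbitrary: f g m rule: finite_induct)
  case empty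
  have "f (\<lambda>_. undefined) * g (\<lambda>_. undefined) \<le> (m (\<lambda>i\<in>{}. undefined))^2"
    using empty(4)[of "\<lambda>_. undefined" "\<lambda>_. undefined"] by (simp add: restrict_def)
  then show ?case
    by (simp add: nn_integral_empty restrict_def PiM_empty nn_integral_count_space_finite)
next
  case (insert i I)
  interpret product_sigma_finite "\<lambda>_::'i. lborel :: real measure" ..
  note [measurable] = insert.prems(1-3)
  have [measurable]: "(\<lambda>x. h (x(i := s))) \<in> borel_measurable (PiM I (\<lambda>_. lborel))"
    if [measurable]: "h \<in> borel_measurable (PiM (insert i I) (\<lambda>_. lborel))"
    for h :: "('i \<Rightarrow> real) \<Rightarrow> ennreal" and s
    by measurable
  have meas: "(\<lambda>s. \<integral>\<^sup>+x. h (x(i := s)) \<partial>PiM I (\<lambda>_. lborel)) \<in> borel_measurable borel"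
    if [measurable]: "h \<in> borel_measurable (PiM (insert i I) (\<lambda>_. lborel))" for h :: "('i \<Rightarrow> real) \<Rightarrow> ennreal"
  proof -
    interpret I: finite_product_sigma_finite "\<lambda>_. lborel" I by standard (rule insert.hyps)
    have "(\<lambda>s. \<integral>\<^sup>+x. h (x(i := s)) \<partial>PiM I (\<lambda>_. lborel)) \<in> borel_measurable lborel" by measurable
    then show ?thesis by simp
  qed
  have "(\<integral>\<^sup>+s. (\<integral>\<^sup>+x. f (x(i := s)) \<partial>PiM I (\<lambda>_. lborel)) \<partial>lborel) *
        (\<integral>\<^sup>+s. (\<integral>\<^sup>+x. g (x(i := s)) \<partial>PiM I (\<lambda>_. lborel)) \<partial>lborel)
     \<le> (\<integral>\<^sup>+s. (\<integral>\<^sup>+x. m (x(i := s)) \<partial>PiM I (\<lambda>_. lborel)) \<partial>lborel)^2"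
  proof (rule prekopa_leindler_real)
    fix s t :: real
    show "(\<integral>\<^sup>+x. f (x(i := s)) \<partial>PiM I (\<lambda>_. lborel)) * (\<integral>\<^sup>+x. g (x(i := t)) \<partial>PiM I (\<lambda>_. lborel))
      \<le> (\<integral>\<^sup>+x. m (x(i := (s + t) / 2)) \<partial>PiM I (\<lambda>_. lborel))^2"
    proof (rule insert.IH)
      fix x y :: "'i \<Rightarrow> real" assume "x \<in> extensional I" "y \<in> extensional I"
      then have "f (x(i := s)) * g (y(i := t))
          \<le> (m (\<lambda>j\<in>insert i I. ((x(i := s)) j + (y(i := t)) j) / 2))^2"
        by (intro insert.prems(4)) (auto simp: extensional_def)
      also have "(\<lambda>j\<in>insert i I. ((x(i := s)) j + (y(i := t)) j) / 2) =
          (\<lambda>j\<in>I. (x j + y j) / 2)(i := (s + t) / 2)"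
        using insert.hyps by (auto simp: restrict_def fun_eq_iff)
      finally show "f (x(i := s)) * g (y(i := t)) \<le> (m ((\<lambda>j\<in>I. (x j + y j) / 2)(i := (s + t) / 2)))^2" .
    qed measurable
  qed (auto intro!: meas)
  then show ?case
    using insert.hyps by (simp add: product_nn_integral_insert_rev)
qed

lemma prekopa_leindler:
  fixes f g m :: "'a::euclidean_space \<Rightarrow> ennreal"
  assumes [measurable]: "f \<in> borel_measurable borel" "g \<in> borel_measurable borel" "m \<in> borel_measurable borel"
    and mid: "\<And>x y. f x * g y \<le> (m ((x + y) /\<^sub>R 2))^2"
  shows "(\<integral>\<^sup>+x. f x \<partial>lborel) * (\<integral>\<^sup>+x. g x \<partial>lborel) \<le> (\<integral>\<^sup>+x. m x \<partial>lborel)^2"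
proof -
  let ?P = "PiM (Basis::'a set) (\<lambda>_. lborel :: real measure)"
  let ?\<phi> = "\<lambda>x. \<Sum>b\<in>Basis. x b *\<^sub>R b :: 'a"
  have [measurable]: "?\<phi> \<in> measurable ?P borel" by measurable
  have tr: "(\<integral>\<^sup>+x. h x \<partial>lborel) = (\<integral>\<^sup>+x. h (?\<phi> x) \<partial>?P)"
    if [measurable]: "h \<in> borel_measurable borel" for h
    by (subst lborel_eq, subst nn_integral_distr) auto
  show ?thesis unfolding tr[OF assms(1)] tr[OF assms(2)] tr[OF assms(3)]
  proof (rule prekopa_leindler_PiM)
    fix x y :: "'a \<Rightarrow> real"
    have "?\<phi> (\<lambda>i\<in>Basis. (x i + y i) / 2) = (?\<phi> x + ?\<phi> y) /\<^sub>R 2"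
      by (simp add: scaleR_sum_right sum.distrib[symmetric] scaleR_add_left[symmetric] cong: sum.cong)
    then show "f (?\<phi> x) * g (?\<phi> y) \<le> (m (?\<phi> (\<lambda>i\<in>Basis. (x i + y i) / 2)))^2"
      using mid by simp
  qed auto
qed

lemma brunn_minkowski_midpoint:
  fixes A B C :: "'a::euclidean_space set"
  assumes [measurable]: "A \<in> sets borel" "B \<in> sets borel" "C \<in> sets borel"
    and mid: "\<And>a b. a \<in> A \<Longrightarrow> b \<in> B \<Longrightarrow> (a + b) /\<^sub>R 2 \<in> C"
  shows "emeasure lborel A * emeasure lborel B \<le> (emeasure lborel C)^2"
proof -
  have "(\<integral>\<^sup>+x. indicator A x \<partial>lborel) * (\<integral>\<^sup>+x. indicator B x \<partial>lborel) \<le> (\<integral>\<^sup>+x. indicator C x \<partial>lborel)^2"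
    by (rule prekopa_leindler) (auto simp: indicator_def intro: mid[unfolded inverse_eq_divide])
  then show ?thesis by simp
qed

text \<open>
  The multiplicative form of the inequality, which is all that is needed for bodies of equal volume.
\<close>

lemma brunn_minkowski_measure:
  fixes A B C :: "'a::euclidean_space set"
  assumes "A \<in> fmeasurable lborel" "B \<in> fmeasurable lborel" "C \<in> fmeasurable lborel"
    and mid: "\<And>a b. a \<in> A \<Longrightarrow> b \<in> B \<Longrightarrow> (a + b) /\<^sub>R 2 \<in> C"
  shows "measure lborel A * measure lborel B \<le> (measure lborel C)^2"
proof -
  have "emeasure lborel A * emeasure lborel B \<le> (emeasure lborel C)^2"
    using assms fmeasurableD by (intro brunn_minkowski_midpoint) auto
  then show ?thesis
    using assms(1-3) by (simp add: emeasure_eq_measure2 ennreal_mult[symmetric] ennreal_power)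
qed

section \<open>Slices of a convex body by parallel hyperplanes\<close>

text \<open>
  The right prism of height \<open>1\<close> over the slice of \<open>A\<close> at level \<open>s\<close> (for a unit vector \<open>u\<close>), moved to the
  slab between the levels \<open>0\<close> and \<open>1\<close>. Its volume is the \<open>(d-1)\<close>-area of the slice. Prisms let
  statements about slices be derived from statements about volumes in the ambient space, without
  choosing coordinates on the hyperplanes.
\<close>

definition slice_prism :: "'a::euclidean_space \<Rightarrow> 'a set \<Rightarrow> real \<Rightarrow> 'a set" where
  "slice_prism u A s = {y. 0 \<le> u \<bullet> y \<and> u \<bullet> y \<le> 1 \<and> y + (s - u \<bullet> y) *\<^sub>R u \<in> A}"

lemma measurable_slice_prism:
  assumes [measurable]: "A \<in> sets borel"
  shows "slice_prism u A s \<in> sets borel"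
    and "(\<lambda>s. emeasure lborel (slice_prism u A s)) \<in> borel_measurable borel"
proof -
  have [measurable]: "{x\<in>space (borel \<Otimes>\<^sub>M borel). snd x + (fst x - u \<bullet> snd x) *\<^sub>R u \<in> A} \<in> sets (borel \<Otimes>\<^sub>M borel)"
    by measurable
  show meas: "slice_prism u A s \<in> sets borel" for s unfolding slice_prism_def by measurable
  have "(\<lambda>s. \<integral>\<^sup>+y. indicator {x. 0 \<le> u \<bullet> snd x \<and> u \<bullet> snd x \<le> 1 \<and> snd x + (fst x - u \<bullet> snd x) *\<^sub>R u \<in> A} (s, y) \<partial>lborel)
      \<in> borel_measurable borel"
    by measurable
  also have "(\<lambda>s. \<integral>\<^sup>+y. indicator {x. 0 \<le> u \<bullet> snd x \<and> u \<bullet> snd x \<le> 1 \<and> snd x + (fst x - u \<bullet> snd x) *\<^sub>R u \<in> A} (s, y) \<partial>lborel)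
    = (\<lambda>s. \<integral>\<^sup>+y. indicator (slice_prism u A s) y \<partial>lborel)"
    by (intro ext nn_integral_cong) (auto simp: slice_prism_def indicator_def)
  also have "\<dots> = (\<lambda>s. emeasure lborel (slice_prism u A s))"
    by (intro ext nn_integral_indicator) (use meas in auto)
  finally show "(\<lambda>s. emeasure lborel (slice_prism u A s)) \<in> borel_measurable borel" .
qed

lemma nn_integral_lborel_shift:
  fixes f :: "'a::euclidean_space \<Rightarrow> ennreal"
  assumes [measurable]: "f \<in> borel_measurable borel"
  shows "(\<integral>\<^sup>+x. f x \<partial>lborel) = (\<integral>\<^sup>+x. f (c + x) \<partial>lborel)"
  by (subst lborel_distr_plus[symmetric, of c], subst nn_integral_distr) auto

text \<open>
  Cavalieri's principle in the direction \<open>u\<close>. It follows from Tonelli's theorem and translation invariance: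
  the points \<open>y\<close> and \<open>z = y + s u\<close> are exchanged, and each \<open>z\<close> is seen from a set of levels \<open>s\<close> of length \<open>1\<close>.
\<close>

lemma nn_integral_slices:
  fixes A :: "'a::euclidean_space set"
  assumes u: "norm u = 1" and [measurable]: "A \<in> sets borel" "\<phi> \<in> borel_measurable borel"
  shows "(\<integral>\<^sup>+y. \<phi> (u \<bullet> y) * indicator A y \<partial>lborel) = (\<integral>\<^sup>+s. \<phi> s * emeasure lborel (slice_prism u A s) \<partial>lborel)"
proof -

  have uu: "u \<bullet> u = 1" using u by (simp add: dot_square_norm)
  let ?J = "\<lambda>t. indicator {0..1} t :: ennreal"
  have "(\<integral>\<^sup>+s. \<phi> s * emeasure lborel (slice_prism u A s) \<partial>lborel)
     = (\<integral>\<^sup>+s. (\<integral>\<^sup>+y. \<phi> s * (?J (u \<bullet> y) * indicator A (y + (s - u \<bullet> y) *\<^sub>R u)) \<partial>lborel) \<partial>lborel)"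
  proof (rule nn_integral_cong)
    fix s
    have "emeasure lborel (slice_prism u A s) = (\<integral>\<^sup>+y. indicator (slice_prism u A s) y \<partial>lborel)"
      using measurable_slice_prism(1)[of A u s] by simp
    also have "\<dots> = (\<integral>\<^sup>+y. ?J (u \<bullet> y) * indicator A (y + (s - u \<bullet> y) *\<^sub>R u) \<partial>lborel)"
      by (intro nn_integral_cong) (auto simp: slice_prism_def indicator_def)
    finally show "\<phi> s * emeasure lborel (slice_prism u A s) =
        (\<integral>\<^sup>+y. \<phi> s * (?J (u \<bullet> y) * indicator A (y + (s - u \<bullet> y) *\<^sub>R u)) \<partial>lborel)"
      by (subst nn_integral_cmult) auto
  qed
  also have "\<dots> = (\<integral>\<^sup>+y. (\<integral>\<^sup>+s. \<phi> s * (?J (u \<bullet> y) * indicator A (y + (s - u \<bullet> y) *\<^sub>R u)) \<partial>lborel) \<partial>lborel)"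
    by (rule lborel_pair.Fubini'[symmetric]) measurable
  also have "\<dots> = (\<integral>\<^sup>+y. (\<integral>\<^sup>+s. \<phi> (u \<bullet> y + s) * (?J (u \<bullet> y) * indicator A (y + s *\<^sub>R u)) \<partial>lborel) \<partial>lborel)"
  proof (rule nn_integral_cong)
    fix y
    show "(\<integral>\<^sup>+s. \<phi> s * (?J (u \<bullet> y) * indicator A (y + (s - u \<bullet> y) *\<^sub>R u)) \<partial>lborel) =
       (\<integral>\<^sup>+s. \<phi> (u \<bullet> y + s) * (?J (u \<bullet> y) * indicator A (y + s *\<^sub>R u)) \<partial>lborel)"
      by (subst nn_integral_lborel_shift[where c="u \<bullet> y"]) auto
  qed
  also have "\<dots> = (\<integral>\<^sup>+s. (\<integral>\<^sup>+y. \<phi> (u \<bullet> y + s) * (?J (u \<bullet> y) * indicator A (y + s *\<^sub>R u)) \<partial>lborel) \<partial>lborel)"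
    by (rule lborel_pair.Fubini') measurable
  \<comment> \<open>Substituting \<open>z = y + s u\<close> turns the height condition on \<open>y\<close> into a condition on \<open>s\<close>.\<close>
  also have "\<dots> = (\<integral>\<^sup>+s. (\<integral>\<^sup>+y. \<phi> (u \<bullet> y) * (indicator {u \<bullet> y - 1..u \<bullet> y} s * indicator A y) \<partial>lborel) \<partial>lborel)"
  proof (rule nn_integral_cong)
    fix s
    have "(\<integral>\<^sup>+y. \<phi> (u \<bullet> y + s) * (?J (u \<bullet> y) * indicator A (y + s *\<^sub>R u)) \<partial>lborel) =
       (\<integral>\<^sup>+y. \<phi> (u \<bullet> (- s *\<^sub>R u + y) + s) * (?J (u \<bullet> (- s *\<^sub>R u + y)) * indicator A ((- s *\<^sub>R u + y) + s *\<^sub>R u)) \<partial>lborel)"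
      by (rule nn_integral_lborel_shift) measurable
    also have "\<dots> = (\<integral>\<^sup>+y. \<phi> (u \<bullet> y) * (indicator {u \<bullet> y - 1..u \<bullet> y} s * indicator A y) \<partial>lborel)"
      by (intro nn_integral_cong) (auto simp: inner_diff_right inner_add_right uu indicator_def)
    finally show "(\<integral>\<^sup>+y. \<phi> (u \<bullet> y + s) * (?J (u \<bullet> y) * indicator A (y + s *\<^sub>R u)) \<partial>lborel) =
       (\<integral>\<^sup>+y. \<phi> (u \<bullet> y) * (indicator {u \<bullet> y - 1..u \<bullet> y} s * indicator A y) \<partial>lborel)" .
  qed
  also have "\<dots> = (\<integral>\<^sup>+y. (\<integral>\<^sup>+s. \<phi> (u \<bullet> y) * (indicator {u \<bullet> y - 1..u \<bullet> y} s * indicator A y) \<partial>lborel) \<partial>lborel)"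
  proof (rule lborel_pair.Fubini'[symmetric])
    have "(\<lambda>(s, y). indicator {u \<bullet> y - 1..u \<bullet> y} s :: ennreal) = (\<lambda>(s, y). ?J (u \<bullet> y - s))"
      by (auto simp: indicator_def fun_eq_iff)
    then have [measurable]: "(\<lambda>(s, y). indicator {u \<bullet> y - 1..u \<bullet> y} s :: ennreal) \<in> borel_measurable (lborel \<Otimes>\<^sub>M lborel)"
      by simp
    show "(\<lambda>(s, y). \<phi> (u \<bullet> y) * (indicator {u \<bullet> y - 1..u \<bullet> y} s * indicator A y)) \<in> borel_measurable (lborel \<Otimes>\<^sub>M lborel)"
      by measurable
  qed
  also have "\<dots> = (\<integral>\<^sup>+y. \<phi> (u \<bullet> y) * indicator A y \<partial>lborel)"
  proof (rule nn_integral_cong)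
    fix y
    have "(\<integral>\<^sup>+s. \<phi> (u \<bullet> y) * (indicator {u \<bullet> y - 1..u \<bullet> y} s * indicator A y) \<partial>lborel) =
      (\<integral>\<^sup>+s. \<phi> (u \<bullet> y) * indicator A y * indicator {u \<bullet> y - 1..u \<bullet> y} s \<partial>lborel)"
      by (simp add: ac_simps)
    also have "\<dots> = \<phi> (u \<bullet> y) * indicator A y * emeasure lborel {u \<bullet> y - 1..u \<bullet> y}"
      by (rule nn_integral_cmult_indicator) simp
    finally show "(\<integral>\<^sup>+s. \<phi> (u \<bullet> y) * (indicator {u \<bullet> y - 1..u \<bullet> y} s * indicator A y) \<partial>lborel) = \<phi> (u \<bullet> y) * indicator A y"
      by simp
  qed
  finally show ?thesis by simp
qed

lemma norm_slice_prism_le: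
  assumes "\<And>x. x \<in> A \<Longrightarrow> norm x \<le> B" and y: "y \<in> slice_prism u A s"
  shows "norm y \<le> B + (\<bar>s\<bar> + 1) * norm u"
proof -
  have "norm y \<le> norm (y + (s - u \<bullet> y) *\<^sub>R u) + norm ((s - u \<bullet> y) *\<^sub>R u)"
    by (metis add_diff_cancel_right' norm_triangle_ineq4)
  also have "\<dots> \<le> B + (\<bar>s\<bar> + 1) * norm u"
    unfolding norm_scaleR using y by (intro add_mono assms(1) mult_right_mono) (auto simp: slice_prism_def)
  finally show ?thesis .
qed

lemma compact_slice_prism:
  assumes A: "compact A"
  shows "compact (slice_prism u A s)"
proof -
  obtain B where B: "\<And>x. x \<in> A \<Longrightarrow> norm x \<le> B" using compact_imp_bounded[OF A] by (auto simp: bounded_iff)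
  have "bounded (slice_prism u A s)"
    unfolding bounded_iff by (intro exI[of _ "B + (\<bar>s\<bar> + 1) * norm u"] ballI norm_slice_prism_le[of A] B)
  moreover have "closed (slice_prism u A s)"
  proof -
    have "closed ((\<lambda>y. y + (s - u \<bullet> y) *\<^sub>R u) -` A)"
      using compact_imp_closed[OF A] by (intro closed_vimage) (auto intro!: continuous_intros)
    moreover have "slice_prism u A s = {y. 0 \<le> u \<bullet> y} \<inter> {y. u \<bullet> y \<le> 1} \<inter> (\<lambda>y. y + (s - u \<bullet> y) *\<^sub>R u) -` A"
      by (auto simp: slice_prism_def)
    ultimately show ?thesis by (auto intro!: closed_Int closed_halfspace_le closed_halfspace_ge)
  qed
  ultimately show ?thesis by (simp add: compact_eq_bounded_closed)
qed

lemma emeasure_compact_eq_measure: "compact A \<Longrightarrow> emeasure lborel A = ennreal (measure lborel A)"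
  using emeasure_compact_finite[of A] by (intro emeasure_eq_ennreal_measure) auto

lemma measure_compact_mono: "compact A \<Longrightarrow> compact B \<Longrightarrow> A \<subseteq> B \<Longrightarrow> measure lborel A \<le> measure lborel B"
  by (intro measure_mono_fmeasurable) (auto simp: fmeasurable_compact borel_compact)

lemma measure_homothety:
  fixes A :: "'a::euclidean_space set"
  assumes "compact A" shows "measure lborel ((\<lambda>y. m *\<^sub>R y + c) ` A) = \<bar>m\<bar> ^ DIM('a) * measure lborel A"
proof -
  have "compact ((\<lambda>y. m *\<^sub>R y + c) ` A)" using assms by (intro compact_continuous_image continuous_intros)
  then show ?thesis
    using measure_lebesgue_affine[of m c A] assms
    by (simp add: measure_completion borel_compact)
qed

lemma measure_open_pos:
  fixes S :: "'a::euclidean_space set"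
  assumes "open U" "U \<noteq> {}" "U \<subseteq> S" "compact S"
  shows "0 < measure lborel S"
proof (rule ccontr)
  assume "\<not> 0 < measure lborel S"
  then have "emeasure lborel S = 0" using emeasure_compact_eq_measure[OF \<open>compact S\<close>] by (simp add: not_less ennreal_neg)
  then have "emeasure lborel U = 0"
    using emeasure_mono[OF \<open>U \<subseteq> S\<close>, of lborel] \<open>compact S\<close> by (simp add: borel_compact)
  then have "U \<in> null_sets lborel" using \<open>open U\<close> by (simp add: null_sets_def)
  then have "negligible U" by (simp add: negligible_iff_null_sets null_sets_completionI)
  then show False using open_not_negligible assms by blast
qed

text \<open>
  All measurements of a convex body are taken in one direction \<open>u\<close>. The function \<open>quantile\<close> parametrizes the
  levels by the volume below them, which makes bodies of equal volume comparable.
\<close>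

locale body_in_direction =
  fixes u :: "'a::euclidean_space" and A :: "'a set"
  assumes unit: "norm u = 1" and convex: "convex A" and compact: "compact A" and solid: "interior A \<noteq> {}"
begin

definition lo where "lo = Inf ((\<bullet>) u ` A)"
definition hi where "hi = Sup ((\<bullet>) u ` A)"
definition vol where "vol = measure lborel A"
definition slice where "slice s = measure lborel (slice_prism u A s)"
definition below where "below s = measure lborel (A \<inter> {y. u \<bullet> y \<le> s})"
definition quantile where "quantile = inv_into {lo<..<hi} below"

lemma uu: "u \<bullet> u = 1" using unit by (simp add: dot_square_norm)

lemma nonempty: "A \<noteq> {}" using solid by auto

lemma heights_compact: "Topological_Spaces.compact ((\<bullet>) u ` A)"
  by (intro compact_continuous_image compact continuous_intros)

lemma lo_le: "a \<in> A \<Longrightarrow> lo \<le> u \<bullet> a" and le_hi: "a \<in> A \<Longrightarrow> u \<bullet> a \<le> hi"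
  unfolding lo_def hi_def using compact_imp_bounded[OF heights_compact]
  by (auto intro!: cInf_lower cSup_upper simp: bounded_imp_bdd_below bounded_imp_bdd_above)

lemma lo_attained: "\<exists>a\<in>A. u \<bullet> a = lo" and hi_attained: "\<exists>a\<in>A. u \<bullet> a = hi"
proof -
  have "lo \<in> (\<bullet>) u ` A" unfolding lo_def using heights_compact nonempty
    by (intro closed_contains_Inf) (auto simp: compact_imp_closed intro: bounded_imp_bdd_below compact_imp_bounded)
  then show "\<exists>a\<in>A. u \<bullet> a = lo" by auto
  have "hi \<in> (\<bullet>) u ` A" unfolding hi_def using heights_compact nonempty
    by (intro closed_contains_Sup) (auto simp: compact_imp_closed intro: bounded_imp_bdd_above compact_imp_bounded)
  then show "\<exists>a\<in>A. u \<bullet> a = hi" by auto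
qed

lemma compact_prism: "Topological_Spaces.compact (slice_prism u A s)"
  by (rule compact_slice_prism[OF compact])

lemma emeasure_prism: "emeasure lborel (slice_prism u A s) = ennreal (slice s)"
  unfolding slice_def by (rule emeasure_compact_eq_measure[OF compact_prism])

lemma slice_nonneg: "0 \<le> slice s" by (simp add: slice_def)

lemma interior_height:
  obtains s where "lo < s" "s < hi" "0 < slice s"
proof -
  obtain p where "p \<in> interior A" using solid by auto
  then obtain e where e: "0 < e" "ball p e \<subseteq> A" by (meson mem_interior)
  define s where "s = u \<bullet> p"
  have "p + (e/2) *\<^sub>R u \<in> A" "p - (e/2) *\<^sub>R u \<in> A"
    using e unit by (auto intro!: subsetD[OF e(2)] simp: dist_norm)
  from le_hi[OF this(1)] lo_le[OF this(2)] have "lo < s" "s < hi"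
    using e by (auto simp: s_def inner_add_right inner_diff_right uu)
  let ?U = "{y. 0 < u \<bullet> y} \<inter> {y. u \<bullet> y < 1} \<inter> (\<lambda>y. y + (s - u \<bullet> y) *\<^sub>R u) -` ball p e"
  have "open ?U"
    by (intro open_Int open_halfspace_lt open_halfspace_gt open_vimage) (auto intro!: continuous_intros)
  moreover have "p + (1/2 - s) *\<^sub>R u \<in> ?U" using e by (simp add: inner_add_right uu s_def dist_norm algebra_simps)
  then have "?U \<noteq> {}" by blast
  moreover have "?U \<subseteq> slice_prism u A s" using e(2) by (auto simp: slice_prism_def)
  ultimately have "0 < slice s" unfolding slice_def
    by (intro measure_open_pos compact_prism)
  then show thesis using that \<open>lo < s\<close> \<open>s < hi\<close> by blast
qed

text \<open>
  By convexity the body contains a copy of the slice at level \<open>s\<close>, shrunk towards any of its points \<open>b\<close>.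
  The prism shrinks in all \<open>d\<close> directions, so the exponent is one more than optimal; only continuity and
  positivity of the slice area are drawn from this.
\<close>

lemma slice_homothety:
  assumes b: "b \<in> A" "u \<bullet> b = t" and l: "0 \<le> l" "l \<le> 1" and s': "s' = (1 - l) * s + l * t"
  shows "(1 - l) ^ DIM('a) * slice s \<le> slice s'"
proof -
  let ?f = "\<lambda>y. (1 - l) *\<^sub>R y + l *\<^sub>R (b - t *\<^sub>R u)"
  have "?f ` slice_prism u A s \<subseteq> slice_prism u A s'"
  proof
    fix z assume "z \<in> ?f ` slice_prism u A s"
    then obtain y where y: "y \<in> slice_prism u A s" "z = ?f y" by auto
    have uz: "u \<bullet> z = (1 - l) * (u \<bullet> y)"
      using b by (simp add: y(2) inner_add_right inner_diff_right uu)
    have "z + (s' - u \<bullet> z) *\<^sub>R u = (1 - l) *\<^sub>R (y + (s - u \<bullet> y) *\<^sub>R u) + l *\<^sub>R b"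
      unfolding uz s' unfolding y(2) by (simp add: algebra_simps)
    also have "\<dots> \<in> A" using convex y(1) b l unfolding slice_prism_def by (intro convexD) auto
    finally have "z + (s' - u \<bullet> z) *\<^sub>R u \<in> A" .
    moreover have "0 \<le> u \<bullet> z" "u \<bullet> z \<le> 1"
      using y(1) l unfolding uz by (auto simp: slice_prism_def intro: mult_le_one)
    ultimately show "z \<in> slice_prism u A s'" by (simp add: slice_prism_def)
  qed
  then have "measure lborel (?f ` slice_prism u A s) \<le> slice s'"
    unfolding slice_def by (intro measure_compact_mono compact_continuous_image compact_prism continuous_intros)
  then show ?thesis
    using l by (simp add: measure_homothety[OF compact_prism] slice_def)
qed

lemma slice_ratio:
  assumes s: "lo < s" "s < hi" and t: "lo < t" "t < hi"
  shows "min ((hi - t) / (hi - s)) ((t - lo) / (s - lo)) ^ DIM('a) * slice s \<le> slice t"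
proof (cases "s \<le> t")
  case True
  obtain b where b: "b \<in> A" "u \<bullet> b = hi" using hi_attained by auto
  define l where "l = (t - s) / (hi - s)"
  have l: "0 \<le> l" "l \<le> 1" "1 - l = (hi - t) / (hi - s)" using s t True by (auto simp: l_def field_simps)
  have "l * (hi - s) = t - s" using s by (simp add: l_def)
  then have "t = (1 - l) * s + l * hi" by (simp add: algebra_simps)
  from slice_homothety[OF b l(1,2) this] have "((hi - t) / (hi - s)) ^ DIM('a) * slice s \<le> slice t"
    by (simp add: l(3))
  moreover have "min ((hi - t) / (hi - s)) ((t - lo) / (s - lo)) = (hi - t) / (hi - s)"
  proof (rule min_absorb1)
    have "(hi - t) / (hi - s) \<le> 1" "1 \<le> (t - lo) / (s - lo)" using True s t by simp_all
    then show "(hi - t) / (hi - s) \<le> (t - lo) / (s - lo)" by linarith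
  qed
  ultimately show ?thesis by simp
next
  case False
  obtain b where b: "b \<in> A" "u \<bullet> b = lo" using lo_attained by auto
  define l where "l = (s - t) / (s - lo)"
  have l: "0 \<le> l" "l \<le> 1" "1 - l = (t - lo) / (s - lo)" using s t False by (auto simp: l_def field_simps)
  have "l * (s - lo) = s - t" using s by (simp add: l_def)
  then have "t = (1 - l) * s + l * lo" by (simp add: algebra_simps)
  from slice_homothety[OF b l(1,2) this] have "((t - lo) / (s - lo)) ^ DIM('a) * slice s \<le> slice t"
    by (simp add: l(3))
  moreover have "min ((hi - t) / (hi - s)) ((t - lo) / (s - lo)) = (t - lo) / (s - lo)"
  proof (rule min_absorb2)
    have "1 \<le> (hi - t) / (hi - s)" "(t - lo) / (s - lo) \<le> 1" using False s t by simp_all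
    then show "(t - lo) / (s - lo) \<le> (hi - t) / (hi - s)" by linarith
  qed
  ultimately show ?thesis by simp
qed

lemma slice_pos:
  assumes "lo < s" "s < hi"
  shows "0 < slice s"
proof -
  obtain s0 where s0: "lo < s0" "s0 < hi" "0 < slice s0" by (rule interior_height)
  have "0 < min ((hi - s) / (hi - s0)) ((s - lo) / (s0 - lo)) ^ DIM('a) * slice s0"
    using s0 assms by (intro mult_pos_pos zero_less_power) auto
  also have "\<dots> \<le> slice s" by (rule slice_ratio) (use s0 assms in auto)
  finally show ?thesis .
qed

lemma slice_eq_0:
  assumes "s < lo \<or> hi < s" shows "slice s = 0"
proof -
  have "u \<bullet> (y + (s - u \<bullet> y) *\<^sub>R u) = s" for y by (simp add: inner_add_right uu)
  then have "slice_prism u A s = {}" unfolding slice_prism_def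
    using lo_le le_hi assms by (metis (mono_tags, lifting) Collect_empty_eq not_less)
  then show ?thesis by (simp add: slice_def)
qed

text \<open>
  Two levels can each be shrunk towards an endpoint to reach the other one, which bounds the ratio of
  the slice areas from both sides by quantities that tend to \<open>1\<close>.
\<close>

lemma isCont_slice:
  assumes s: "lo < s" "s < hi"
  shows "isCont slice s"
proof -
  let ?r = "\<lambda>s t. min ((hi - t) / (hi - s)) ((t - lo) / (s - lo)) ^ DIM('a)"
  have ev: "\<forall>\<^sub>F t in at s. lo < t \<and> t < hi"
  proof -
    have "\<forall>\<^sub>F t in nhds s. t \<in> {lo<..<hi}" by (rule eventually_nhds_in_open) (use s in auto)
    then show ?thesis by (simp add: eventually_at_filter eventually_mono)
  qed
  have "((\<lambda>t. ?r s t * slice s) \<longlongrightarrow> (min ((hi - s) / (hi - s)) ((s - lo) / (s - lo))) ^ DIM('a) * slice s) (at s)"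
    using s by (intro tendsto_intros) auto
  then have l: "((\<lambda>t. ?r s t * slice s) \<longlongrightarrow> slice s) (at s)" using s by simp
  have "((\<lambda>t. slice s / ?r t s) \<longlongrightarrow> slice s / (min ((hi - s) / (hi - s)) ((s - lo) / (s - lo))) ^ DIM('a)) (at s)"
    using s by (intro tendsto_intros) auto
  then have r: "((\<lambda>t. slice s / ?r t s) \<longlongrightarrow> slice s) (at s)" using s by simp
  have "(slice \<longlongrightarrow> slice s) (at s)"
  proof (rule tendsto_sandwich[OF _ _ l r])
    show "\<forall>\<^sub>F t in at s. ?r s t * slice s \<le> slice t"
      using ev by eventually_elim (use slice_ratio s in auto)
    show "\<forall>\<^sub>F t in at s. slice t \<le> slice s / ?r t s"
      using ev
    proof eventually_elim
      case (elim t)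
      have "?r t s * slice t \<le> slice s" using slice_ratio elim s by auto
      moreover have "0 < ?r t s" using elim s by (intro zero_less_power) auto
      ultimately show ?case by (simp add: pos_le_divide_eq mult.commute)
    qed
  qed
  then show ?thesis by (simp add: isCont_def)
qed

lemma sets_halfspace [measurable]: "{y::'a. u \<bullet> y \<le> s} \<in> sets borel" "{y::'a. s < u \<bullet> y} \<in> sets borel"
  by (auto intro: borel_closed borel_open closed_halfspace_le open_halfspace_gt)

lemma sets_body [measurable]: "A \<in> sets borel"
  by (rule borel_compact[OF compact])

lemma fmeasurable_body_Int: "S \<in> sets borel \<Longrightarrow> A \<inter> S \<in> fmeasurable lborel"
  by (rule fmeasurable_Int_fmeasurable[OF fmeasurable_compact[OF compact]]) simp

lemma slice_measurable [measurable]: "slice \<in> borel_measurable borel"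
proof -
  have "(\<lambda>s. enn2real (emeasure lborel (slice_prism u A s))) \<in> borel_measurable borel"
    using measurable_slice_prism(2)[OF sets_body] by measurable
  then show ?thesis by (simp add: emeasure_prism slice_nonneg cong: measurable_cong)
qed

lemma above: "measure lborel (A \<inter> {y. s < u \<bullet> y}) = vol - below s"
proof -
  have "measure lborel A = measure lborel ((A \<inter> {y. u \<bullet> y \<le> s}) \<union> (A \<inter> {y. s < u \<bullet> y}))"
    by (rule arg_cong[where f="measure lborel"]) auto
  also have "\<dots> = below s + measure lborel (A \<inter> {y. s < u \<bullet> y})"
    unfolding below_def by (rule measure_Un2[THEN trans]) (auto intro!: fmeasurable_body_Int arg_cong[where f="measure lborel"])
  finally show ?thesis by (simp add: vol_def)
qed

lemma below_diff:
  assumes "c \<le> x"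
  shows "ennreal (below x - below c) = (\<integral>\<^sup>+s. indicator {c<..x} s * ennreal (slice s) \<partial>lborel)"
    and "below c \<le> below x"
proof -
  let ?D = "A \<inter> {y. c < u \<bullet> y \<and> u \<bullet> y \<le> x}"
  have D: "{y. c < u \<bullet> y \<and> u \<bullet> y \<le> x} \<in> sets borel" by measurable
  have "below x = measure lborel ((A \<inter> {y. u \<bullet> y \<le> c}) \<union> ?D)"
    unfolding below_def using assms by (intro arg_cong[where f="measure lborel"]) auto
  also have "\<dots> = below c + measure lborel ?D"
    unfolding below_def
    by (rule measure_Un2[THEN trans]) (auto intro!: fmeasurable_body_Int arg_cong[where f="measure lborel"])
  finally have eq: "below x - below c = measure lborel ?D" by simp
  then show "below c \<le> below x" using measure_nonneg[of lborel ?D] by linarith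
  have "ennreal (measure lborel ?D) = emeasure lborel ?D"
    using fmeasurable_body_Int[OF D] by (intro emeasure_eq_measure2[symmetric])
  also have "\<dots> = (\<integral>\<^sup>+y. indicator ?D y \<partial>lborel)" by simp
  also have "\<dots> = (\<integral>\<^sup>+y. indicator {c<..x} (u \<bullet> y) * indicator A y \<partial>lborel)"
    by (intro nn_integral_cong) (auto simp: indicator_def)
  also have "\<dots> = (\<integral>\<^sup>+s. indicator {c<..x} s * ennreal (slice s) \<partial>lborel)"
    by (subst nn_integral_slices[OF unit]) (auto simp: emeasure_prism)
  finally show "ennreal (below x - below c) = (\<integral>\<^sup>+s. indicator {c<..x} s * ennreal (slice s) \<partial>lborel)"
    by (simp add: eq)
qed

lemma slice_bounded: "\<exists>C\<ge>0. \<forall>s. slice s \<le> C"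
proof -
  obtain B where B: "\<And>x. x \<in> A \<Longrightarrow> norm x \<le> B" using compact_imp_bounded[OF compact] by (auto simp: bounded_iff)
  define C where "C = measure lborel (cball 0 (B + (max \<bar>lo\<bar> \<bar>hi\<bar> + 1)) :: 'a set)"
  have "slice s \<le> C" for s
  proof (cases "s < lo \<or> hi < s")
    case False
    have "slice_prism u A s \<subseteq> cball 0 (B + (max \<bar>lo\<bar> \<bar>hi\<bar> + 1))"
    proof
      fix y assume "y \<in> slice_prism u A s"
      then have "norm y \<le> B + (\<bar>s\<bar> + 1) * norm u" using norm_slice_prism_le[of A B] B by blast
      moreover have "\<bar>s\<bar> \<le> max \<bar>lo\<bar> \<bar>hi\<bar>" using False by arith
      ultimately show "y \<in> cball 0 (B + (max \<bar>lo\<bar> \<bar>hi\<bar> + 1))" using unit by simp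
    qed
    then show ?thesis unfolding slice_def C_def by (intro measure_compact_mono compact_prism compact_cball)
  qed (simp add: slice_eq_0 C_def)
  then show ?thesis by (intro exI[of _ C]) (simp add: C_def)
qed

lemma below_lipschitz: "\<exists>C\<ge>0. \<forall>c x. c \<le> x \<longrightarrow> below x - below c \<le> C * (x - c)"
proof -
  obtain C where C: "0 \<le> C" "\<And>s. slice s \<le> C" using slice_bounded by auto
  have "below x - below c \<le> C * (x - c)" if "c \<le> x" for c x
  proof -
    have "ennreal (below x - below c) \<le> (\<integral>\<^sup>+s. ennreal C * indicator {c<..x} s \<partial>lborel)"
      unfolding below_diff(1)[OF that] using C
      by (intro nn_integral_mono) (auto simp: indicator_def ennreal_leI)
    also have "\<dots> = ennreal (C * (x - c))"
      using that C by (subst nn_integral_cmult_indicator) (auto simp: ennreal_mult)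
    finally show ?thesis using C that by (subst (asm) ennreal_le_iff) auto
  qed
  then show ?thesis using C by blast
qed

lemma continuous_below: "continuous_on UNIV below"
proof -
  obtain C where C: "0 \<le> C" "\<And>c x. c \<le> x \<Longrightarrow> below x - below c \<le> C * (x - c)" using below_lipschitz by auto
  have "C-lipschitz_on UNIV below"
  proof (rule lipschitz_onI)
    fix x y :: real
    show "dist (below x) (below y) \<le> C * dist x y"
      using C(2)[of x y] C(2)[of y x] below_diff(2)[of x y] below_diff(2)[of y x]
      by (cases "x \<le> y") (auto simp: dist_real_def abs_if)
  qed (use C in auto)
  then show ?thesis by (rule lipschitz_on_continuous_on)
qed

lemma below_lo: "below lo = 0"
proof -
  obtain C where C: "0 \<le> C" "\<And>c x. c \<le> x \<Longrightarrow> below x - below c \<le> C * (x - c)" using below_lipschitz by auto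
  have z: "below s = 0" if "s < lo" for s
  proof -
    have "A \<inter> {y. u \<bullet> y \<le> s} = {}" using lo_le that by force
    then show ?thesis by (simp add: below_def)
  qed
  have "below lo \<le> 0"
  proof (rule field_le_epsilon)
    fix e :: real assume e: "0 < e"
    have "below lo - below (lo - e / (C + 1)) \<le> C * (e / (C + 1))" using C(2)[of "lo - e / (C+1)" lo] C(1) e by simp
    also have "\<dots> \<le> e" using C(1) e by (simp add: field_simps)
    finally show "below lo \<le> 0 + e" using z[of "lo - e / (C+1)"] C(1) e by simp
  qed
  then show ?thesis using measure_nonneg[of lborel] by (simp add: below_def order_antisym)
qed

lemma below_hi: "below hi = vol"
proof -
  have "A \<inter> {y. u \<bullet> y \<le> hi} = A" using le_hi by auto
  then show ?thesis by (simp add: below_def vol_def)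
qed

lemma below_has_derivative:
  assumes s: "lo < s" "s < hi"
  shows "(below has_real_derivative slice s) (at s)"
proof -
  obtain c where c: "lo < c" "c < s" using dense s by blast
  obtain d where d: "s < d" "d < hi" using dense s by blast
  have cont: "continuous_on {c..d} slice"
    using c d by (auto intro!: continuous_at_imp_continuous_on isCont_slice)
  have eq: "below x = below c + integral {c..x} slice" if x: "x \<in> {c..d}" for x
  proof -
    have int: "slice integrable_on {c..x}"
      using cont x by (intro integrable_continuous_real) (auto elim: continuous_on_subset)
    have "((\<lambda>s. if s \<in> {c..x} then slice s else 0) has_integral integral {c..x} slice) UNIV"
      unfolding has_integral_restrict_UNIV by (rule integrable_integral[OF int])
    moreover have "(\<lambda>s. if s \<in> {c..x} then slice s else 0) = (\<lambda>s. indicator {c..x} s * slice s)"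
      by (auto simp: indicator_def)
    ultimately have "((\<lambda>s. indicator {c..x} s * slice s) has_integral integral {c..x} slice) UNIV"
      by simp
    then have "(\<integral>\<^sup>+s. ennreal (indicator {c..x} s * slice s) \<partial>lborel) = ennreal (integral {c..x} slice)"
      by (intro nn_integral_has_integral_lborel) (auto simp: slice_nonneg)
    also have "(\<integral>\<^sup>+s. ennreal (indicator {c..x} s * slice s) \<partial>lborel) =
        (\<integral>\<^sup>+s. indicator {c<..x} s * ennreal (slice s) \<partial>lborel)"
      by (intro nn_integral_cong_AE) (use AE_lborel_singleton[of c] in eventually_elim, auto simp: indicator_def)
    also have "\<dots> = ennreal (below x - below c)" using below_diff x by simp
    finally show ?thesis
      using below_diff(2)[of c x] x by (simp add: integral_nonneg slice_nonneg int)
  qed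
  have "((\<lambda>x. integral {c..x} slice) has_real_derivative slice s) (at s within {c..d})"
    by (rule integral_has_real_derivative[OF cont]) (use c d in auto)
  from DERIV_add[OF DERIV_const[of "below c"] this]
  have "((\<lambda>x. below c + integral {c..x} slice) has_real_derivative slice s) (at s within {c..d})"
    by simp
  then have "(below has_real_derivative slice s) (at s within {c..d})"
    by (rule has_field_derivative_transform_within[of _ _ _ _ 1]) (use c d eq[symmetric] in auto)
  then show ?thesis using c d by (simp add: at_within_Icc_at)
qed

lemma below_strict_mono:
  assumes "lo < s" "s < t" "t < hi" shows "below s < below t"
proof (rule DERIV_pos_imp_increasing[OF assms(2)])
  fix x assume "s \<le> x" "x \<le> t"
  then have "lo < x" "x < hi" using assms by auto
  then show "\<exists>y. (below has_real_derivative y) (at x) \<and> 0 < y"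
    using below_has_derivative slice_pos by blast
qed

lemma quantile_below: "lo < s \<Longrightarrow> s < hi \<Longrightarrow> quantile (below s) = s"
  unfolding quantile_def
proof (rule inv_into_f_f)
  have "strict_mono_on {lo<..<hi} below"
    by (rule strict_mono_onI) (use below_strict_mono in auto)
  then show "inj_on below {lo<..<hi}" by (rule strict_mono_on_imp_inj_on)
qed auto

lemma quantile:
  assumes p: "0 < p" "p < vol"
  shows "lo < quantile p" "quantile p < hi" "below (quantile p) = p"
proof -
  have "lo \<le> hi" using lo_le le_hi nonempty by fastforce
  then obtain s where s: "lo \<le> s" "s \<le> hi" "below s = p"
    using IVT'[of below lo p hi] p continuous_on_subset[OF continuous_below] by (auto simp: below_lo below_hi)
  then have "lo < s" "s < hi" using p below_lo below_hi by (auto simp: order.order_iff_strict)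
  then show "lo < quantile p" "quantile p < hi" "below (quantile p) = p"
    using quantile_below s(3) by auto
qed

lemma quantile_has_derivative:
  assumes p: "0 < p" "p < vol"
  shows "(quantile has_real_derivative 1 / slice (quantile p)) (at p)"
proof -
  note q = quantile[OF p]
  have pos: "0 < slice (quantile p)" using q slice_pos by blast
  have "(quantile has_derivative (*) (1 / slice (quantile p))) (at (below (quantile p)))"
  proof (rule has_derivative_inverse_strong[where S="{lo<..<hi}" and f'="(*) (slice (quantile p))"
        and f=below and x="quantile p"])
    show "open {lo<..<hi}" "quantile p \<in> {lo<..<hi}" using q by auto
    show "continuous_on {lo<..<hi} below" using continuous_below by (rule continuous_on_subset) auto
    show "(below has_derivative (*) (slice (quantile p))) (at (quantile p))"
      using below_has_derivative[OF q(1,2)] by (simp add: has_field_derivative_def)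
    show "(*) (slice (quantile p)) \<circ> (*) (1 / slice (quantile p)) = id" using pos by auto
    show "quantile (below x) = x" if "x \<in> {lo<..<hi}" for x using that quantile_below by auto
  qed
  then show ?thesis using q by (simp add: has_field_derivative_def)
qed

lemma below_strictly_between:
  assumes "lo < s" "s < hi"
  shows "0 < below s" "below s < vol"
proof -
  obtain c d where "lo < c" "c < s" "s < d" "d < hi" using dense assms by meson
  then have "below c < below s" "below s < below d" using below_strict_mono assms by auto
  moreover have "0 \<le> below c" "below d \<le> vol"
    using below_diff(2)[of lo c] below_diff(2)[of d hi] below_lo below_hi \<open>lo < c\<close> \<open>d < hi\<close> by auto
  ultimately show "0 < below s" "below s < vol" by auto
qed

end

section \<open>Equality in the Brunn--Minkowski inequality\<close>

text \<open>
  Two bodies of equal volume for which the midpoint inequality is an equality, seen in the direction \<open>u\<close>.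
\<close>

locale midpoint_bodies =
  a: body_in_direction u A + b: body_in_direction u B + m: body_in_direction u M
  for u :: "'a::euclidean_space" and A B M +
  assumes mid: "\<And>x y. x \<in> A \<Longrightarrow> y \<in> B \<Longrightarrow> (x + y) /\<^sub>R 2 \<in> M"
    and vol_B: "b.vol = a.vol" and vol_M: "m.vol = a.vol"
begin

lemma inner_mid: "u \<bullet> ((x + y) /\<^sub>R 2) = (u \<bullet> x + u \<bullet> y) / 2"
  by (simp add: inner_add_right)

text \<open>
  The prisms over the slices satisfy the midpoint condition themselves, so the inequality for
  slices is an instance of the one for volumes.
\<close>

lemma mid_slices: "a.slice s * b.slice t \<le> (m.slice ((s + t) / 2))^2"
  unfolding a.slice_def b.slice_def m.slice_def
proof (rule brunn_minkowski_measure)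
  fix x y assume x: "x \<in> slice_prism u A s" and y: "y \<in> slice_prism u B t"
  let ?z = "(x + y) /\<^sub>R 2"
  have "?z + ((s + t) / 2 - u \<bullet> ?z) *\<^sub>R u = ((x + (s - u \<bullet> x) *\<^sub>R u) + (y + (t - u \<bullet> y) *\<^sub>R u)) /\<^sub>R 2"
    unfolding inner_mid by (simp add: algebra_simps add_divide_distrib diff_divide_distrib)
  also have "\<dots> \<in> M" using x y by (intro mid) (auto simp: slice_prism_def)
  finally have "?z + ((s + t) / 2 - u \<bullet> ?z) *\<^sub>R u \<in> M" .
  then show "?z \<in> slice_prism u M ((s + t) / 2)"
    using x y inner_mid[of x y] by (simp add: slice_prism_def del: inner_scaleR_right)
qed (auto intro: fmeasurable_compact a.compact_prism b.compact_prism m.compact_prism)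

text \<open>
  Midpoints of the lower parts lie below the average of the cutting levels and midpoints of the upper
  parts above it. Neither part of \<open>M\<close> can be too small, and the total volume is fixed, so the average level
  cuts off exactly \<open>p\<close>.
\<close>

lemma quantile_mid:
  assumes p: "0 < p" "p < a.vol"
  shows "m.quantile p = (a.quantile p + b.quantile p) / 2"
proof -
  define s where "s = a.quantile p"
  define t where "t = b.quantile p"
  have s: "a.lo < s" "s < a.hi" "a.below s = p" using a.quantile[OF p] by (auto simp: s_def)
  have t: "b.lo < t" "t < b.hi" "b.below t = p" using b.quantile[of p] p vol_B by (auto simp: t_def)
  have "a.below s * b.below t \<le> (m.below ((s + t) / 2))^2"
    unfolding a.below_def b.below_def m.below_def
    by (rule brunn_minkowski_measure)
       (auto intro!: a.fmeasurable_body_Int b.fmeasurable_body_Int m.fmeasurable_body_Int mid[simplified] a.sets_halfspace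
        simp: inner_add_right)
  then have "p^2 \<le> (m.below ((s + t) / 2))^2" using s t by (simp add: power2_eq_square)
  then have le: "p \<le> m.below ((s + t) / 2)"
    by (rule power2_le_imp_le) (simp add: m.below_def)
  have "measure lborel (A \<inter> {y. s < u \<bullet> y}) * measure lborel (B \<inter> {y. t < u \<bullet> y})
      \<le> (measure lborel (M \<inter> {y. (s + t) / 2 < u \<bullet> y}))^2"
    by (rule brunn_minkowski_measure)
       (auto intro!: a.fmeasurable_body_Int b.fmeasurable_body_Int m.fmeasurable_body_Int mid[simplified] a.sets_halfspace
        simp: inner_add_right)
  then have "(a.vol - p)^2 \<le> (a.vol - m.below ((s + t) / 2))^2"
    unfolding a.above b.above m.above using s t vol_B vol_M by (simp add: power2_eq_square)
  moreover have "0 \<le> a.vol - m.below ((s + t) / 2)"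
    using m.above[of "(s + t) / 2"] vol_M measure_nonneg[of lborel "M \<inter> {y. (s + t) / 2 < u \<bullet> y}"] by simp
  ultimately have "a.vol - p \<le> a.vol - m.below ((s + t) / 2)"
    by (rule power2_le_imp_le)
  with le have eq: "m.below ((s + t) / 2) = p" by simp
  have "m.lo < (s + t) / 2"
  proof -
    obtain x y where "x \<in> A" "u \<bullet> x = a.lo" "y \<in> B" "u \<bullet> y = b.lo" using a.lo_attained b.lo_attained by blast
    then show ?thesis using m.lo_le[OF mid[of x y]] s t unfolding inner_mid by simp
  qed
  moreover have "(s + t) / 2 < m.hi"
  proof -
    obtain x y where "x \<in> A" "u \<bullet> x = a.hi" "y \<in> B" "u \<bullet> y = b.hi" using a.hi_attained b.hi_attained by blast
    then show ?thesis using m.le_hi[OF mid[of x y]] s t unfolding inner_mid by simp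
  qed
  ultimately show ?thesis using m.quantile_below eq s_def t_def by metis
qed

text \<open>
  Differentiating the previous identity shows that the slice area of \<open>M\<close> is the harmonic mean of
  the slice areas of \<open>A\<close> and \<open>B\<close>, while it is at least their geometric mean.
\<close>

lemma slices_at_quantiles:
  assumes p: "0 < p" "p < a.vol"
  shows "a.slice (a.quantile p) = b.slice (b.quantile p)"
proof -
  have pb: "p < b.vol" and pm: "p < m.vol" using p vol_B vol_M by auto
  let ?a = "a.slice (a.quantile p)" and ?b = "b.slice (b.quantile p)" and ?m = "m.slice (m.quantile p)"
  have pos: "0 < ?a" "0 < ?b" "0 < ?m"
    using a.slice_pos a.quantile[OF p] b.slice_pos b.quantile[OF p(1) pb] m.slice_pos m.quantile[OF p(1) pm] by auto
  have "((\<lambda>p. (a.quantile p + b.quantile p) / 2) has_real_derivative (1 / ?a + 1 / ?b) / 2) (at p)"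
    by (intro DERIV_cdivide DERIV_add a.quantile_has_derivative b.quantile_has_derivative p pb)
  then have "(m.quantile has_real_derivative (1 / ?a + 1 / ?b) / 2) (at p)"
    by (rule has_field_derivative_transform_within_open[of _ _ _ "{0<..<a.vol}"]) (use p quantile_mid in auto)
  with m.quantile_has_derivative[OF p(1) pm] have "1 / ?m = (1 / ?a + 1 / ?b) / 2"
    by (rule DERIV_unique)
  from this[symmetric] have "((1 / ?a + 1 / ?b) / 2)^2 = 1 / ?m^2" by (simp only: power_one_over)
  also have "\<dots> \<le> 1 / (?a * ?b)"
    using mid_slices[of "a.quantile p" "b.quantile p"] pos
    unfolding quantile_mid[OF p, symmetric] by (intro divide_left_mono) simp_all
  finally have "((1 / ?a + 1 / ?b) / 2)^2 \<le> (1 / ?a) * (1 / ?b)" by simp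
  moreover have "x = y" if "((x + y) / 2)^2 \<le> x * y" for x y :: real
  proof -
    have "(x - y)^2 = 4 * (((x + y) / 2)^2 - x * y)" by (simp add: power2_eq_square field_simps)
    with that have "(x - y)^2 \<le> 0" by simp
    then show ?thesis by simp
  qed
  ultimately have "1 / ?a = 1 / ?b" by blast
  then show ?thesis using pos by simp
qed

lemma quantile_shift: "\<exists>\<tau>. \<forall>p. 0 < p \<longrightarrow> p < a.vol \<longrightarrow> a.quantile p = b.quantile p + \<tau>"
proof (cases "0 < a.vol")
  case True
  have d: "((\<lambda>p. a.quantile p - b.quantile p) has_real_derivative 0) (at p)" if p: "p \<in> {0<..<a.vol}" for p
  proof -
    have "((\<lambda>p. a.quantile p - b.quantile p) has_real_derivative
        1 / a.slice (a.quantile p) - 1 / b.slice (b.quantile p)) (at p)"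
      using p vol_B by (intro DERIV_diff a.quantile_has_derivative b.quantile_has_derivative) auto
    then show ?thesis using slices_at_quantiles p by simp
  qed
  have c: "a.quantile p - b.quantile p = a.quantile (a.vol / 2) - b.quantile (a.vol / 2)"
    if "0 < p" "p < a.vol" for p
  proof (rule DERIV_isconst3[where f="\<lambda>p. a.quantile p - b.quantile p", OF True _ _ d])
    show "p \<in> {0<..<a.vol}" "a.vol / 2 \<in> {0<..<a.vol}" using that True by auto
  qed
  have "a.quantile p = b.quantile p + (a.quantile (a.vol / 2) - b.quantile (a.vol / 2))"
    if "0 < p" "p < a.vol" for p using c[OF that] by linarith
  then show ?thesis by blast
next
  case False
  then show ?thesis by auto
qed

lemma shifted:
  obtains \<tau> where "a.lo = b.lo + \<tau>" "a.hi = b.hi + \<tau>"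
    "\<And>s. s \<noteq> b.lo \<Longrightarrow> s \<noteq> b.hi \<Longrightarrow> a.slice (\<tau> + s) = b.slice s"
proof -
  obtain \<tau> where \<tau>: "\<And>p. 0 < p \<Longrightarrow> p < a.vol \<Longrightarrow> a.quantile p = b.quantile p + \<tau>" using quantile_shift by blast
  have B: "a.lo < \<tau> + s \<and> \<tau> + s < a.hi \<and> a.slice (\<tau> + s) = b.slice s" if s: "b.lo < s" "s < b.hi" for s
  proof -
    let ?p = "b.below s"
    have p: "0 < ?p" "?p < a.vol" using b.below_strictly_between[OF s] vol_B by auto
    have "a.quantile ?p = \<tau> + s" using \<tau>[OF p] b.quantile_below[OF s] by simp
    then show ?thesis using a.quantile[OF p] slices_at_quantiles[OF p] b.quantile_below[OF s] by simp
  qed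
  have A: "b.lo < s - \<tau> \<and> s - \<tau> < b.hi" if s: "a.lo < s" "s < a.hi" for s
  proof -
    let ?p = "a.below s"
    have p: "0 < ?p" "?p < a.vol" using a.below_strictly_between[OF s] by auto
    have "b.quantile ?p = s - \<tau>" using \<tau>[OF p] a.quantile_below[OF s] by simp
    then show ?thesis using b.quantile[of ?p] p vol_B by simp
  qed
  obtain sa where sa: "a.lo < sa" "sa < a.hi" using a.interior_height by blast
  obtain sb where sb: "b.lo < sb" "sb < b.hi" using b.interior_height by blast
  have "b.hi \<le> a.hi - \<tau>"
  proof (rule dense_le_bounded[OF sb(2)])
    fix s assume "sb < s" "s < b.hi"
    then show "s \<le> a.hi - \<tau>" using B[of s] sb by linarith
  qed
  moreover have "a.hi \<le> b.hi + \<tau>"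
  proof (rule dense_le_bounded[OF sa(2)])
    fix s assume "sa < s" "s < a.hi"
    then show "s \<le> b.hi + \<tau>" using A[of s] sa by linarith
  qed
  moreover have "a.lo - \<tau> \<le> b.lo"
  proof (rule dense_ge_bounded[OF sb(1)])
    fix s assume "b.lo < s" "s < sb"
    then show "a.lo - \<tau> \<le> s" using B[of s] sb by linarith
  qed
  moreover have "b.lo + \<tau> \<le> a.lo"
  proof (rule dense_ge_bounded[OF sa(1)])
    fix s assume "a.lo < s" "s < sa"
    then show "b.lo + \<tau> \<le> s" using A[of s] sa by linarith
  qed
  ultimately have eq: "a.lo = b.lo + \<tau>" "a.hi = b.hi + \<tau>" by auto
  moreover have "a.slice (\<tau> + s) = b.slice s" if "s \<noteq> b.lo" "s \<noteq> b.hi" for s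
  proof (cases "b.lo < s \<and> s < b.hi")
    case False
    then have "s < b.lo \<or> b.hi < s" using that by auto
    then show ?thesis using eq a.slice_eq_0[of "\<tau> + s"] b.slice_eq_0[of s] by auto
  qed (use B in auto)
  ultimately show thesis using that by blast
qed

text \<open>
  The slice areas agree up to a shift of the level, and the shift is the difference of the mean levels,
  that is, of the components of the centroids along \<open>u\<close>. This makes it linear in \<open>u\<close>.
\<close>

lemma hi_shift:
  "a.vol * (a.hi - b.hi) = u \<bullet> ((LINT y|lborel. indicator A y *\<^sub>R y) - (LINT y|lborel. indicator B y *\<^sub>R y))"
proof -
  obtain \<tau> where lo: "a.lo = b.lo + \<tau>" and hi: "a.hi = b.hi + \<tau>"
    and sl: "\<And>s. s \<noteq> b.lo \<Longrightarrow> s \<noteq> b.hi \<Longrightarrow> a.slice (\<tau> + s) = b.slice s" using shifted by blast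
  \<comment> \<open>Adding \<open>C\<close> makes all levels nonnegative, so that first moments are integrals in \<open>ennreal\<close>.\<close>
  define C where "C = \<bar>a.lo\<bar>"
  have moment: "(\<integral>\<^sup>+y. ennreal (u \<bullet> y + D) * indicator K y \<partial>lborel)
      = ennreal (u \<bullet> (LINT y|lborel. indicator K y *\<^sub>R y) + D * measure lborel K)"
      "0 \<le> u \<bullet> (LINT y|lborel. indicator K y *\<^sub>R y) + D * measure lborel K"
    if K: "compact K" and nn: "\<And>y. y \<in> K \<Longrightarrow> 0 \<le> u \<bullet> y + D" for K :: "'a set" and D
  proof -
    have int1: "integrable lborel (\<lambda>y. indicator K y *\<^sub>R y)"
      by (rule borel_integrable_compact[OF K]) (auto intro!: continuous_intros)
    have int2: "integrable lborel (\<lambda>y. D * indicator K y)"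
      using fmeasurable_compact[OF K] by (intro integrable_mult_right integrable_real_indicator) (auto simp: fmeasurable_def)
    have eq: "indicator K y * (u \<bullet> y + D) = u \<bullet> (indicator K y *\<^sub>R y) + D * indicator K y" for y
      by (simp add: algebra_simps)
    have int: "integrable lborel (\<lambda>y. indicator K y * (u \<bullet> y + D))"
      unfolding eq by (intro Bochner_Integration.integrable_add int2 integrable_inner_right int1)
    have val: "(LINT y|lborel. indicator K y * (u \<bullet> y + D)) = u \<bullet> (LINT y|lborel. indicator K y *\<^sub>R y) + D * measure lborel K"
      unfolding eq using int1 int2 fmeasurable_compact[OF K]
      by (subst Bochner_Integration.integral_add)
         (auto simp del: inner_scaleR_right intro: integrable_inner_right)
    have pos: "0 \<le> indicator K y * (u \<bullet> y + D)" for y using nn by (auto simp: indicator_def)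
    have "(\<integral>\<^sup>+y. ennreal (u \<bullet> y + D) * indicator K y \<partial>lborel) = (\<integral>\<^sup>+y. ennreal (indicator K y * (u \<bullet> y + D)) \<partial>lborel)"
      by (intro nn_integral_cong) (auto simp: indicator_def)
    also have "\<dots> = ennreal (LINT y|lborel. indicator K y * (u \<bullet> y + D))"
      by (rule nn_integral_eq_integral[OF int]) (use pos in auto)
    finally show "(\<integral>\<^sup>+y. ennreal (u \<bullet> y + D) * indicator K y \<partial>lborel)
      = ennreal (u \<bullet> (LINT y|lborel. indicator K y *\<^sub>R y) + D * measure lborel K)" unfolding val .
    show "0 \<le> u \<bullet> (LINT y|lborel. indicator K y *\<^sub>R y) + D * measure lborel K"
      unfolding val[symmetric] by (intro Bochner_Integration.integral_nonneg pos)
  qed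
  have nnA: "0 \<le> u \<bullet> y + C" if "y \<in> A" for y using a.lo_le[OF that] by (simp add: C_def)
  have nnB: "0 \<le> u \<bullet> y + (\<tau> + C)" if "y \<in> B" for y using b.lo_le[OF that] lo by (simp add: C_def)
  have "(\<integral>\<^sup>+y. ennreal (u \<bullet> y + C) * indicator A y \<partial>lborel) = (\<integral>\<^sup>+s. ennreal (s + C) * ennreal (a.slice s) \<partial>lborel)"
    unfolding a.emeasure_prism[symmetric] by (rule nn_integral_slices[OF a.unit]) auto
  also have "\<dots> = (\<integral>\<^sup>+s. ennreal ((\<tau> + s) + C) * ennreal (a.slice (\<tau> + s)) \<partial>lborel)"
    by (rule nn_integral_lborel_shift) measurable
  also have "\<dots> = (\<integral>\<^sup>+s. ennreal (s + (\<tau> + C)) * ennreal (b.slice s) \<partial>lborel)"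
  proof (rule nn_integral_cong_AE)
    show "AE s in lborel. ennreal ((\<tau> + s) + C) * ennreal (a.slice (\<tau> + s)) = ennreal (s + (\<tau> + C)) * ennreal (b.slice s)"
      using AE_lborel_singleton[of b.lo] AE_lborel_singleton[of b.hi]
    proof eventually_elim
      case (elim s)
      have "(\<tau> + s) + C = s + (\<tau> + C)" by simp
      then show ?case using sl[OF elim] by (simp only:)
    qed
  qed
  also have "\<dots> = (\<integral>\<^sup>+y. ennreal (u \<bullet> y + (\<tau> + C)) * indicator B y \<partial>lborel)"
    unfolding b.emeasure_prism[symmetric] by (rule nn_integral_slices[OF a.unit, symmetric]) auto
  finally have "u \<bullet> (LINT y|lborel. indicator A y *\<^sub>R y) + C * measure lborel A =
      u \<bullet> (LINT y|lborel. indicator B y *\<^sub>R y) + (\<tau> + C) * measure lborel B"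
    using moment[OF a.compact, of C] moment[OF b.compact, of "\<tau> + C"] nnA nnB
    by (simp add: ennreal_inj)
  then show ?thesis
    using vol_B hi by (simp add: inner_diff_right a.vol_def b.vol_def algebra_simps)
qed

end

text \<open>
  The conclusion says, in terms of support functions, that \<open>A\<close> is the translate of \<open>B\<close> by \<open>w\<close>, the
  difference of the centroids.
\<close>

theorem brunn_minkowski_equality:
  fixes A B M :: "'a::euclidean_space set"
  assumes A: "convex A" "compact A" "interior A \<noteq> {}"
    and B: "convex B" "compact B" "interior B \<noteq> {}"
    and M: "convex M" "compact M" "interior M \<noteq> {}"
    and mid: "\<And>a b. a \<in> A \<Longrightarrow> b \<in> B \<Longrightarrow> (a + b) /\<^sub>R 2 \<in> M"
    and vol: "measure lborel B = measure lborel A" "measure lborel M = measure lborel A"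
  obtains w where "\<And>u. norm u = 1 \<Longrightarrow> (SUP y\<in>A. u \<bullet> y) = (SUP y\<in>B. u \<bullet> y) + u \<bullet> w"
proof
  fix u :: 'a assume u: "norm u = 1"
  interpret midpoint_bodies u A B M
    by unfold_locales (use assms u in \<open>auto simp: body_in_direction_def body_in_direction.vol_def\<close>)
  have "0 < a.vol" unfolding a.vol_def
    by (rule measure_open_pos[OF open_interior A(3) interior_subset A(2)])
  then show "(SUP y\<in>A. u \<bullet> y) = (SUP y\<in>B. u \<bullet> y) + u \<bullet>
     (((LINT y|lborel. indicator A y *\<^sub>R y) - (LINT y|lborel. indicator B y *\<^sub>R y)) /\<^sub>R measure lborel A)"
    using hi_shift[symmetric] unfolding a.hi_def b.hi_def a.vol_def inner_scaleR_right
    by (simp add: mult.assoc[symmetric])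
qed

section \<open>Minkowski's first inequality for polytopes\<close>

definition cell :: "'a::euclidean_space set \<Rightarrow> ('a \<Rightarrow> real) \<Rightarrow> 'a set" where
  "cell X k = {y. \<forall>u\<in>X. u \<bullet> y \<le> k u}"

lemma closed_cell: "closed (cell X k)"
proof -
  have "cell X k = (\<Inter>u\<in>X. {y. u \<bullet> y \<le> k u})" by (auto simp: cell_def)
  then show ?thesis by (simp add: closed_INT closed_halfspace_le)
qed

lemma convex_cell: "convex (cell X k)"
proof -
  have "cell X k = (\<Inter>u\<in>X. {y. u \<bullet> y \<le> k u})" by (auto simp: cell_def)
  then show ?thesis by (simp add: convex_INT convex_halfspace_le)
qed

lemma cell_borel [measurable]: "cell X k \<in> sets borel"
  by (rule borel_closed[OF closed_cell])

lemma scale_mem_cell: "0 < c \<Longrightarrow> c *\<^sub>R y \<in> cell X (\<lambda>u. c * k u) \<longleftrightarrow> y \<in> cell X k"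
  by (simp add: cell_def)

lemma cell_scale: "0 < c \<Longrightarrow> cell X (\<lambda>u. c * k u) = (\<lambda>y. c *\<^sub>R y + 0) ` cell X k"
proof (intro equalityI subsetI)
  fix y assume c: "0 < c" and "y \<in> cell X (\<lambda>u. c * k u)"
  then have "(1 / c) *\<^sub>R y \<in> cell X k" using scale_mem_cell[of c "(1 / c) *\<^sub>R y" X k] by simp
  then have "c *\<^sub>R ((1 / c) *\<^sub>R y) + 0 \<in> (\<lambda>y. c *\<^sub>R y + 0) ` cell X k" by blast
  then show "y \<in> (\<lambda>y. c *\<^sub>R y + 0) ` cell X k" using c by simp
qed (auto simp: scale_mem_cell)

lemma cell_mono: "(\<And>u. u \<in> X \<Longrightarrow> k u \<le> l u) \<Longrightarrow> cell X k \<subseteq> cell X l"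
  by (fastforce simp: cell_def)

lemma power_quotient_limit: "((\<lambda>x. ((1 + x) ^ n - 1) / x) \<longlongrightarrow> real n) (at 0)"
proof -
  have "((\<lambda>x::real. (1 + x) ^ n) has_real_derivative real n) (at 0)"
    by (auto intro!: derivative_eq_intros)
  then show ?thesis by (simp add: has_field_derivative_iff)
qed

text \<open>
  A bounded polytope with the origin in its interior, given by outer unit normals \<open>X\<close> and support
  numbers \<open>h\<close>. Normals without a facet are possible; for them \<open>facet_area\<close> is \<open>0\<close>.
\<close>

locale bounded_cell =
  fixes X :: "'a::euclidean_space set" and h :: "'a \<Rightarrow> real"
  assumes fin: "finite X" and unit: "\<And>u. u \<in> X \<Longrightarrow> norm u = 1"
    and pos: "\<And>u. u \<in> X \<Longrightarrow> 0 < h u" and bounded: "bounded (cell X h)"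
begin

abbreviation "body \<equiv> cell X h"
definition facet_area where "facet_area u = measure lborel (slice_prism u body (h u))"

lemma compact_cell: "compact (cell X k)"
proof -
  define c where "c = Max (insert 1 ((\<lambda>u. k u / h u) ` X))"
  have c: "1 \<le> c" unfolding c_def by (rule Max_ge) (use fin in auto)
  have "k u \<le> c * h u" if "u \<in> X" for u
  proof -
    have "k u / h u \<le> c" unfolding c_def by (rule Max_ge) (use fin that in auto)
    then show ?thesis using pos[OF that] by (simp add: field_simps)
  qed
  then have "cell X k \<subseteq> cell X (\<lambda>u. c * h u)" by (rule cell_mono)
  also have "\<dots> = (\<lambda>y. c *\<^sub>R y + 0) ` body" by (rule cell_scale) (use c in auto)
  also have "\<dots> = (*\<^sub>R) c ` body" by simp
  finally show ?thesis
    using bounded_subset[OF bounded_scaling[OF bounded]] closed_cell by (auto simp: compact_eq_bounded_closed)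
qed

lemma compact_prism: "compact (slice_prism u (cell X k) s)"
  by (rule compact_slice_prism[OF compact_cell])

lemma inner_self: "u \<in> X \<Longrightarrow> u \<bullet> u = 1" using unit by (simp add: dot_square_norm)

lemma measure_cell_scale: "0 < c \<Longrightarrow> measure lborel (cell X (\<lambda>u. c * k u)) = c ^ DIM('a) * measure lborel (cell X k)"
  unfolding cell_scale by (subst measure_homothety[OF compact_cell]) auto

lemma interior_cell:
  assumes "\<And>u. u \<in> X \<Longrightarrow> 0 < k u" shows "interior (cell X k) \<noteq> {}"
proof -
  have "open (\<Inter>u\<in>X. {y. u \<bullet> y < k u})" by (intro open_INT fin ballI open_halfspace_lt)
  moreover have "(\<Inter>u\<in>X. {y. u \<bullet> y < k u}) \<subseteq> cell X k" by (auto simp: cell_def less_imp_le)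
  moreover have "0 \<in> (\<Inter>u\<in>X. {y. u \<bullet> y < k u})" using assms by simp
  ultimately show ?thesis using interior_maximal by blast
qed

lemma measure_cell_pos: "(\<And>u. u \<in> X \<Longrightarrow> 0 < k u) \<Longrightarrow> 0 < measure lborel (cell X k)"
  by (rule measure_open_pos[OF open_interior interior_cell interior_subset compact_cell])

text \<open>
  The cone over the facet with normal \<open>u\<close>, between this facet and its dilate by \<open>1 + e\<close>.
\<close>

definition cap where
  "cap e u = {y. h u < u \<bullet> y \<and> u \<bullet> y \<le> (1 + e) * h u \<and> (h u / (u \<bullet> y)) *\<^sub>R y \<in> body}"

lemma cap_borel [measurable]: "cap e u \<in> sets borel"
  unfolding cap_def by measurable

lemma cap_subset:
  assumes u: "u \<in> X" and e: "0 < e" shows "cap e u \<subseteq> cell X (\<lambda>u. (1 + e) * h u)"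
proof
  fix y assume y: "y \<in> cap e u"
  define f where "f = (h u / (u \<bullet> y)) *\<^sub>R y"
  have hy: "0 < h u" "h u < u \<bullet> y" "u \<bullet> y \<le> (1 + e) * h u" using y pos[OF u] by (auto simp: cap_def)
  have f: "f \<in> body" using y by (auto simp: cap_def f_def)
  have y_eq: "y = ((u \<bullet> y) / h u) *\<^sub>R f" using hy by (simp add: f_def)
  have le: "(u \<bullet> y) / h u \<le> 1 + e" using hy by (simp add: field_simps)
  show "y \<in> cell X (\<lambda>u. (1 + e) * h u)" unfolding cell_def
  proof (clarify)
    fix v assume v: "v \<in> X"
    have "v \<bullet> y = ((u \<bullet> y) / h u) * (v \<bullet> f)" by (subst y_eq) simp
    also have "\<dots> \<le> ((u \<bullet> y) / h u) * h v"
      using f v hy by (intro mult_left_mono) (auto simp: cell_def)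
    also have "\<dots> \<le> (1 + e) * h v" using le pos[OF v] by (intro mult_right_mono) auto
    finally show "v \<bullet> y \<le> (1 + e) * h v" .
  qed
qed

text \<open>
  Each slice of the cap is a dilate of the facet by a factor \<open>t > 1\<close>, and hence contains the translate of the
  facet by \<open>(t - 1) y0\<close> for any point \<open>y0\<close> of the facet.
\<close>

lemma emeasure_cap:
  assumes u: "u \<in> X" and e: "0 < e"
  shows "ennreal (e * h u * facet_area u) \<le> emeasure lborel (cap e u)"
proof (cases "slice_prism u body (h u) = {}")
  case True
  then show ?thesis by (simp add: facet_area_def)
next
  case False
  then obtain y0' where y0': "y0' \<in> slice_prism u body (h u)" by auto
  define y0 where "y0 = y0' + (h u - u \<bullet> y0') *\<^sub>R u"
  have y0: "y0 \<in> body" "u \<bullet> y0 = h u" using y0' inner_self[OF u]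
    by (auto simp: slice_prism_def y0_def inner_add_right)
  have hu: "0 < h u" by (rule pos[OF u])
  have "emeasure lborel (cap e u) = (\<integral>\<^sup>+y. 1 * indicator (cap e u) y \<partial>lborel)" by simp
  also have "\<dots> = (\<integral>\<^sup>+s. 1 * emeasure lborel (slice_prism u (cap e u) s) \<partial>lborel)"
    by (rule nn_integral_slices[OF unit[OF u]]) auto
  finally have eq: "emeasure lborel (cap e u) = (\<integral>\<^sup>+s. emeasure lborel (slice_prism u (cap e u) s) \<partial>lborel)" by simp
  have ge: "ennreal (facet_area u) * indicator {h u<..(1 + e) * h u} s \<le> emeasure lborel (slice_prism u (cap e u) s)" for s
  proof (cases "h u < s \<and> s \<le> (1 + e) * h u")
    case True
    define t where "t = s / h u"
    have t: "1 < t" "t * h u = s" using True hu by (auto simp: t_def field_simps)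
    let ?f = "\<lambda>z. 1 *\<^sub>R z + (t - 1) *\<^sub>R (y0 - h u *\<^sub>R u)"
    have sub: "?f ` slice_prism u body (h u) \<subseteq> slice_prism u (cap e u) s"
    proof
      fix z' assume "z' \<in> ?f ` slice_prism u body (h u)"
      then obtain z where z: "z \<in> slice_prism u body (h u)" and z': "z' = ?f z" by auto
      define w where "w = z + (h u - u \<bullet> z) *\<^sub>R u"
      have w: "w \<in> body" "u \<bullet> w = h u" using z inner_self[OF u] by (auto simp: slice_prism_def w_def inner_add_right)
      have uz: "u \<bullet> z' = u \<bullet> z" using y0 inner_self[OF u] by (simp add: z' inner_add_right inner_diff_right)
      have eq: "z' + (s - u \<bullet> z') *\<^sub>R u = w + (t - 1) *\<^sub>R y0"
        unfolding uz unfolding z' w_def t(2)[symmetric] by (simp add: algebra_simps)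
      have us: "u \<bullet> (w + (t - 1) *\<^sub>R y0) = s" using w y0 t by (simp add: inner_add_right algebra_simps)
      have "(h u / s) *\<^sub>R (w + (t - 1) *\<^sub>R y0) = (1 / t) *\<^sub>R w + (1 - 1 / t) *\<^sub>R y0"
      proof -
        have "h u / s = 1 / t" using t hu by (simp add: t(2)[symmetric])
        moreover have "(1 / t) * (t - 1) = 1 - 1 / t" using t by (simp add: field_simps)
        ultimately show ?thesis by (simp only: scaleR_add_right scaleR_scaleR)
      qed
      also have "\<dots> \<in> body" by (rule convexD[OF convex_cell w(1) y0(1)]) (use t in auto)
      finally have "w + (t - 1) *\<^sub>R y0 \<in> cap e u" unfolding cap_def us using True us by simp
      then show "z' \<in> slice_prism u (cap e u) s"
        using z uz eq by (simp add: slice_prism_def)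
    qed
    have "ennreal (facet_area u) = ennreal (measure lborel (?f ` slice_prism u body (h u)))"
      by (subst measure_homothety[OF compact_prism]) (simp add: facet_area_def)
    also have "\<dots> = emeasure lborel (?f ` slice_prism u body (h u))"
      by (rule emeasure_compact_eq_measure[symmetric]) (intro compact_continuous_image compact_prism continuous_intros)
    also have "\<dots> \<le> emeasure lborel (slice_prism u (cap e u) s)"
      by (rule emeasure_mono[OF sub]) (simp add: measurable_slice_prism)
    finally show ?thesis using True by simp
  qed auto
  have "ennreal (e * h u * facet_area u) = ennreal (facet_area u) * ennreal (e * h u)"
    using e hu by (subst ennreal_mult[symmetric]) (auto simp: facet_area_def mult_ac)
  also have "\<dots> = (\<integral>\<^sup>+s. ennreal (facet_area u) * indicator {h u<..(1 + e) * h u} s \<partial>lborel)"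
    using e hu by (subst nn_integral_cmult_indicator) (auto simp: algebra_simps)
  also have "\<dots> \<le> emeasure lborel (cap e u)"
    unfolding eq by (rule nn_integral_mono) (rule ge)
  finally show ?thesis .
qed

text \<open>
  A ray from the origin leaves the body through one point only, and points on two facets lie in a
  fixed hyperplane through the origin.
\<close>

lemma AE_cap_disjoint: "AE y in lborel. \<forall>u\<in>X. \<forall>v\<in>X. y \<in> cap e u \<and> y \<in> cap e v \<longrightarrow> u = v"
proof (intro AE_finite_allI fin)
  fix u v assume u: "u \<in> X" and v: "v \<in> X"
  show "AE y in lborel. y \<in> cap e u \<and> y \<in> cap e v \<longrightarrow> u = v"
  proof (cases "u = v")
    case False
    \<comment> \<open>The normal of the hyperplane that contains the intersection of the two facets and the origin.\<close>
    define n where "n = (1 / h u) *\<^sub>R u - (1 / h v) *\<^sub>R v"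
    have "n \<noteq> 0"
    proof
      assume "n = 0"
      then have eq: "(1 / h u) *\<^sub>R u = (1 / h v) *\<^sub>R v" by (simp add: n_def)
      then have "norm ((1 / h u) *\<^sub>R u) = norm ((1 / h v) *\<^sub>R v)" by simp
      then have "1 / h u = 1 / h v" using unit[OF u] unit[OF v] pos[OF u] pos[OF v] by simp
      then show False using eq False pos[OF u] by simp
    qed
    then have "negligible {x. n \<bullet> x = 0}" using negligible_hyperplane by blast
    then have "AE x in lebesgue. x \<notin> {x. n \<bullet> x = 0}"
      by (intro AE_not_in) (simp add: negligible_iff_null_sets)
    then have "AE x in lborel. x \<notin> {x. n \<bullet> x = 0}" by (simp only: AE_completion_iff)
    then show ?thesis
    proof eventually_elim
      case (elim y)
      have "n \<bullet> y = 0" if "y \<in> cap e u" "y \<in> cap e v"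
      proof -
        have "v \<bullet> ((h u / (u \<bullet> y)) *\<^sub>R y) \<le> h v" "u \<bullet> ((h v / (v \<bullet> y)) *\<^sub>R y) \<le> h u"
          using that u v unfolding cap_def cell_def by blast+
        moreover have "0 < h u" "0 < h v" "0 < u \<bullet> y" "0 < v \<bullet> y"
          using that pos[OF u] pos[OF v] by (auto simp: cap_def intro: less_trans)
        ultimately have "(u \<bullet> y) / h u = (v \<bullet> y) / h v"
          by (intro order_antisym) (simp_all add: field_simps)
        then show ?thesis by (simp add: n_def inner_diff_left)
      qed
      then show ?case using elim by auto
    qed
  qed simp
qed

lemma sum_caps:
  assumes e: "0 < e"
  shows "(\<Sum>u\<in>X. e * h u * facet_area u) + measure lborel body \<le> (1 + e) ^ DIM('a) * measure lborel body"
proof -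
  let ?E = "cell X (\<lambda>u. (1 + e) * h u)"
  have nn: "0 \<le> e * h u * facet_area u" if "u \<in> X" for u
    using e pos[OF that] by (simp add: facet_area_def)
  have sub: "body \<subseteq> ?E"
  proof (rule cell_mono)
    fix u assume "u \<in> X" then show "h u \<le> (1 + e) * h u" using e pos[of u] by (simp add: algebra_simps)
  qed
  have "ennreal ((\<Sum>u\<in>X. e * h u * facet_area u) + measure lborel body)
      = (\<Sum>u\<in>X. ennreal (e * h u * facet_area u)) + emeasure lborel body"
    using nn by (simp add: sum_ennreal emeasure_compact_eq_measure[OF compact_cell] sum_nonneg)
  also have "\<dots> \<le> (\<Sum>u\<in>X. emeasure lborel (cap e u)) + emeasure lborel body"
    by (intro add_mono sum_mono emeasure_cap e) auto
  also have "\<dots> = (\<integral>\<^sup>+y. (\<Sum>u\<in>X. indicator (cap e u) y) + indicator body y \<partial>lborel)"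
    by (subst nn_integral_add) (auto simp: nn_integral_sum)
  also have "\<dots> \<le> (\<integral>\<^sup>+y. indicator ?E y \<partial>lborel)"
  proof (rule nn_integral_mono_AE)
    show "AE y in lborel. (\<Sum>u\<in>X. indicator (cap e u) y) + indicator body y \<le> (indicator ?E y :: ennreal)"
      using AE_cap_disjoint[of e]
    proof eventually_elim
      case (elim y)
      show ?case
      proof (cases "\<exists>u\<in>X. y \<in> cap e u")
        case True
        then obtain u where u: "u \<in> X" "y \<in> cap e u" by auto
        have "y \<notin> body" using u by (auto simp: cap_def cell_def intro!: bexI[of _ u])
        moreover have "(\<Sum>v\<in>X. indicator (cap e v) y :: ennreal) = (\<Sum>v\<in>X. if v = u then 1 else 0)"
          using elim u by (intro sum.cong) (auto simp: indicator_def)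
        ultimately show ?thesis using u cap_subset[OF u(1) e] fin by (auto simp: indicator_def)
      next
        case False
        then have "(\<Sum>u\<in>X. indicator (cap e u) y :: ennreal) = 0" by (intro sum.neutral) auto
        then show ?thesis using sub by (auto simp: indicator_def)
      qed
    qed
  qed
  also have "\<dots> = emeasure lborel ?E" by simp
  also have "\<dots> = ennreal ((1 + e) ^ DIM('a) * measure lborel body)"
    using e by (simp add: emeasure_compact_eq_measure[OF compact_cell] measure_cell_scale)
  finally show ?thesis using e by (subst (asm) ennreal_le_iff) auto
qed

text \<open>
  Summing the caps compares the facets with the growth of the volume under dilation by \<open>1 + e\<close>; the claim
  is the limit \<open>e \<rightarrow> 0\<close>. (Equality holds when \<open>X\<close> consists of the facet normals, by decomposition into
  cones.)
\<close>

lemma sum_area_le: "(\<Sum>u\<in>X. h u * facet_area u) \<le> real DIM('a) * measure lborel body"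
proof -
  have lim: "((\<lambda>e. ((1 + e) ^ DIM('a) - 1) / e * measure lborel body) \<longlongrightarrow> real DIM('a) * measure lborel body) (at_right 0)"
    by (intro tendsto_mult tendsto_const tendsto_mono[OF _ power_quotient_limit]) (simp add: at_within_le_at at_le)
  show ?thesis
  proof (rule tendsto_lowerbound[OF lim])
    show "\<forall>\<^sub>F e in at_right 0. (\<Sum>u\<in>X. h u * facet_area u) \<le> ((1 + e) ^ DIM('a) - 1) / e * measure lborel body"
      using eventually_at_right_less[of 0]
    proof eventually_elim
      case (elim e)
      have "(\<Sum>u\<in>X. e * h u * facet_area u) = e * (\<Sum>u\<in>X. h u * facet_area u)"
        by (simp add: sum_distrib_left mult.assoc)
      with sum_caps[OF elim] have "e * (\<Sum>u\<in>X. h u * facet_area u) \<le> ((1 + e) ^ DIM('a) - 1) * measure lborel body"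
        by (simp add: algebra_simps)
      then show ?case using elim by (simp add: field_simps)
    qed
  qed simp
qed

text \<open>
  The area of the facet with normal \<open>u\<close> after enlarging it by an amount of order \<open>e\<close>. It dominates all slices
  of the outer polytope with the support numbers \<open>h + e * k\<close> beyond that facet.
\<close>

definition shell_area where
  "shell_area k e u = measure lborel (slice_prism u (cell X (\<lambda>v. h v + e * (k v + k u))) (h u))"

text \<open>
  The part of the outer polytope outside the body is covered by one slab per normal, of width
  \<open>e * k u\<close> and with slices of area at most \<open>shell_area k e u\<close>.
\<close>

lemma measure_outer_cell_le:
  assumes k: "\<And>u. u \<in> X \<Longrightarrow> 0 < k u" and e: "0 < e"
  shows "measure lborel (cell X (\<lambda>u. h u + e * k u)) \<le> measure lborel body + e * (\<Sum>u\<in>X. k u * shell_area k e u)"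
proof -
  let ?Q = "cell X (\<lambda>u. h u + e * k u)"
  define S where "S u = ?Q \<inter> {y. h u < u \<bullet> y}" for u
  have S_borel [measurable]: "S u \<in> sets borel" for u unfolding S_def by measurable
  have S_le: "emeasure lborel (S u) \<le> ennreal (e * k u * shell_area k e u)" if u: "u \<in> X" for u
  proof -
    let ?w = "ennreal (shell_area k e u)"
    have "emeasure lborel (S u) = (\<integral>\<^sup>+y. 1 * indicator (S u) y \<partial>lborel)" by simp
    also have "\<dots> = (\<integral>\<^sup>+s. 1 * emeasure lborel (slice_prism u (S u) s) \<partial>lborel)"
      by (rule nn_integral_slices[OF unit[OF u]]) auto
    also have "\<dots> \<le> (\<integral>\<^sup>+s. ?w * indicator {h u<..h u + e * k u} s \<partial>lborel)"
    proof (rule nn_integral_mono)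
      fix s
      show "1 * emeasure lborel (slice_prism u (S u) s) \<le> ?w * indicator {h u<..h u + e * k u} s"
      proof (cases "h u < s \<and> s \<le> h u + e * k u")
        case True
        have sub: "slice_prism u (S u) s \<subseteq> slice_prism u (cell X (\<lambda>v. h v + e * (k v + k u))) (h u)"
        proof
          fix y assume y: "y \<in> slice_prism u (S u) s"
          define z where "z = y + (s - u \<bullet> y) *\<^sub>R u"
          have z: "z \<in> ?Q" using y by (auto simp: slice_prism_def S_def z_def)
          have "y + (h u - u \<bullet> y) *\<^sub>R u = z - (s - h u) *\<^sub>R u" by (simp add: z_def algebra_simps)
          also have "\<dots> \<in> cell X (\<lambda>v. h v + e * (k v + k u))" unfolding cell_def
          proof (clarify)
            fix v assume v: "v \<in> X"
            have "\<bar>v \<bullet> u\<bar> \<le> 1" using Cauchy_Schwarz_ineq2[of v u] unit[OF u] unit[OF v] by simp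
            then have "- ((s - h u) * (v \<bullet> u)) \<le> (s - h u) * 1"
              using True by (subst mult_minus_right[symmetric], intro mult_left_mono) auto
            also have "\<dots> \<le> e * k u" using True by simp
            finally have "- ((s - h u) * (v \<bullet> u)) \<le> e * k u" .
            moreover have "v \<bullet> z \<le> h v + e * k v" using z v by (auto simp: cell_def)
            ultimately show "v \<bullet> (z - (s - h u) *\<^sub>R u) \<le> h v + e * (k v + k u)"
              by (simp add: inner_diff_right algebra_simps)
          qed
          finally show "y \<in> slice_prism u (cell X (\<lambda>v. h v + e * (k v + k u))) (h u)"
            using y by (simp add: slice_prism_def)
        qed
        have "emeasure lborel (slice_prism u (S u) s) \<le> emeasure lborel (slice_prism u (cell X (\<lambda>v. h v + e * (k v + k u))) (h u))"
          by (rule emeasure_mono[OF sub]) (simp add: measurable_slice_prism)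
        then show ?thesis using True
          by (simp add: emeasure_compact_eq_measure[OF compact_prism] shell_area_def)
      next
        case False
        have "slice_prism u (S u) s = {}"
        proof (rule ccontr)
          assume "slice_prism u (S u) s \<noteq> {}"
          then obtain y where y: "y \<in> slice_prism u (S u) s" by auto
          have "u \<bullet> (y + (s - u \<bullet> y) *\<^sub>R u) = s" using inner_self[OF u] by (simp add: inner_add_right)
          then show False using y False u by (auto simp: slice_prism_def S_def cell_def)
        qed
        then show ?thesis by simp
      qed
    qed
    also have "\<dots> = ?w * ennreal (e * k u)"
      using e k[OF u] by (subst nn_integral_cmult_indicator) auto
    also have "\<dots> = ennreal (e * k u * shell_area k e u)"
      using e k[OF u] by (subst ennreal_mult[symmetric]) (auto simp: shell_area_def mult_ac)
    finally show ?thesis .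
  qed
  have nn: "0 \<le> e * k u * shell_area k e u" if "u \<in> X" for u
    using e k[OF that] by (simp add: shell_area_def)
  have "?Q \<subseteq> body \<union> (\<Union>u\<in>X. S u)" by (fastforce simp: S_def cell_def)
  then have "emeasure lborel ?Q \<le> emeasure lborel (body \<union> (\<Union>u\<in>X. S u))"
    by (rule emeasure_mono) (auto intro!: sets.Un sets.finite_UN fin)
  also have "\<dots> \<le> emeasure lborel body + emeasure lborel (\<Union>u\<in>X. S u)"
    by (rule emeasure_subadditive) (auto intro!: sets.finite_UN fin)
  also have "\<dots> \<le> emeasure lborel body + (\<Sum>u\<in>X. emeasure lborel (S u))"
    by (intro add_left_mono emeasure_subadditive_finite) (use fin in auto)
  also have "\<dots> \<le> emeasure lborel body + (\<Sum>u\<in>X. ennreal (e * k u * shell_area k e u))"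
    by (intro add_left_mono sum_mono S_le)
  also have "\<dots> = ennreal (measure lborel body + (\<Sum>u\<in>X. e * k u * shell_area k e u))"
    using nn by (simp add: sum_ennreal emeasure_compact_eq_measure[OF compact_cell] sum_nonneg)
  finally have "ennreal (measure lborel ?Q) \<le> ennreal (measure lborel body + (\<Sum>u\<in>X. e * k u * shell_area k e u))"
    by (simp add: emeasure_compact_eq_measure[OF compact_cell])
  then have "measure lborel ?Q \<le> measure lborel body + (\<Sum>u\<in>X. e * k u * shell_area k e u)"
    using nn by (subst (asm) ennreal_le_iff) (auto intro!: add_nonneg_nonneg sum_nonneg)
  then show ?thesis by (simp add: sum_distrib_left mult.assoc)
qed

text \<open>
  The enlarged facets are compact and decrease to the facet.
\<close>

lemma shell_area_limit:
  assumes k: "\<And>u. u \<in> X \<Longrightarrow> 0 < k u" and u: "u \<in> X"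
    and e: "decseq e" "\<And>n. 0 < e n" "e \<longlonglongrightarrow> 0"
  shows "(\<lambda>n. shell_area k (e n) u) \<longlonglongrightarrow> facet_area u"
proof -
  let ?Z = "\<lambda>n. slice_prism u (cell X (\<lambda>v. h v + e n * (k v + k u))) (h u)"
  have "(\<lambda>n. measure lborel (?Z n)) \<longlonglongrightarrow> measure lborel (\<Inter>n. ?Z n)"
  proof (rule Lim_measure_decseq)
    show "range ?Z \<subseteq> sets lborel" by (auto simp: measurable_slice_prism)
    show "emeasure lborel (?Z n) \<noteq> \<infinity>" for n
      by (simp add: emeasure_compact_eq_measure[OF compact_prism])
    have "cell X (\<lambda>v. h v + e n * (k v + k u)) \<subseteq> cell X (\<lambda>v. h v + e m * (k v + k u))" if "m \<le> n" for m n
    proof (rule cell_mono)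
      fix v assume "v \<in> X"
      then show "h v + e n * (k v + k u) \<le> h v + e m * (k v + k u)"
        using decseqD[OF e(1) that] k[OF u] k[of v] by (intro add_left_mono mult_right_mono) auto
    qed
    then show "decseq ?Z" by (auto simp: decseq_def slice_prism_def)
  qed
  moreover have "(\<Inter>n. ?Z n) = slice_prism u body (h u)"
  proof (intro equalityI subsetI)
    fix y assume y: "y \<in> (\<Inter>n. ?Z n)"
    have "y + (h u - u \<bullet> y) *\<^sub>R u \<in> body" unfolding cell_def
    proof clarify
      fix v assume v: "v \<in> X"
      have "(\<lambda>n. h v + e n * (k v + k u)) \<longlonglongrightarrow> h v + 0 * (k v + k u)"
        by (intro tendsto_intros e)
      then show "v \<bullet> (y + (h u - u \<bullet> y) *\<^sub>R u) \<le> h v"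
        by (rule tendsto_lowerbound[THEN order_trans])
           (use y v in \<open>auto simp: slice_prism_def cell_def intro!: always_eventually\<close>)
    qed
    then show "y \<in> slice_prism u body (h u)" using y by (auto simp: slice_prism_def)
  next
    fix y assume y: "y \<in> slice_prism u body (h u)"
    have "body \<subseteq> cell X (\<lambda>v. h v + e n * (k v + k u))" for n
    proof (rule cell_mono)
      fix v assume "v \<in> X"
      then show "h v \<le> h v + e n * (k v + k u)" using e(2)[of n] k[OF u] k[of v] by simp
    qed
    then show "y \<in> (\<Inter>n. ?Z n)" using y by (auto simp: slice_prism_def)
  qed
  ultimately show ?thesis unfolding shell_area_def facet_area_def by simp
qed

text \<open>
  Log-concavity of the volume along the segment from \<open>h\<close> to \<open>k\<close>, at the dyadic points accessible by repeated
  bisection towards \<open>h\<close>.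
\<close>

lemma measure_interpolated_cell_ge:
  assumes k: "\<And>u. u \<in> X \<Longrightarrow> 0 < k u"
  shows "measure lborel body * (measure lborel (cell X k) / measure lborel body) powr ((1/2)^n)
    \<le> measure lborel (cell X (\<lambda>u. (1 - (1/2)^n) * h u + (1/2)^n * k u))"
proof (induction n)
  case 0
  have "0 < measure lborel body" "0 < measure lborel (cell X k)" using pos k by (auto intro: measure_cell_pos)
  then show ?case by simp
next
  case (Suc n)
  let ?d = "(1/2::real)^n" and ?r = "measure lborel (cell X k) / measure lborel body"
  let ?V = "measure lborel body" and ?M = "measure lborel (cell X (\<lambda>u. (1 - ?d) * h u + ?d * k u))"
  let ?M' = "measure lborel (cell X (\<lambda>u. (1 - (1/2)^Suc n) * h u + (1/2)^Suc n * k u))"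
  have V: "0 < ?V" using pos by (auto intro: measure_cell_pos)
  have "?V * ?M \<le> ?M'^2"
  proof (rule brunn_minkowski_measure)
    fix a b assume a: "a \<in> body" and b: "b \<in> cell X (\<lambda>u. (1 - ?d) * h u + ?d * k u)"
    show "(a + b) /\<^sub>R 2 \<in> cell X (\<lambda>u. (1 - (1/2)^Suc n) * h u + (1/2)^Suc n * k u)"
      unfolding cell_def
    proof clarify
      fix u assume u: "u \<in> X"
      have "u \<bullet> a \<le> h u" "u \<bullet> b \<le> (1 - ?d) * h u + ?d * k u" using a b u by (auto simp: cell_def)
      then show "u \<bullet> ((a + b) /\<^sub>R 2) \<le> (1 - (1/2)^Suc n) * h u + (1/2)^Suc n * k u"
        by (simp add: inner_add_right algebra_simps)
    qed
  qed (auto intro!: fmeasurable_compact compact_cell)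
  moreover have "?V * (?V * ?r powr ?d) \<le> ?V * ?M" using Suc.IH V by (intro mult_left_mono) auto
  moreover have "?V * (?V * ?r powr ?d) = (?V * ?r powr ((1/2)^Suc n))^2"
    by (simp add: power2_eq_square powr_add[symmetric] mult_ac)
  ultimately have "(?V * ?r powr ((1/2)^Suc n))^2 \<le> ?M'^2" by linarith
  then show ?case by (rule power2_le_imp_le) simp
qed

text \<open>
  Moving from \<open>h\<close> towards \<open>k\<close>, log-concavity forces the volume to grow at least at the logarithmic rate \<open>ln r\<close>,
  where \<open>r\<close> is the ratio of the final to the initial volume, whereas to first order it changes by the sum of
  \<open>(k u - h u)\<close> times the area of the facet, which is not positive. Only upper bounds for outer
  parallel polytopes are needed: the interpolated polytope is the dilate by \<open>1 - d\<close> of the one with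
  the support numbers \<open>h + e * k\<close>, where \<open>e = d / (1 - d)\<close>.
\<close>

theorem minkowski_first_inequality:
  assumes k: "\<And>u. u \<in> X \<Longrightarrow> 0 < k u"
    and le: "(\<Sum>u\<in>X. k u * facet_area u) \<le> (\<Sum>u\<in>X. h u * facet_area u)"
  shows "measure lborel (cell X k) \<le> measure lborel body"
proof -
  let ?V = "measure lborel body" and ?N = "DIM('a)"
  define r where "r = measure lborel (cell X k) / ?V"
  have V: "0 < ?V" using pos by (auto intro: measure_cell_pos)
  have r: "0 < r" unfolding r_def using V measure_cell_pos[of k] k by simp
  \<comment> \<open>The power \<open>Suc n\<close> keeps the dilation factor \<open>1 - d n\<close> positive for \<open>n = 0\<close> too.\<close>
  define d where "d n = (1/2::real) ^ Suc n" for n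
  define e where "e n = d n / (1 - d n)" for n
  have d: "0 < d n" "d n < 1" for n
    using power_strict_decreasing[of 0 "Suc n" "1/2::real"] by (auto simp: d_def)
  have d0: "d \<longlonglongrightarrow> 0" unfolding d_def by (rule LIMSEQ_Suc) (rule LIMSEQ_power_zero, simp)
  have "e \<longlonglongrightarrow> 0 / (1 - 0)" unfolding e_def by (intro tendsto_intros d0) simp
  then have e0: "e \<longlonglongrightarrow> 0" by simp
  have epos: "0 < e n" for n using d[of n] by (simp add: e_def)
  have edec: "decseq e"
  proof (rule decseq_SucI)
    fix n
    have "d (Suc n) \<le> d n" by (simp add: d_def)
    then show "e (Suc n) \<le> e n" unfolding e_def using d[of n] d[of "Suc n"] by (intro frac_le) auto
  qed
  define S where "S n = (\<Sum>u\<in>X. k u * shell_area k (e n) u)" for n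
  have S: "S \<longlonglongrightarrow> (\<Sum>u\<in>X. k u * facet_area u)"
    unfolding S_def by (intro tendsto_sum tendsto_mult tendsto_const shell_area_limit k edec epos e0)
  have ineq: "?V * ln r \<le> ?V * (((1 + (- d n)) ^ ?N - 1) / d n) + (1 - d n) ^ (?N - 1) * S n" for n
  proof -
    let ?d = "d n"
    have d1: "0 < 1 - ?d" using d by simp
    have "?V * (1 + ?d * ln r) \<le> ?V * r powr ?d"
    proof (intro mult_left_mono)
      show "1 + ?d * ln r \<le> r powr ?d" using r exp_ge_add_one_self[of "?d * ln r"] by (simp add: powr_def)
    qed simp
    also have "\<dots> \<le> measure lborel (cell X (\<lambda>u. (1 - ?d) * h u + ?d * k u))"
      using measure_interpolated_cell_ge[OF k, where n="Suc n"] by (simp add: r_def d_def)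
    also have "(\<lambda>u. (1 - ?d) * h u + ?d * k u) = (\<lambda>u. (1 - ?d) * (h u + e n * k u))"
    proof
      fix u
      have "(1 - ?d) * e n = ?d" using d1 by (simp add: e_def)
      then show "(1 - ?d) * h u + ?d * k u = (1 - ?d) * (h u + e n * k u)"
        by (metis distrib_left mult.assoc)
    qed
    also have "measure lborel (cell X \<dots>) = (1 - ?d) ^ ?N * measure lborel (cell X (\<lambda>u. h u + e n * k u))"
      by (rule measure_cell_scale[OF d1])
    also have "\<dots> \<le> (1 - ?d) ^ ?N * (?V + e n * S n)"
      unfolding S_def using d1 by (intro mult_left_mono measure_outer_cell_le k epos) auto
    also have "\<dots> = (1 - ?d) ^ ?N * ?V + ?d * ((1 - ?d) ^ (?N - 1) * S n)"
    proof -
      have "(1 - ?d) ^ ?N = (1 - ?d) ^ (?N - 1) * (1 - ?d)"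
        by (rule power_minus_mult[symmetric]) simp
      moreover have "(1 - ?d) * e n = ?d" using d1 by (simp add: e_def)
      ultimately have "(1 - ?d) ^ ?N * e n = ?d * (1 - ?d) ^ (?N - 1)"
        by (simp add: mult.assoc mult.commute)
      then show ?thesis by (simp add: distrib_left mult.assoc[symmetric])
    qed
    finally have "?d * (?V * ln r) \<le> ?V * ((1 - ?d) ^ ?N - 1) + ?d * ((1 - ?d) ^ (?N - 1) * S n)"
      by (simp add: algebra_simps)
    then show ?thesis using d(1)[of n] by (simp add: field_simps)
  qed
  have "(\<lambda>n. ((1 + (- d n)) ^ ?N - 1) / (- d n)) \<longlonglongrightarrow> real ?N"
  proof (rule filterlim_compose[OF power_quotient_limit])
    show "filterlim (\<lambda>n. - d n) (at 0) sequentially"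
      unfolding filterlim_at using tendsto_minus[OF d0] d by (auto intro!: always_eventually simp: less_imp_neq[OF d(1), symmetric])
  qed
  from tendsto_minus[OF this] have "(\<lambda>n. ((1 + (- d n)) ^ ?N - 1) / d n) \<longlonglongrightarrow> - real ?N" by simp
  then have "(\<lambda>n. ?V * (((1 + (- d n)) ^ ?N - 1) / d n) + (1 - d n) ^ (?N - 1) * S n)
     \<longlonglongrightarrow> ?V * (- real ?N) + (1 - 0) ^ (?N - 1) * (\<Sum>u\<in>X. k u * facet_area u)"
    by (intro tendsto_intros S d0)
  then have "?V * ln r \<le> ?V * (- real ?N) + (1 - 0) ^ (?N - 1) * (\<Sum>u\<in>X. k u * facet_area u)"
    by (rule tendsto_lowerbound) (use ineq in \<open>auto intro!: always_eventually\<close>)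
  also have "\<dots> \<le> 0" using order_trans[OF le sum_area_le] by (simp add: mult.commute)
  finally have "ln r \<le> 0" using V by (simp add: mult_le_0_iff)
  then have "r \<le> 1" using r by simp
  then show ?thesis using V by (simp add: r_def)
qed

end

section \<open>Rotation invariance and moments of the sphere measure\<close>

lemma orthogonal_transformation_measurable:
  fixes f :: "'a::euclidean_space \<Rightarrow> 'a"
  shows "orthogonal_transformation f \<Longrightarrow> f \<in> borel_measurable borel"
  by (intro borel_measurable_continuous_onI linear_continuous_on)
     (simp add: orthogonal_transformation_linear linear_conv_bounded_linear[symmetric])

text \<open>
  The uniqueness argument for Haar measure. Tonelli's theorem exchanges the roles of the two sets in
  \<open>vol (f -` A) * vol (ball 0 1)\<close>, and the ball is mapped to itself by \<open>f\<close> and by \<open>uminus\<close>.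
\<close>

lemma lborel_distr_orthogonal:
  fixes f :: "'a::euclidean_space \<Rightarrow> 'a"
  assumes f: "orthogonal_transformation f"
  shows "distr lborel borel f = lborel"
proof (rule measure_eqI)
  fix A assume "A \<in> sets (distr lborel borel f)"
  then have [measurable]: "A \<in> sets borel" by simp
  note [measurable] = orthogonal_transformation_measurable[OF f]
  have lin: "linear f" by (rule orthogonal_transformation_linear[OF f])
  have surj: "surj f" by (rule orthogonal_transformation_surj[OF f])
  let ?B = "ball 0 1 :: 'a set"
  have [measurable]: "?B \<in> sets borel" by (rule borel_open) simp
  have "emeasure (distr lborel borel f) A * emeasure lborel ?B =
      (\<integral>\<^sup>+x. indicator A (f x) \<partial>lborel) * emeasure lborel ?B"
    by (simp add: nn_integral_indicator[symmetric] nn_integral_distr del: nn_integral_indicator)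
  also have "\<dots> = (\<integral>\<^sup>+x. (\<integral>\<^sup>+y. indicator A (f x) * indicator ?B y \<partial>lborel) \<partial>lborel)"
    by (subst nn_integral_cmult_indicator, simp) (rule nn_integral_multc[symmetric], measurable)
  also have "\<dots> = (\<integral>\<^sup>+x. (\<integral>\<^sup>+y. indicator A (f x) * indicator ?B (- f x + y) \<partial>lborel) \<partial>lborel)"
    by (rule nn_integral_cong, rule nn_integral_lborel_shift) measurable
  also have "\<dots> = (\<integral>\<^sup>+y. (\<integral>\<^sup>+x. indicator A (f x) * indicator ?B (- f x + y) \<partial>lborel) \<partial>lborel)"
    by (rule lborel_pair.Fubini') measurable
  also have "\<dots> = (\<integral>\<^sup>+y. (\<integral>\<^sup>+x. indicator A (y + f x) * indicator ?B x \<partial>lborel) \<partial>lborel)"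
  proof (rule nn_integral_cong)
    fix y :: 'a
    obtain z where z: "f z = y" using surj by (metis surjD)
    have "(\<integral>\<^sup>+x. indicator A (f x) * indicator ?B (- f x + y) \<partial>lborel) =
        (\<integral>\<^sup>+x. indicator A (f (z + x)) * indicator ?B (- f (z + x) + y) \<partial>lborel)"
      by (rule nn_integral_lborel_shift) measurable
    also have "\<dots> = (\<integral>\<^sup>+x. indicator A (y + f x) * indicator ?B x \<partial>lborel)"
      using f by (intro nn_integral_cong)
        (simp add: linear_add[OF lin] z indicator_def orthogonal_transformation_norm)
    finally show "(\<integral>\<^sup>+x. indicator A (f x) * indicator ?B (- f x + y) \<partial>lborel) =
        (\<integral>\<^sup>+x. indicator A (y + f x) * indicator ?B x \<partial>lborel)" .
  qed
  also have "\<dots> = (\<integral>\<^sup>+x. (\<integral>\<^sup>+y. indicator A (y + f x) * indicator ?B x \<partial>lborel) \<partial>lborel)"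
    by (rule lborel_pair.Fubini') measurable
  also have "\<dots> = (\<integral>\<^sup>+x. emeasure lborel A * indicator ?B x \<partial>lborel)"
  proof (rule nn_integral_cong)
    fix x :: 'a
    have "(\<integral>\<^sup>+y. indicator A (y + f x) \<partial>lborel) = (\<integral>\<^sup>+y. indicator A y \<partial>lborel)"
      using nn_integral_lborel_shift[of "indicator A" "f x"] by (simp add: add.commute)
    then show "(\<integral>\<^sup>+y. indicator A (y + f x) * indicator ?B x \<partial>lborel) = emeasure lborel A * indicator ?B x"
      by (simp add: nn_integral_multc)
  qed
  also have "\<dots> = emeasure lborel A * emeasure lborel ?B" by (simp add: nn_integral_cmult_indicator)
  finally have eq: "emeasure (distr lborel borel f) A * emeasure lborel ?B = emeasure lborel A * emeasure lborel ?B" .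
  have "emeasure lborel ?B \<noteq> top" using emeasure_lborel_ball_finite[of 0 1] by (simp add: less_top)
  moreover have "emeasure lborel ?B \<noteq> 0"
  proof
    assume "emeasure lborel ?B = 0"
    then have "negligible ?B" by (simp add: negligible_iff_null_sets null_sets_completionI null_sets_def)
    then show False using open_not_negligible[of ?B] by simp
  qed
  ultimately show "emeasure (distr lborel borel f) A = emeasure lborel A"
    using eq by (simp add: mult.commute[of _ "emeasure lborel ?B"] ennreal_mult_cancel_left)
qed simp

lemma measure_orthogonal:
  fixes f :: "'a::euclidean_space \<Rightarrow> 'a"
  assumes f: "orthogonal_transformation f" and K: "compact K"
  shows "measure lborel (f ` K) = measure lborel K"
proof -
  note [measurable] = orthogonal_transformation_measurable[OF f]
  have "compact (f ` K)"
    using orthogonal_transformation_linear[OF f] K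
    by (intro compact_continuous_image linear_continuous_on) (simp_all add: linear_conv_bounded_linear[symmetric])
  then have [measurable]: "f ` K \<in> sets borel" by (rule borel_compact)
  have "measure lborel (f ` K) = measure (distr lborel borel f) (f ` K)"
    by (simp add: lborel_distr_orthogonal[OF f])
  also have "\<dots> = measure lborel (f -` f ` K)" by (simp add: measure_distr)
  also have "f -` f ` K = K" using orthogonal_transformation_inj[OF f] by (simp add: inj_vimage_image_eq)
  finally show ?thesis .
qed

lemma orthogonal_sgn:
  fixes f :: "'a::euclidean_space \<Rightarrow> 'a"
  assumes "orthogonal_transformation f" shows "sgn (f x) = f (sgn x)"
  using assms by (simp add: sgn_div_norm orthogonal_transformation_norm
      linear_scale[OF orthogonal_transformation_linear])

lemma sgn_measurable [measurable]: "(sgn :: 'a::euclidean_space \<Rightarrow> 'a) \<in> borel_measurable borel"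
  unfolding sgn_div_norm[abs_def] by measurable

lemma sets_sphere_measure [measurable_cong, simp]: "sets (sphere_measure :: (real^'n) measure) = sets borel"
  by (simp add: sphere_measure_def)

lemma space_sphere_measure [simp]: "space (sphere_measure :: (real^'n) measure) = UNIV"
  by (simp add: sphere_measure_def)

lemma sets_sphere_prob [measurable_cong, simp]: "sets (sphere_prob :: (real^'n) measure) = sets borel"
  by (simp add: sphere_prob_def)

lemma space_sphere_prob [simp]: "space (sphere_prob :: (real^'n) measure) = UNIV"
  by (simp add: sphere_prob_def)

lemma sphere_borel [measurable]: "sphere (a::'a::euclidean_space) r \<in> sets borel"
  and cball_borel [measurable]: "cball (a::'a::euclidean_space) r \<in> sets borel"
  by (auto intro: borel_closed)

lemma emeasure_sphere_measure:
  assumes [measurable]: "A \<in> sets borel"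
  shows "emeasure (sphere_measure :: (real^'n) measure) A =
    (\<integral>\<^sup>+x. ennreal (real CARD('n)) * indicator (cball 0 1) x * indicator A (sgn x) \<partial>lborel)"
proof -
  have "emeasure (sphere_measure :: (real^'n) measure) A = (\<integral>\<^sup>+x. indicator A x \<partial>sphere_measure)" by simp
  also have "\<dots> = (\<integral>\<^sup>+x. indicator A (sgn x) \<partial>(density lborel (\<lambda>x. ennreal (real CARD('n)) * indicator (cball 0 1) x)))"
    unfolding sphere_measure_def by (rule nn_integral_distr) measurable
  also have "\<dots> = (\<integral>\<^sup>+x. ennreal (real CARD('n)) * indicator (cball 0 1) x * indicator A (sgn x) \<partial>lborel)"
    by (rule nn_integral_density) measurable
  finally show ?thesis .
qed

lemma emeasure_sphere:
  "emeasure (sphere_measure :: (real^'n) measure) (sphere 0 1) = ennreal (real CARD('n)) * emeasure lborel (cball 0 1 :: (real^'n) set)"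
proof -
  have "emeasure (sphere_measure :: (real^'n) measure) (sphere 0 1) =
     (\<integral>\<^sup>+x. ennreal (real CARD('n)) * indicator (cball 0 1 :: (real^'n) set) x \<partial>lborel)"
    unfolding emeasure_sphere_measure[OF sphere_borel]
  proof (rule nn_integral_cong_AE)
    show "AE x in lborel. ennreal (real CARD('n)) * indicator (cball 0 1) (x::real^'n) * indicator (sphere 0 1) (sgn x)
        = ennreal (real CARD('n)) * indicator (cball 0 1) x"
      using AE_lborel_singleton[of "0::real^'n"] by eventually_elim (simp add: norm_sgn indicator_def)
  qed
  then show ?thesis by (simp add: nn_integral_cmult_indicator)
qed

lemma emeasure_sphere_pos_finite:
  "emeasure (sphere_measure :: (real^'n) measure) (sphere 0 1) \<noteq> 0"
  "emeasure (sphere_measure :: (real^'n) measure) (sphere 0 1) \<noteq> top"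
proof -
  have e: "emeasure lborel (cball 0 1 :: (real^'n) set) = ennreal (measure lborel (cball 0 1 :: (real^'n) set))"
    by (rule emeasure_compact_eq_measure) simp
  have "0 < measure lborel (cball 0 1 :: (real^'n) set)"
    by (rule measure_open_pos[of "ball 0 1"]) auto
  then show "emeasure (sphere_measure :: (real^'n) measure) (sphere 0 1) \<noteq> 0"
    "emeasure (sphere_measure :: (real^'n) measure) (sphere 0 1) \<noteq> top"
    unfolding emeasure_sphere e by (auto simp: ennreal_mult_eq_top_iff)
qed

lemma emeasure_sphere_prob:
  assumes [measurable]: "A \<in> sets borel"
  shows "emeasure (sphere_prob :: (real^'n) measure) A = emeasure sphere_measure (sphere 0 1 \<inter> A) / emeasure (sphere_measure :: (real^'n) measure) (sphere 0 1)"
  unfolding sphere_prob_def by (rule emeasure_uniform_measure) auto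

lemma emeasure_sphere_prob_UNIV: "emeasure (sphere_prob :: (real^'n) measure) UNIV = 1"
  using emeasure_sphere_pos_finite[where 'n='n]
  by (simp add: emeasure_sphere_prob ennreal_divide_self less_top)

lemma finite_measure_sphere_prob: "finite_measure (sphere_prob :: (real^'n) measure)"
  by (rule finite_measureI) (simp add: emeasure_sphere_prob_UNIV)

lemma measure_sphere_prob_UNIV: "measure (sphere_prob :: (real^'n) measure) UNIV = 1"
  by (simp add: measure_def emeasure_sphere_prob_UNIV)

lemma AE_sphere_prob: "AE x in (sphere_prob :: (real^'n) measure). norm x = 1"
proof -
  have "AE x in (sphere_prob :: (real^'n) measure). x \<in> sphere 0 1"
  proof (rule AE_I[where N="- sphere 0 1"])
    show "emeasure (sphere_prob :: (real^'n) measure) (- sphere 0 1) = 0"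
      by (subst emeasure_sphere_prob) auto
  qed auto
  then show ?thesis by eventually_elim simp
qed

text \<open>
  Orthogonal maps commute with the radial projection \<open>sgn\<close>.
\<close>

lemma sphere_prob_distr_orthogonal:
  fixes g :: "real^'n \<Rightarrow> real^'n"
  assumes g: "orthogonal_transformation g"
  shows "distr sphere_prob borel g = sphere_prob"
proof (rule measure_eqI)
  note [measurable] = orthogonal_transformation_measurable[OF g]
  fix A assume "A \<in> sets (distr sphere_prob borel g)"
  then have [measurable]: "A \<in> sets borel" by simp
  have pre: "g -` A \<in> sets borel"
    using measurable_sets[OF orthogonal_transformation_measurable[OF g], of A] by simp
  have "emeasure sphere_measure (sphere 0 1 \<inter> g -` A) =
     (\<integral>\<^sup>+x. ennreal (real CARD('n)) * indicator (cball 0 1) x * indicator (sphere 0 1 \<inter> A) (sgn (g x)) \<partial>lborel)"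
    using pre g by (subst emeasure_sphere_measure)
      (auto intro!: nn_integral_cong simp: indicator_def orthogonal_sgn orthogonal_transformation_norm)
  also have "\<dots> = (\<integral>\<^sup>+x. ennreal (real CARD('n)) * indicator (cball 0 1) (g x) * indicator (sphere 0 1 \<inter> A) (sgn (g x)) \<partial>lborel)"
    using g by (intro nn_integral_cong) (simp add: indicator_def orthogonal_transformation_norm)
  also have "\<dots> = (\<integral>\<^sup>+x. ennreal (real CARD('n)) * indicator (cball 0 1) x * indicator (sphere 0 1 \<inter> A) (sgn x) \<partial>(distr lborel borel g))"
    by (rule nn_integral_distr[symmetric]) measurable
  also have "\<dots> = emeasure sphere_measure (sphere 0 1 \<inter> A)"
    unfolding lborel_distr_orthogonal[OF g] by (rule emeasure_sphere_measure[symmetric]) measurable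
  finally show "emeasure (distr sphere_prob borel g) A = emeasure sphere_prob A"
    using pre by (simp add: emeasure_distr emeasure_sphere_prob)
qed simp

lemma integral_sphere_prob_orthogonal:
  fixes g :: "real^'n \<Rightarrow> real^'n" and f :: "real^'n \<Rightarrow> 'b::{banach, second_countable_topology}"
  assumes g: "orthogonal_transformation g" and [measurable]: "f \<in> borel_measurable borel"
  shows "(LINT x|sphere_prob. f (g x)) = (LINT x|sphere_prob. f x)"
proof -
  note [measurable] = orthogonal_transformation_measurable[OF g]
  have "(LINT x|sphere_prob. f x) = (LINT x|distr sphere_prob borel g. f x)"
    by (simp add: sphere_prob_distr_orthogonal[OF g])
  also have "\<dots> = (LINT x|sphere_prob. f (g x))" by (rule integral_distr) measurable
  finally show ?thesis by simp
qed

lemma integrable_sphere_prob: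
  fixes f :: "real^'n \<Rightarrow> 'b::{banach, second_countable_topology}"
  assumes [measurable]: "f \<in> borel_measurable borel" and B: "\<And>x. norm x = 1 \<Longrightarrow> norm (f x) \<le> B"
  shows "integrable sphere_prob f"
proof (rule finite_measure.integrable_const_bound[OF finite_measure_sphere_prob])
  show "AE x in sphere_prob. norm (f x) \<le> B" using AE_sphere_prob by eventually_elim (rule B)
qed simp

lemma integral_inner_sphere: "(LINT x|sphere_prob. x \<bullet> w) = 0" for w :: "real^'n"
proof -
  have "(LINT x|sphere_prob. (- x) \<bullet> w) = (LINT x|sphere_prob. x \<bullet> w)"
    by (rule integral_sphere_prob_orthogonal[of uminus]) (auto simp: orthogonal_transformation_neg)
  then show ?thesis by simp
qed

lemma integrable_inner_inner_sphere: "integrable sphere_prob (\<lambda>x::real^'n. (x \<bullet> a) * (x \<bullet> b))"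
proof (rule integrable_sphere_prob)
  fix x :: "real^'n" assume x: "norm x = 1"
  have "\<bar>x \<bullet> a\<bar> \<le> norm a" "\<bar>x \<bullet> b\<bar> \<le> norm b"
    using Cauchy_Schwarz_ineq2[of x a] Cauchy_Schwarz_ineq2[of x b] x by auto
  then show "norm ((x \<bullet> a) * (x \<bullet> b)) \<le> norm a * norm b"
    by (simp add: abs_mult mult_mono)
qed measurable

text \<open>
  By rotation invariance the integral depends on the norm of \<open>w\<close> only, and over an orthonormal basis the
  values add up to \<open>1\<close>.
\<close>

lemma integral_inner_sq_sphere: "(LINT x|sphere_prob. (x \<bullet> w)^2) = (norm w)^2 / real CARD('n)" for w :: "real^'n"
proof -
  define q where "q w = (LINT x|sphere_prob. (x \<bullet> w)^2)" for w :: "real^'n"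
  have q_norm: "q a = q b" if ab: "norm a = norm b" for a b
  proof -
    obtain f where f: "orthogonal_transformation f" "f a = b" using orthogonal_transformation_exists[OF ab] by blast
    have "q b = (LINT x|sphere_prob. (f x \<bullet> f a)^2)"
      unfolding q_def f(2) by (rule integral_sphere_prob_orthogonal[OF f(1), symmetric]) measurable
    also have "\<dots> = q a" using f(1) by (simp add: q_def orthogonal_transformation_def)
    finally show ?thesis by simp
  qed
  have int: "integrable sphere_prob (\<lambda>x::real^'n. (x \<bullet> a)^2)" for a
    using integrable_inner_inner_sphere[of a a] by (simp add: power2_eq_square)
  obtain i0 :: 'n where True by blast
  have "real CARD('n) * q (axis i0 1) = (\<Sum>i\<in>(UNIV::'n set). q (axis i0 1))" by simp
  also have "\<dots> = (\<Sum>i\<in>UNIV. q (axis i 1))" by (intro sum.cong refl q_norm) simp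
  also have "\<dots> = (LINT x|sphere_prob. (\<Sum>i\<in>UNIV. ((x::real^'n) \<bullet> axis i 1)^2))"
    unfolding q_def by (rule Bochner_Integration.integral_sum[symmetric]) (rule int)
  also have "\<dots> = (LINT x|(sphere_prob::(real^'n) measure). 1)"
  proof (rule integral_cong_AE)
    show "AE x in sphere_prob. (\<Sum>i\<in>UNIV. ((x::real^'n) \<bullet> axis i 1)^2) = 1"
      using AE_sphere_prob
    proof eventually_elim
      case (elim x)
      have "(\<Sum>i\<in>UNIV. (x \<bullet> axis i 1)^2) = x \<bullet> x"
        unfolding inner_vec_def[of x x] by (simp add: inner_axis power2_eq_square)
      then show ?case using elim by (simp add: dot_square_norm)
    qed
  qed measurable
  also have "\<dots> = 1" by (simp add: measure_sphere_prob_UNIV)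
  finally have q1: "q (axis i0 1) = 1 / real CARD('n)" by (simp add: field_simps)
  have "q w = q (norm w *\<^sub>R axis i0 1)" by (rule q_norm) simp
  also have "\<dots> = (norm w)^2 * q (axis i0 1)" by (simp add: q_def power_mult_distrib)
  finally show ?thesis by (simp add: q_def[symmetric] q1)
qed

text \<open>
  Polarization of the preceding identity.
\<close>

lemma integral_inner_inner_sphere:
  "(LINT x|sphere_prob. (x \<bullet> a) * (x \<bullet> b)) = (a \<bullet> b) / real CARD('n)" for a b :: "real^'n"
proof -
  have int: "integrable sphere_prob (\<lambda>x::real^'n. (x \<bullet> a)^2)" for a
    using integrable_inner_inner_sphere[of a a] by (simp add: power2_eq_square)
  have "(LINT x|sphere_prob. (x \<bullet> a) * (x \<bullet> b)) = (LINT x|sphere_prob. ((x \<bullet> (a + b))^2 - (x \<bullet> (a - b))^2) / 4)"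
    by (intro Bochner_Integration.integral_cong) (auto simp: inner_add_right inner_diff_right power2_eq_square algebra_simps)
  also have "\<dots> = ((norm (a + b))^2 / real CARD('n) - (norm (a - b))^2 / real CARD('n)) / 4"
    using int by (simp add: integral_inner_sq_sphere)
  also have "\<dots> = (a \<bullet> b) / real CARD('n)"
    by (simp add: power2_norm_eq_inner inner_add_left inner_add_right inner_diff_left inner_diff_right inner_commute field_simps)
  finally show ?thesis .
qed

section \<open>Moments of spherical designs\<close>

lemma finite_exponents: "finite {\<alpha> :: 'n::finite \<Rightarrow> nat. (\<Sum>i\<in>UNIV. \<alpha> i) \<le> t}"
proof (rule finite_subset)
  show "{\<alpha> :: 'n \<Rightarrow> nat. (\<Sum>i\<in>UNIV. \<alpha> i) \<le> t} \<subseteq> PiE UNIV (\<lambda>_. {..t})"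
  proof
    fix \<alpha> :: "'n \<Rightarrow> nat" assume "\<alpha> \<in> {\<alpha>. (\<Sum>i\<in>UNIV. \<alpha> i) \<le> t}"
    then have "\<alpha> i \<le> t" for i using member_le_sum[of i UNIV \<alpha>] by auto
    then show "\<alpha> \<in> PiE UNIV (\<lambda>_. {..t})" by (auto simp: PiE_def)
  qed
qed (auto intro: finite_PiE)

lemma polynomial_fun_monomial:
  assumes "(\<Sum>i\<in>UNIV. \<alpha> i) \<le> t"
  shows "polynomial_fun t (\<lambda>x::real^'n. \<Prod>i\<in>UNIV. x $ i ^ \<alpha> i)"
  unfolding polynomial_fun_def
proof (intro exI allI)
  fix x :: "real^'n"
  have "(\<Sum>\<beta> | (\<Sum>i\<in>UNIV. \<beta> i) \<le> t. (if \<beta> = \<alpha> then 1 else 0) * (\<Prod>i\<in>UNIV. x $ i ^ \<beta> i)) =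
    (\<Sum>\<beta> | (\<Sum>i\<in>UNIV. \<beta> i) \<le> t. if \<beta> = \<alpha> then (\<Prod>i\<in>UNIV. x $ i ^ \<beta> i) else 0)"
    by (intro sum.cong) auto
  then show "(\<Prod>i\<in>UNIV. x $ i ^ \<alpha> i) =
     (\<Sum>\<beta> | (\<Sum>i\<in>UNIV. \<beta> i) \<le> t. (\<lambda>\<beta>. if \<beta> = \<alpha> then 1 else 0) \<beta> * (\<Prod>i\<in>UNIV. x $ i ^ \<beta> i))"
    using assms by (simp add: finite_exponents)
qed

lemma polynomial_fun_add:
  assumes "polynomial_fun t p" "polynomial_fun t q"
  shows "polynomial_fun t (\<lambda>x. p x + q x)"
proof -
  obtain c d where "\<And>x. p x = (\<Sum>\<alpha> | (\<Sum>i\<in>UNIV. \<alpha> i) \<le> t. c \<alpha> * (\<Prod>i\<in>UNIV. x $ i ^ \<alpha> i))"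
    "\<And>x. q x = (\<Sum>\<alpha> | (\<Sum>i\<in>UNIV. \<alpha> i) \<le> t. d \<alpha> * (\<Prod>i\<in>UNIV. x $ i ^ \<alpha> i))"
    using assms by (auto simp: polynomial_fun_def)
  then show ?thesis unfolding polynomial_fun_def
    by (intro exI[of _ "\<lambda>\<alpha>. c \<alpha> + d \<alpha>"]) (simp add: sum.distrib distrib_right)
qed

lemma polynomial_fun_cmult:
  assumes "polynomial_fun t p" shows "polynomial_fun t (\<lambda>x. b * p x)"
proof -
  obtain c where "\<And>x. p x = (\<Sum>\<alpha> | (\<Sum>i\<in>UNIV. \<alpha> i) \<le> t. c \<alpha> * (\<Prod>i\<in>UNIV. x $ i ^ \<alpha> i))"
    using assms by (auto simp: polynomial_fun_def)
  then show ?thesis unfolding polynomial_fun_def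
    by (intro exI[of _ "\<lambda>\<alpha>. b * c \<alpha>"]) (simp add: sum_distrib_left mult.assoc)
qed

lemma polynomial_fun_sum:
  assumes "finite I" "\<And>i. i \<in> I \<Longrightarrow> polynomial_fun t (p i)"
  shows "polynomial_fun t (\<lambda>x. \<Sum>i\<in>I. p i x)"
  using assms
proof (induction I rule: finite_induct)
  case empty
  show ?case by (simp add: polynomial_fun_def) (rule exI[of _ "\<lambda>_. 0"], simp)
qed (auto intro: polynomial_fun_add)

lemma prod_power_delta: "(\<Prod>k\<in>UNIV. y k ^ (if k = i then 1 else 0)) = (y i :: real)" for i :: "'n::finite"
proof -
  have "(\<Prod>k\<in>UNIV. y k ^ (if k = i then 1 else 0)) = (\<Prod>k\<in>UNIV. if k = i then y k else 1)"
    by (intro prod.cong) auto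
  then show ?thesis by simp
qed

lemma polynomial_fun_inner: "polynomial_fun 2 (\<lambda>x::real^'n. x \<bullet> w)"
proof -
  have "polynomial_fun 2 (\<lambda>x::real^'n. \<Sum>i\<in>UNIV. w $ i * (\<Prod>k\<in>UNIV. x $ k ^ (if k = i then 1 else 0)))"
    by (intro polynomial_fun_sum polynomial_fun_cmult polynomial_fun_monomial) auto
  also have "(\<lambda>x::real^'n. \<Sum>i\<in>UNIV. w $ i * (\<Prod>k\<in>UNIV. x $ k ^ (if k = i then 1 else 0))) = (\<lambda>x. x \<bullet> w)"
    unfolding prod_power_delta by (auto simp: inner_vec_def mult.commute)
  finally show ?thesis .
qed

lemma polynomial_fun_inner_inner: "polynomial_fun 2 (\<lambda>x::real^'n. (x \<bullet> v) * (x \<bullet> w))"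
proof -
  let ?\<delta> = "\<lambda>i k. if k = i then 1 else 0 :: nat"
  have "polynomial_fun 2 (\<lambda>x::real^'n. \<Sum>i\<in>UNIV. \<Sum>j\<in>UNIV. (v $ i * w $ j) * (\<Prod>k\<in>UNIV. x $ k ^ (?\<delta> i k + ?\<delta> j k)))"
    by (intro polynomial_fun_sum polynomial_fun_cmult polynomial_fun_monomial) (auto simp: sum.distrib)
  also have "(\<lambda>x::real^'n. \<Sum>i\<in>UNIV. \<Sum>j\<in>UNIV. (v $ i * w $ j) * (\<Prod>k\<in>UNIV. x $ k ^ (?\<delta> i k + ?\<delta> j k)))
      = (\<lambda>x. (x \<bullet> v) * (x \<bullet> w))"
    unfolding power_add prod.distrib prod_power_delta
    by (auto simp: inner_vec_def sum_product mult_ac)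
  finally show ?thesis .
qed

lemma design_first_moment:
  assumes "spherical_design 2 X" shows "(\<Sum>x\<in>X. x \<bullet> w) = 0"
proof -
  have "(\<Sum>x\<in>X. x \<bullet> w) / real (card X) = (LINT x|sphere_prob. x \<bullet> w)"
    using assms polynomial_fun_inner[of w] unfolding spherical_design_def by blast
  moreover have "card X \<noteq> 0" using assms by (auto simp: spherical_design_def)
  ultimately show ?thesis by (simp add: integral_inner_sphere)
qed

lemma design_second_moment:
  fixes X :: "(real^'n) set"
  assumes "spherical_design 2 X"
  shows "(\<Sum>x\<in>X. (x \<bullet> v) * (x \<bullet> w)) = real (card X) / real CARD('n) * (v \<bullet> w)"
proof -
  have "(\<Sum>x\<in>X. (x \<bullet> v) * (x \<bullet> w)) / real (card X) = (LINT x|sphere_prob. (x \<bullet> v) * (x \<bullet> w))"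
    using assms polynomial_fun_inner_inner[of v w] unfolding spherical_design_def by blast
  moreover have "card X \<noteq> 0" using assms by (auto simp: spherical_design_def)
  ultimately show ?thesis by (simp add: integral_inner_inner_sphere field_simps)
qed

section \<open>Support functions and Steiner points\<close>

lemma bdd_above_inner_compact: "compact P \<Longrightarrow> bdd_above ((\<lambda>y. u \<bullet> y) ` P)"
  by (intro bounded_imp_bdd_above compact_imp_bounded compact_continuous_image continuous_intros)

lemma le_support_function: "compact P \<Longrightarrow> y \<in> P \<Longrightarrow> u \<bullet> y \<le> support_function P u"
  unfolding support_function_def by (intro cSUP_upper bdd_above_inner_compact)

lemma support_function_least: "P \<noteq> {} \<Longrightarrow> (\<And>y. y \<in> P \<Longrightarrow> u \<bullet> y \<le> c) \<Longrightarrow> support_function P u \<le> c"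
  unfolding support_function_def by (rule cSUP_least)

lemma support_function_lipschitz:
  assumes P: "compact P" "P \<noteq> {}"
  obtains B where "B-lipschitz_on UNIV (support_function P)"
proof -
  obtain B where B: "\<And>y. y \<in> P \<Longrightarrow> norm y \<le> B" using compact_imp_bounded[OF P(1)] by (auto simp: bounded_iff)
  then have B0: "0 \<le> B" using P(2) norm_ge_zero order_trans by blast
  have le: "support_function P u \<le> support_function P v + B * dist u v" for u v
  proof (rule support_function_least[OF P(2)])
    fix y assume y: "y \<in> P"
    have "u \<bullet> y = v \<bullet> y + (u - v) \<bullet> y" by (simp add: inner_diff_left)
    also have "(u - v) \<bullet> y \<le> norm (u - v) * norm y" by (rule norm_cauchy_schwarz)
    also have "\<dots> \<le> B * dist u v" using B[OF y] by (simp add: dist_norm mult.commute mult_right_mono)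
    finally show "u \<bullet> y \<le> support_function P v + B * dist u v" using le_support_function[OF P(1) y, of v] by simp
  qed
  have "B-lipschitz_on UNIV (support_function P)"
  proof (rule lipschitz_onI[OF _ B0])
    fix u v show "dist (support_function P u) (support_function P v) \<le> B * dist u v"
      using le[of u v] le[of v u] by (simp add: dist_real_def dist_commute abs_le_iff)
  qed
  then show thesis by (rule that)
qed

lemma integrable_support_function:
  fixes P :: "(real^'n) set"
  assumes P: "compact P" "P \<noteq> {}"
  shows "support_function P \<in> borel_measurable borel" "integrable sphere_prob (\<lambda>u. support_function P u *\<^sub>R u)"
proof -
  obtain B where B: "B-lipschitz_on UNIV (support_function P)" using support_function_lipschitz[OF P] .
  show [measurable]: "support_function P \<in> borel_measurable borel"
    by (intro borel_measurable_continuous_onI lipschitz_on_continuous_on[OF B])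
  show "integrable sphere_prob (\<lambda>u. support_function P u *\<^sub>R u)"
  proof (rule integrable_sphere_prob)
    fix u :: "real^'n" assume u: "norm u = 1"
    have "\<bar>support_function P u - support_function P 0\<bar> \<le> B * norm u"
      using lipschitz_onD[OF B, of u 0] by (simp add: dist_real_def)
    then show "norm (support_function P u *\<^sub>R u) \<le> B + \<bar>support_function P 0\<bar>" using u by simp
  qed measurable
qed

lemma orthogonal_inv_inner:
  fixes g :: "'a::euclidean_space \<Rightarrow> 'a"
  assumes g: "orthogonal_transformation g" shows "u \<bullet> g y = inv g u \<bullet> y"
proof -
  have "inv g u \<bullet> y = g (inv g u) \<bullet> g y" using g by (simp add: orthogonal_transformation_def)
  then show ?thesis using surj_f_inv_f[OF orthogonal_transformation_surj[OF g]] by simp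
qed

lemma support_function_orthogonal:
  fixes g :: "real^'n \<Rightarrow> real^'n"
  shows "orthogonal_transformation g \<Longrightarrow> support_function (g ` P) u = support_function P (inv g u)"
  by (simp add: support_function_def image_image orthogonal_inv_inner)

lemma steiner_point_orthogonal:
  fixes P :: "(real^'n) set" and g :: "real^'n \<Rightarrow> real^'n"
  assumes g: "orthogonal_transformation g" and P: "compact P" "P \<noteq> {}"
  shows "steiner_point (g ` P) = g (steiner_point P)"
proof -
  note [measurable] = integrable_support_function(1)[OF P] orthogonal_transformation_measurable[OF g]
    orthogonal_transformation_measurable[OF orthogonal_transformation_inv[OF g]]
  have lin: "linear g" by (rule orthogonal_transformation_linear[OF g])
  have "(LINT u|sphere_prob. support_function (g ` P) u *\<^sub>R u) = (LINT u|sphere_prob. support_function P (inv g u) *\<^sub>R u)"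
    by (simp add: support_function_orthogonal[OF g])
  also have "\<dots> = (LINT u|sphere_prob. support_function P (inv g (g u)) *\<^sub>R g u)"
    by (rule integral_sphere_prob_orthogonal[OF g, symmetric]) measurable
  also have "\<dots> = (LINT u|sphere_prob. g (support_function P u *\<^sub>R u))"
    by (simp add: inv_f_f[OF orthogonal_transformation_inj[OF g]] linear_scale[OF lin])
  also have "\<dots> = g (LINT u|sphere_prob. support_function P u *\<^sub>R u)"
    using lin integrable_support_function(2)[OF P]
    by (intro integral_bounded_linear) (simp_all add: linear_conv_bounded_linear)
  finally show ?thesis by (simp add: steiner_point_def linear_scale[OF lin])
qed

text \<open>
  The normalizing factor in \<open>steiner_point\<close> is the one for which the second moments of the sphere
  reproduce \<open>w\<close>.
\<close>

lemma steiner_point_translate: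
  fixes P L :: "(real^'n) set"
  assumes P: "compact P" "P \<noteq> {}" and L: "compact L" "L \<noteq> {}"
    and w: "\<And>u. norm u = 1 \<Longrightarrow> support_function P u = support_function L u + u \<bullet> w"
  shows "steiner_point P = steiner_point L + w"
proof -
  note [measurable] = integrable_support_function(1)[OF P] integrable_support_function(1)[OF L]
  have int: "integrable sphere_prob (\<lambda>u::real^'n. (u \<bullet> w) *\<^sub>R u)"
  proof (rule integrable_sphere_prob)
    fix u :: "real^'n" assume "norm u = 1"
    then show "norm ((u \<bullet> w) *\<^sub>R u) \<le> norm w" using Cauchy_Schwarz_ineq2[of u w] by simp
  qed measurable
  have "(LINT u|sphere_prob. (u \<bullet> w) *\<^sub>R u) \<bullet> b = w \<bullet> b / real CARD('n)" for b :: "real^'n"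
  proof -
    have "(LINT u|sphere_prob. (u \<bullet> w) *\<^sub>R u) \<bullet> b = (LINT u|sphere_prob. ((u \<bullet> w) *\<^sub>R u) \<bullet> b)"
      by (rule integral_inner_left[symmetric]) (rule int)
    then show ?thesis by (simp add: integral_inner_inner_sphere)
  qed
  then have "\<forall>b. (LINT u|sphere_prob. (u \<bullet> w) *\<^sub>R u) \<bullet> b = (w /\<^sub>R real CARD('n)) \<bullet> b"
    by (simp add: divide_inverse mult.commute)
  then have "(LINT u|sphere_prob. (u \<bullet> w) *\<^sub>R u) = w /\<^sub>R real CARD('n)"
    unfolding vector_eq_rdot .
  then have "real CARD('n) *\<^sub>R (LINT u|sphere_prob. (u \<bullet> w) *\<^sub>R u) = w" by simp
  moreover have "(LINT u|sphere_prob. support_function P u *\<^sub>R u)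
     = (LINT u|sphere_prob. support_function L u *\<^sub>R u + (u \<bullet> w) *\<^sub>R u)"
  proof (rule integral_cong_AE)
    show "AE u in sphere_prob. support_function P u *\<^sub>R u = support_function L u *\<^sub>R u + (u \<bullet> w) *\<^sub>R u"
      using AE_sphere_prob by eventually_elim (simp add: w scaleR_add_left)
  qed measurable
  then have "(LINT u|sphere_prob. support_function P u *\<^sub>R u)
     = (LINT u|sphere_prob. support_function L u *\<^sub>R u) + (LINT u|sphere_prob. (u \<bullet> w) *\<^sub>R u)"
    using int integrable_support_function(2)[OF L] by simp
  ultimately show ?thesis by (simp add: steiner_point_def scaleR_add_right)
qed

section \<open>Symmetry of the Minkowski polytope\<close>

text \<open>
  A segment from an interior point to a point outside \<open>P\<close> leaves \<open>P\<close> through a facet, whose defining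
  inequality is violated beyond.
\<close>

lemma polytope_eq_cell:
  fixes P :: "(real^'n) set"
  assumes P: "polytope P" and solid: "interior P \<noteq> {}"
  shows "P = cell (facet_normals P) (support_function P)"
proof (intro equalityI subsetI)
  have comp: "compact P" by (rule polytope_imp_compact[OF P])
  fix y assume "y \<in> P"
  then show "y \<in> cell (facet_normals P) (support_function P)"
    using le_support_function[OF comp] by (auto simp: cell_def)
next
  have comp: "compact P" by (rule polytope_imp_compact[OF P])
  have cvx: "convex P" by (rule polytope_imp_convex[OF P])
  fix y assume y: "y \<in> cell (facet_normals P) (support_function P)"
  obtain p where p: "p \<in> interior P" using solid by auto
  show "y \<in> P"
  proof (rule ccontr)
    assume nP: "y \<notin> P"
    have "closed_segment p y \<inter> frontier P \<noteq> {}"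
      by (rule connected_Int_frontier) (use p nP interior_subset in auto)
    then obtain z where z: "z \<in> closed_segment p y" "z \<in> frontier P" by auto
    have "rel_interior P = interior P" by (rule rel_interior_nonempty_interior[OF solid])
    then have "z \<in> P - rel_interior P"
      using z comp by (simp add: frontier_def compact_imp_closed)
    then obtain F where F: "F facet_of P" "z \<in> F"
      unfolding rel_boundary_of_polyhedron[OF polytope_imp_polyhedron[OF P]] by auto
    obtain a b where ab: "a \<noteq> 0" "P \<subseteq> {x. a \<bullet> x \<le> b}" "F = P \<inter> {x. a \<bullet> x = b}"
      using facet_of_polyhedron[OF polytope_imp_polyhedron[OF P] F(1)] by metis
    define u where "u = a /\<^sub>R norm a"
    have u: "norm u = 1" using ab(1) by (simp add: u_def)
    have ax: "a \<bullet> x = norm a * (u \<bullet> x)" for x using ab(1) by (simp add: u_def)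
    have na: "0 < norm a" using ab(1) by simp
    have zP: "z \<in> P" "a \<bullet> z = b" using F(2) ab(3) by auto
    have uz: "u \<bullet> x \<le> u \<bullet> z" if "x \<in> P" for x
      using ab(2) that zP na by (auto simp: ax)
    have h: "support_function P u = u \<bullet> z"
      using uz zP le_support_function[OF comp zP(1), of u] by (intro antisym support_function_least) auto
    have "support_face P u = F"
      unfolding support_face_def h ab(3) zP(2)[symmetric] using na by (auto simp: ax)
    then have "u \<in> facet_normals P" using F(1) u by (simp add: facet_normals_def)
    then have uy: "u \<bullet> y \<le> u \<bullet> z" using y h by (auto simp: cell_def)
    have up: "u \<bullet> p < u \<bullet> z"
    proof -
      obtain e where e: "0 < e" "ball p e \<subseteq> P" using p by (meson mem_interior)
      have "p + (e/2) *\<^sub>R u \<in> P" using e u by (intro subsetD[OF e(2)]) (simp add: dist_norm)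
      from uz[OF this] show ?thesis using e u by (simp add: inner_add_right dot_square_norm)
    qed
    obtain t where t: "0 \<le> t" "t \<le> 1" "z = (1 - t) *\<^sub>R p + t *\<^sub>R y" using z(1) by (auto simp: in_segment)
    have "u \<bullet> z = (1 - t) * (u \<bullet> p) + t * (u \<bullet> y)" by (simp add: t(3) inner_add_right)
    also have "\<dots> \<le> (1 - t) * (u \<bullet> p) + t * (u \<bullet> z)" using uy t by (intro add_left_mono mult_left_mono) auto
    finally have "(1 - t) * (u \<bullet> z) \<le> (1 - t) * (u \<bullet> p)" by (simp add: algebra_simps)
    then have "t = 1" using up t by (cases "t = 1") (auto simp: mult_le_cancel_left)
    then have "z = y" using t by simp
    then show False using zP nP by simp
  qed
qed

text \<open>
  Both sides measure a prism over the same face, placed at different heights.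
\<close>

lemma area_support_face:
  fixes P :: "(real^'n) set"
  assumes u: "norm u = 1" and P: "compact P"
  shows "area u (support_face P u) = measure lborel (slice_prism u P (support_function P u))"
proof -
  let ?h = "support_function P u"
  have uu: "u \<bullet> u = 1" using u by (simp add: dot_square_norm)
  have "{y + s *\<^sub>R u | y s. y \<in> support_face P u \<and> 0 \<le> s \<and> s \<le> 1} = (\<lambda>z. 1 *\<^sub>R z + ?h *\<^sub>R u) ` slice_prism u P ?h"
  proof (intro equalityI subsetI)
    fix w assume "w \<in> {y + s *\<^sub>R u | y s. y \<in> support_face P u \<and> 0 \<le> s \<and> s \<le> 1}"
    then obtain y s where ys: "w = y + s *\<^sub>R u" "y \<in> P" "u \<bullet> y = ?h" "0 \<le> s" "s \<le> 1"
      by (auto simp: support_face_def)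
    have "u \<bullet> (w - ?h *\<^sub>R u) = s" using ys by (simp add: inner_add_right inner_diff_right uu)
    then have "w - ?h *\<^sub>R u \<in> slice_prism u P ?h" using ys by (simp add: slice_prism_def algebra_simps)
    then show "w \<in> (\<lambda>z. 1 *\<^sub>R z + ?h *\<^sub>R u) ` slice_prism u P ?h" by (rule rev_image_eqI) simp
  next
    fix w assume "w \<in> (\<lambda>z. 1 *\<^sub>R z + ?h *\<^sub>R u) ` slice_prism u P ?h"
    then obtain z where z: "z \<in> slice_prism u P ?h" "w = z + ?h *\<^sub>R u" by auto
    have "z + (?h - u \<bullet> z) *\<^sub>R u \<in> support_face P u"
      using z by (simp add: support_face_def slice_prism_def inner_add_right uu)
    moreover have "w = (z + (?h - u \<bullet> z) *\<^sub>R u) + (u \<bullet> z) *\<^sub>R u" by (simp add: z(2) algebra_simps)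
    moreover have "0 \<le> u \<bullet> z" "u \<bullet> z \<le> 1" using z by (auto simp: slice_prism_def)
    ultimately show "w \<in> {y + s *\<^sub>R u | y s. y \<in> support_face P u \<and> 0 \<le> s \<and> s \<le> 1}" by blast
  qed
  then show ?thesis
    unfolding area_def by (simp only: measure_homothety[OF compact_slice_prism[OF P]]) simp
qed

text \<open>
  If the origin is not interior, \<open>P\<close> lies in a half-space bounded by a hyperplane through the origin, and
  the polar contains the ray spanned by its outer normal.
\<close>

lemma zero_in_interior_if_bounded_polar:
  fixes P :: "(real^'n) set"
  assumes P: "convex P" "interior P \<noteq> {}" and "bounded (polar P)"
  shows "0 \<in> interior P"
proof (rule ccontr)
  assume "0 \<notin> interior P"
  then obtain a where a: "a \<noteq> 0" "\<And>y. y \<in> interior P \<Longrightarrow> 0 \<le> a \<bullet> y"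
    using separating_hyperplane_set_0[OF convex_interior[OF P(1)]] by blast
  have "P \<subseteq> closure (interior P)" using convex_closure_interior[OF P] closure_subset by blast
  also have "\<dots> \<subseteq> {y. 0 \<le> a \<bullet> y}"
    by (rule closure_minimal) (auto intro: a(2) closed_halfspace_ge)
  finally have sub: "0 \<le> a \<bullet> y" if "y \<in> P" for y using that by auto
  obtain B where B: "\<And>z. z \<in> polar P \<Longrightarrow> norm z \<le> B" using assms(3) by (auto simp: bounded_iff)
  \<comment> \<open>The point \<open>- t a\<close> of the polar then has norm \<open>\<bar>B\<bar> + 1 > B\<close>.\<close>
  define t where "t = (\<bar>B\<bar> + 1) / norm a"
  have "(- t) *\<^sub>R a \<in> polar P"
  proof -
    have "0 \<le> t" by (simp add: t_def)
    then have "- t * (a \<bullet> y) \<le> 1" if "y \<in> P" for y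
      using mult_nonneg_nonneg[OF _ sub[OF that], of t] by simp
    then show ?thesis by (simp add: polar_def)
  qed
  from B[OF this] show False using a(1) by (simp add: t_def)
qed

text \<open>
  Uniqueness in Minkowski's problem, for the two solutions \<open>P\<close> and \<open>g ` P\<close>. The polytope with the averaged
  support numbers \<open>k\<close> serves as the midpoint body, which the first inequality bounds from above and
  Brunn--Minkowski from below.
\<close>

theorem support_function_invariant:
  fixes X P :: "(real^'n) set" and g :: "real^'n \<Rightarrow> real^'n"
  assumes X: "finite X" and M: "minkowski_polytope X P" and s0: "steiner_point P = 0" and int: "0 \<in> interior P"
    and g: "orthogonal_transformation g" and gX: "g ` X = X" and x: "x \<in> X"
  shows "support_function P (g x) = support_function P x"
proof -
  let ?h = "support_function P"
  define k where "k u = (?h u + ?h (inv g u)) / 2" for u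
  have P: "polytope P" "interior P \<noteq> {}" "facet_normals P = X"
    and areas: "\<And>x. x \<in> X \<Longrightarrow> area x (support_face P x) = sphere_area TYPE('n) / real (card X)"
    using M by (auto simp: minkowski_polytope_def)
  have comp: "compact P" and cvx: "convex P" by (rule polytope_imp_compact polytope_imp_convex, fact)+
  have ne: "P \<noteq> {}" using P(2) by auto
  have unit: "norm u = 1" if "u \<in> X" for u using that P(3) by (auto simp: facet_normals_def)
  have Pcell: "P = cell X ?h" using polytope_eq_cell[OF P(1,2)] P(3) by simp
  obtain e where e: "0 < e" "ball 0 e \<subseteq> P" using int by (meson mem_interior)
  have hpos: "0 < ?h u" if u: "norm u = 1" for u
  proof -
    have "(e/2) *\<^sub>R u \<in> P" using e u by (intro subsetD[OF e(2)]) simp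
    from le_support_function[OF comp this, of u] show ?thesis using e u by (simp add: dot_square_norm)
  qed
  interpret bounded_cell X ?h
    by unfold_locales (use X unit hpos compact_imp_bounded[OF comp] Pcell in auto)
  have inj: "inj g" and surj: "surj g"
    using g by (rule orthogonal_transformation_inj orthogonal_transformation_surj)+
  have invg: "orthogonal_transformation (inv g)" by (rule orthogonal_transformation_inv[OF g])
  have invX: "inv g ` X = X" using gX inj by (metis image_inv_f_f)
  have inv_inj: "inj_on (inv g) X" using surj surj_imp_inj_inv inj_on_subset by blast
  define a where "a = sphere_area TYPE('n) / real (card X)"
  have fa: "facet_area u = a" if "u \<in> X" for u
    using areas[OF that] area_support_face[OF unit[OF that] comp] Pcell by (simp add: facet_area_def a_def)
  have sum_inv: "(\<Sum>u\<in>X. ?h (inv g u)) = (\<Sum>u\<in>X. ?h u)"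
    using sum.reindex[OF inv_inj, of ?h] invX by simp
  have kpos: "0 < k u" if "u \<in> X" for u
    using hpos[of u] hpos[of "inv g u"] unit[OF that] invg by (simp add: k_def orthogonal_transformation_norm)
  have "(\<Sum>u\<in>X. k u) = (\<Sum>u\<in>X. ?h u)"
    by (simp add: k_def sum_divide_distrib[symmetric] sum.distrib sum_inv)
  then have "(\<Sum>u\<in>X. k u * facet_area u) = (\<Sum>u\<in>X. ?h u * facet_area u)"
    by (simp add: fa sum_distrib_right[symmetric])
  then have upper: "measure lborel (cell X k) \<le> measure lborel P"
    using minkowski_first_inequality[OF kpos] Pcell by simp
  define L where "L = g ` P"
  have lin: "linear g" by (rule orthogonal_transformation_linear[OF g])
  have L: "compact L" "convex L" "L \<noteq> {}"
    using comp cvx ne lin unfolding L_def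
    by (auto intro!: compact_continuous_image linear_continuous_on convex_linear_image
        simp: linear_conv_bounded_linear[symmetric])
  have Lint: "interior L \<noteq> {}"
    unfolding L_def using interior_injective_linear_image[OF lin inj, of P] P(2) by simp
  have volL: "measure lborel L = measure lborel P" unfolding L_def by (rule measure_orthogonal[OF g comp])
  have mid: "(y + z) /\<^sub>R 2 \<in> cell X k" if "y \<in> P" "z \<in> L" for y z
    unfolding cell_def
  proof clarify
    fix u assume "u \<in> X"
    have "u \<bullet> y \<le> ?h u" "u \<bullet> z \<le> ?h (inv g u)"
      using that le_support_function[OF comp] le_support_function[OF L(1), of z u]
      by (auto simp: L_def support_function_orthogonal[OF g])
    then show "u \<bullet> ((y + z) /\<^sub>R 2) \<le> k u" by (simp add: k_def inner_add_right)
  qed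
  have "measure lborel P * measure lborel L \<le> (measure lborel (cell X k))^2"
    by (rule brunn_minkowski_measure) (auto intro: fmeasurable_compact comp L compact_cell mid[simplified])
  then have "(measure lborel P)^2 \<le> (measure lborel (cell X k))^2" by (simp add: volL power2_eq_square)
  then have "measure lborel P \<le> measure lborel (cell X k)" by (rule power2_le_imp_le) simp
  with upper have volM: "measure lborel (cell X k) = measure lborel P" by simp
  obtain w where w: "\<And>u. norm u = 1 \<Longrightarrow> (SUP y\<in>P. u \<bullet> y) = (SUP y\<in>L. u \<bullet> y) + u \<bullet> w"
    using brunn_minkowski_equality[OF cvx comp P(2) L(2,1) Lint convex_cell compact_cell interior_cell[OF kpos] mid volL volM]
    by blast
  then have w': "\<And>u. norm u = 1 \<Longrightarrow> ?h u = support_function L u + u \<bullet> w"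
    by (simp add: support_function_def)
  have "steiner_point L = 0"
    unfolding L_def steiner_point_orthogonal[OF g comp ne] s0 by (rule linear_0[OF lin])
  then have "w = 0" using steiner_point_translate[OF comp ne L(1,3) w'] s0 by simp
  then have "?h (g x) = support_function L (g x)"
    using w'[of "g x"] unit[OF x] g by (simp add: orthogonal_transformation_norm)
  then show ?thesis by (simp add: L_def support_function_orthogonal[OF g] inv_f_f[OF inj])
qed

section \<open>The Gauss--Radau rule of a coordinate\<close>

lemma poly_degree_le_2:
  fixes p :: "real poly"
  assumes "degree p \<le> 2" shows "poly p s = coeff p 0 + coeff p 1 * s + coeff p 2 * s^2"
proof -
  have "poly p s = (\<Sum>i\<le>2. coeff p i * s ^ i)"
    unfolding poly_altdef using assms by (intro sum.mono_neutral_left) (auto simp: coeff_eq_0)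
  then show ?thesis by (simp add: numeral_2_eq_2)
qed

lemma integral_quadratic_coordinate_distr:
  "(LINT s|coordinate_distr (i::'n::finite). a + b * s + c * s^2) = a + c / real CARD('n)"
proof -
  have ax: "x $ i = x \<bullet> axis i 1" for x :: "real^'n" by (simp add: inner_axis)
  have int1: "integrable sphere_prob (\<lambda>x::real^'n. x \<bullet> axis i 1)"
  proof (rule integrable_sphere_prob)
    fix x :: "real^'n" assume "norm x = 1"
    then show "norm (x \<bullet> axis i 1) \<le> 1" using Cauchy_Schwarz_ineq2[of x "axis i 1"] by simp
  qed measurable
  have int2: "integrable sphere_prob (\<lambda>x::real^'n. (x \<bullet> axis i 1)^2)"
    using integrable_inner_inner_sphere[of "axis i 1" "axis i 1"] by (simp add: power2_eq_square)
  have int0: "integrable sphere_prob (\<lambda>x::real^'n. a)"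
    by (rule finite_measure.integrable_const[OF finite_measure_sphere_prob])
  have meas: "(\<lambda>x::real^'n. x $ i) \<in> borel_measurable sphere_prob"
    unfolding ax by measurable
  have "(LINT s|coordinate_distr i. a + b * s + c * s^2) = (LINT x|(sphere_prob :: (real^'n) measure). a + b * (x $ i) + c * (x $ i)^2)"
    unfolding coordinate_distr_def using meas by (intro integral_distr) measurable
  also have "\<dots> = (LINT x|(sphere_prob :: (real^'n) measure). a) + b * (LINT x|(sphere_prob :: (real^'n) measure). x \<bullet> axis i 1)
      + c * (LINT x|(sphere_prob :: (real^'n) measure). (x \<bullet> axis i 1)^2)"
    unfolding ax using int0 int1 int2 by simp
  also have "\<dots> = a + c / real CARD('n)"
    by (simp add: measure_sphere_prob_UNIV integral_inner_sphere integral_inner_sq_sphere)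
  finally show ?thesis .
qed

text \<open>
  For a quadratic polynomial only the constant and the leading coefficient contribute, since the
  coordinate has mean \<open>0\<close> and second moment \<open>1 / n\<close>. Testing the rule with \<open>1\<close> and \<open>s\<close> determines the weights.
\<close>

lemma gauss_radau_coordinate_distr:
  fixes i :: "'n::finite"
  defines "n \<equiv> real CARD('n)"
  shows "gauss_radau_rule (coordinate_distr i) \<xi> v w \<longleftrightarrow> \<xi> = 1 / n \<and> v = 1 / (n + 1) \<and> w = n / (n + 1)"
proof
  have n: "0 < n" by (simp add: n_def)
  have E: "(LINT s|coordinate_distr i. poly p s) = coeff p 0 + coeff p 2 / n" if "degree p \<le> 2" for p
    unfolding poly_degree_le_2[OF that] integral_quadratic_coordinate_distr n_def ..
  have Q: "(LINT s|coordinate_distr i. poly q s * (1 + s)) = coeff q 0 + coeff q 1 / n" if "degree q = 1" for q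
  proof -
    have "poly q s * (1 + s) = coeff q 0 + (coeff q 0 + coeff q 1) * s + coeff q 1 * s^2" for s
      using that by (simp add: poly_altdef algebra_simps power2_eq_square)
    then show ?thesis unfolding n_def by (simp only: integral_quadratic_coordinate_distr)
  qed
  {
    assume r: "gauss_radau_rule (coordinate_distr i) \<xi> v w"
    then obtain q where q: "degree q = 1" "coeff q 0 + coeff q 1 / n = 0" "poly q \<xi> = 0"
      using Q by (auto simp: gauss_radau_rule_def)
    have q1: "coeff q 1 \<noteq> 0" using q(1) by (metis degree_0 leading_coeff_0_iff zero_neq_one)
    have "coeff q 0 + coeff q 1 * \<xi> = 0" using q(1,3) by (simp add: poly_altdef)
    then have "coeff q 1 * (\<xi> - 1 / n) = 0" using q(2) by (simp add: right_diff_distrib)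
    then have xi: "\<xi> = 1 / n" using q1 by simp
    have rule: "coeff p 0 + coeff p 2 / n = v * poly p (-1) + w * poly p \<xi>" if "degree p \<le> 2" for p
      using r E[OF that] that by (auto simp: gauss_radau_rule_def)
    have "v + w = 1" using rule[of 1] by simp
    moreover have "coeff [:0, 1::real:] 2 = 0" by (rule coeff_eq_0) simp
    then have "w / n = v" using rule[of "[:0, 1:]"] xi by simp
    ultimately have "v * (n + 1) = 1" and wv: "w = n * v" using n by (auto simp: field_simps)
    then have "v = 1 / (n + 1)" using n by (simp add: eq_divide_eq)
    then show "\<xi> = 1 / n \<and> v = 1 / (n + 1) \<and> w = n / (n + 1)" using xi wv by simp
  next
    assume "\<xi> = 1 / n \<and> v = 1 / (n + 1) \<and> w = n / (n + 1)"
    then have xi: "\<xi> = 1 / n" and v: "v = 1 / (n + 1)" and w: "w = n / (n + 1)" by auto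
    have "\<exists>q :: real poly. degree q = 1 \<and> (LINT s|coordinate_distr i. poly q s * (1 + s)) = 0 \<and> poly q \<xi> = 0"
    proof (intro exI conjI)
      show "degree [:- 1 / n, 1:] = 1" by simp
      from Q[OF this] show "(LINT s|coordinate_distr i. poly [:- 1 / n, 1:] s * (1 + s)) = 0"
        by (simp only:) simp
      show "poly [:- 1 / n, 1:] \<xi> = 0" by (simp add: xi)
    qed
    moreover have "(LINT s|coordinate_distr i. poly p s) = v * poly p (-1) + w * poly p \<xi>"
      if p: "degree p \<le> 2" for p
    proof -
      have v1: "v * (n + 1) = 1" and wv: "w = n * v" using n by (simp_all add: v w)
      have "v + w = 1" "w / n = v" using v1 wv n by (simp_all add: algebra_simps)
      moreover have "v + w / n^2 = v * (n + 1) / n"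
        using n by (simp add: wv field_simps power2_eq_square)
      then have "v + w / n^2 = 1 / n" unfolding v1 .
      moreover have "v * poly p (-1) + w * poly p \<xi> =
          coeff p 0 * (v + w) + coeff p 1 * (w / n - v) + coeff p 2 * (v + w / n^2)"
        unfolding poly_degree_le_2[OF p] xi by (simp add: power2_eq_square algebra_simps)
      ultimately show ?thesis unfolding E[OF p] by simp
    qed
    ultimately show "gauss_radau_rule (coordinate_distr i) \<xi> v w" by (simp add: gauss_radau_rule_def)
  }
qed

section \<open>Radii of the polytope and extremal designs\<close>

lemma centered_inradius_eq:
  fixes P :: "(real^'n) set"
  assumes P: "P = {y. \<forall>x\<in>X. x \<bullet> y \<le> \<rho>}" and X: "X \<noteq> {}" "\<And>x. x \<in> X \<Longrightarrow> norm x = 1" and \<rho>: "0 \<le> \<rho>"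
  shows "centered_inradius P = \<rho>"
proof -
  have iff: "cball 0 \<sigma> \<subseteq> P \<longleftrightarrow> \<sigma> \<le> \<rho>" if \<sigma>: "0 \<le> \<sigma>" for \<sigma>
  proof
    assume sub: "cball 0 \<sigma> \<subseteq> P"
    obtain x where x: "x \<in> X" using X by auto
    have "\<sigma> *\<^sub>R x \<in> P" using X(2)[OF x] \<sigma> by (intro subsetD[OF sub]) simp
    then have "x \<bullet> (\<sigma> *\<^sub>R x) \<le> \<rho>" using x P by blast
    then show "\<sigma> \<le> \<rho>" using X(2)[OF x] by (simp add: dot_square_norm)
  next
    assume le: "\<sigma> \<le> \<rho>"
    show "cball 0 \<sigma> \<subseteq> P" unfolding P
    proof clarify
      fix y x assume y: "y \<in> cball (0::real^'n) \<sigma>" and x: "x \<in> X"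
      have "x \<bullet> y \<le> norm x * norm y" by (rule norm_cauchy_schwarz)
      then show "x \<bullet> y \<le> \<rho>" using X(2)[OF x] y le by simp
    qed
  qed
  have "{\<sigma>. 0 \<le> \<sigma> \<and> cball 0 \<sigma> \<subseteq> P} = {0..\<rho>}"
  proof (rule set_eqI)
    fix \<sigma> show "\<sigma> \<in> {\<sigma>. 0 \<le> \<sigma> \<and> cball 0 \<sigma> \<subseteq> P} \<longleftrightarrow> \<sigma> \<in> {0..\<rho>}"
      using iff[of \<sigma>] by (cases "0 \<le> \<sigma>") simp_all
  qed
  then show ?thesis unfolding centered_inradius_def using \<rho> by simp
qed

lemma centered_circumradius_attained:
  fixes P :: "(real^'n) set"
  assumes P: "compact P" "P \<noteq> {}"
  obtains v where "v \<in> P" "norm v = centered_circumradius P" "\<And>y. y \<in> P \<Longrightarrow> norm y \<le> norm v"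
proof -
  obtain v where v: "v \<in> P" "\<And>y. y \<in> P \<Longrightarrow> norm y \<le> norm v"
    using continuous_attains_sup[OF P, of norm] by (auto intro: continuous_intros)
  have "{\<sigma>. 0 \<le> \<sigma> \<and> P \<subseteq> cball 0 \<sigma>} = {norm v..}"
    using v by (auto intro: order_trans simp: subset_eq) (meson norm_ge_zero order_trans)
  then have "centered_circumradius P = norm v" by (simp add: centered_circumradius_def)
  then show thesis using that v by simp
qed

text \<open>
  The quadratic polynomial \<open>(s + norm v) (\<rho> - s)\<close> is nonnegative on the range of \<open>x \<bullet> v\<close> and has its zeros
  at the two nodes of the Radau rule scaled by \<open>norm v\<close>, if \<open>\<rho> = norm v / d\<close>.
\<close>

lemma sum_radau_defect:
  fixes X :: "(real^'n) set"
  assumes X: "spherical_design 2 X"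
  shows "(\<Sum>x\<in>X. (x \<bullet> v + norm v) * (\<rho> - x \<bullet> v)) = real (card X) * norm v / real CARD('n) * (real CARD('n) * \<rho> - norm v)"
proof -
  have "(\<Sum>x\<in>X. (x \<bullet> v + norm v) * (\<rho> - x \<bullet> v)) =
      (\<Sum>x\<in>X. norm v * \<rho> + (\<rho> - norm v) * (x \<bullet> v) - (x \<bullet> v) * (x \<bullet> v))"
    by (intro sum.cong) (auto simp: algebra_simps)
  also have "\<dots> = real (card X) * (norm v * \<rho>) + (\<rho> - norm v) * (\<Sum>x\<in>X. x \<bullet> v) - (\<Sum>x\<in>X. (x \<bullet> v) * (x \<bullet> v))"
    by (simp add: sum_subtractf sum.distrib sum_distrib_left)
  also have "\<dots> = real (card X) * (norm v * \<rho>) - real (card X) / real CARD('n) * (norm v)^2"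
    unfolding design_first_moment[OF X] design_second_moment[OF X] by (simp add: dot_square_norm)
  also have "\<dots> = real (card X) * norm v / real CARD('n) * (real CARD('n) * \<rho> - norm v)"
    by (simp add: field_simps power2_eq_square)
  finally show ?thesis .
qed

lemma radau_terms_nonneg:
  fixes X :: "(real^'n) set"
  assumes "norm x = 1" "x \<bullet> v \<le> \<rho>"
  shows "0 \<le> (x \<bullet> v + norm v) * (\<rho> - x \<bullet> v)"
  using assms Cauchy_Schwarz_ineq2[of x v] by (intro mult_nonneg_nonneg) (auto simp: abs_le_iff)

lemma norm_le_card_mult:
  fixes X :: "(real^'n) set"
  assumes X: "spherical_design 2 X" and v: "\<And>x. x \<in> X \<Longrightarrow> x \<bullet> v \<le> \<rho>" "v \<noteq> 0"
  shows "norm v \<le> real CARD('n) * \<rho>"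
proof -
  have "finite X" "X \<noteq> {}" "X \<subseteq> sphere 0 1" using X by (auto simp: spherical_design_def)
  then have "0 < card X" by (simp add: card_gt_0_iff)
  have "0 \<le> (\<Sum>x\<in>X. (x \<bullet> v + norm v) * (\<rho> - x \<bullet> v))"
    using \<open>X \<subseteq> sphere 0 1\<close> v by (intro sum_nonneg radau_terms_nonneg) auto
  moreover have "0 < real (card X) * norm v / real CARD('n)" using \<open>0 < card X\<close> v(2) by simp
  ultimately have "0 \<le> real CARD('n) * \<rho> - norm v"
    unfolding sum_radau_defect[OF X] zero_le_mult_iff by (meson not_less order_less_imp_le)
  then show ?thesis by simp
qed

text \<open>
  All terms of the Radau sum vanish, so \<open>x \<bullet> v\<close> takes only the two values \<open>- norm v\<close> and \<open>\<rho>\<close>. The first one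
  forces \<open>x = - v / norm v\<close>, and since the values add up to \<open>0\<close>, it occurs exactly once and is balanced
  by \<open>CARD('n)\<close> occurrences of the other one.
\<close>

lemma card_of_extremal_design:
  fixes X :: "(real^'n) set"
  assumes X: "spherical_design 2 X" and v: "\<And>x. x \<in> X \<Longrightarrow> x \<bullet> v \<le> \<rho>" and \<rho>: "0 < \<rho>"
    and eq: "norm v = real CARD('n) * \<rho>"
  shows "card X = CARD('n) + 1"
proof -
  let ?R = "norm v"
  have fin: "finite X" and ne: "X \<noteq> {}" and sph: "X \<subseteq> sphere 0 1" using X by (auto simp: spherical_design_def)
  have R: "0 < ?R" using eq \<rho> by simp
  have "(\<Sum>x\<in>X. (x \<bullet> v + ?R) * (\<rho> - x \<bullet> v)) = 0"
    by (subst sum_radau_defect[OF X]) (simp add: eq)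
  moreover have "0 \<le> (x \<bullet> v + ?R) * (\<rho> - x \<bullet> v)" if "x \<in> X" for x
    using sph v that by (intro radau_terms_nonneg) auto
  ultimately have zero: "(x \<bullet> v + ?R) * (\<rho> - x \<bullet> v) = 0" if "x \<in> X" for x
    using sum_nonneg_eq_0_iff[OF fin, of "\<lambda>x. (x \<bullet> v + ?R) * (\<rho> - x \<bullet> v)"] that by blast
  define A where "A = {x\<in>X. x \<bullet> v = - ?R}"
  have rest: "x \<bullet> v = \<rho>" if "x \<in> X - A" for x using zero[of x] that by (auto simp: A_def)
  have "A \<subseteq> {- (v /\<^sub>R ?R)}"
  proof
    fix x assume x: "x \<in> A"
    then have nx: "norm x = 1" and xv: "x \<bullet> v = - ?R" using sph by (auto simp: A_def)
    have "(x + v /\<^sub>R ?R) \<bullet> (x + v /\<^sub>R ?R) = x \<bullet> x + 2 * (x \<bullet> v) / ?R + (v \<bullet> v) / ?R^2"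
      by (simp add: inner_add_left inner_add_right inner_commute field_simps power2_eq_square)
    also have "\<dots> = 0" using nx xv R by (simp add: dot_square_norm power2_eq_square)
    finally have "x + v /\<^sub>R ?R = 0" by simp
    then show "x \<in> {- (v /\<^sub>R ?R)}" by (simp add: eq_neg_iff_add_eq_0)
  qed
  then have cA: "card A \<le> 1" using card_mono[of "{- (v /\<^sub>R ?R)}" A] by simp
  have finA: "finite A" and sub: "A \<subseteq> X" using fin by (auto simp: A_def)
  have "0 = (\<Sum>x\<in>X. x \<bullet> v)" by (simp add: design_first_moment[OF X])
  also have "\<dots> = (\<Sum>x\<in>X - A. x \<bullet> v) + (\<Sum>x\<in>A. x \<bullet> v)" by (rule sum.subset_diff[OF sub fin])
  also have "\<dots> = real (card (X - A)) * \<rho> - real (card A) * ?R"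
  proof -
    have "(\<Sum>x\<in>X - A. x \<bullet> v) = (\<Sum>x\<in>X - A. \<rho>)" by (rule sum.cong) (simp_all only: rest)
    moreover have "(\<Sum>x\<in>A. x \<bullet> v) = (\<Sum>x\<in>A. - ?R)" by (rule sum.cong) (auto simp: A_def)
    ultimately show ?thesis by simp
  qed
  finally have bal: "real (card (X - A)) * \<rho> = real (card A) * (real CARD('n) * \<rho>)" by (simp add: eq)
  then have bal': "card (X - A) = card A * CARD('n)" using \<rho>
    by (simp flip: mult.assoc of_nat_mult)
  have cX: "card X = card (X - A) + card A" using card_Diff_subset[OF finA sub] card_mono[OF fin sub] by simp
  have "card X \<noteq> 0" using fin ne by simp
  then have "card A = 1" using cA bal' cX by (cases "card A") auto
  then show ?thesis using bal' cX by simp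
qed

text \<open>
  The inner products of \<open>x\<close> with the other \<open>CARD('n)\<close> points have a prescribed sum and a prescribed sum of
  squares, and these are extremal for the inequality of Cauchy and Schwarz.
\<close>

lemma gram_of_tight_design:
  fixes X :: "(real^'n) set"
  assumes X: "spherical_design 2 X" and card: "card X = CARD('n) + 1" and x: "x \<in> X" and y: "y \<in> X" "x \<noteq> y"
  shows "x \<bullet> y = - 1 / real CARD('n)"
proof -
  let ?n = "real CARD('n)"
  have fin: "finite X" and sph: "X \<subseteq> sphere 0 1" using X by (auto simp: spherical_design_def)
  have xx: "x \<bullet> x = 1" using x sph by (auto simp: dot_square_norm)
  have s1: "(\<Sum>z\<in>X - {x}. z \<bullet> x) = - 1"
    using design_first_moment[OF X, of x] sum.remove[OF fin x, of "\<lambda>z. z \<bullet> x"] xx by simp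
  have s2: "(\<Sum>z\<in>X - {x}. (z \<bullet> x) * (z \<bullet> x)) = 1 / ?n"
    using design_second_moment[OF X, of x x] sum.remove[OF fin x, of "\<lambda>z. (z \<bullet> x) * (z \<bullet> x)"] xx card
    by (simp add: field_simps)
  have "(\<Sum>z\<in>X - {x}. (z \<bullet> x + 1 / ?n)^2) = (\<Sum>z\<in>X - {x}. (z \<bullet> x) * (z \<bullet> x) + 2 / ?n * (z \<bullet> x) + 1 / ?n^2)"
    by (intro sum.cong) (auto simp: power2_eq_square field_simps)
  also have "\<dots> = 1 / ?n + 2 / ?n * (- 1) + ?n / ?n^2"
    using card fin x by (simp only: sum.distrib sum_distrib_left[symmetric] s1 s2) simp
  also have "\<dots> = 0" by (simp add: power2_eq_square)
  finally have "(y \<bullet> x + 1 / ?n)^2 = 0"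
    using y fin by (subst (asm) sum_nonneg_eq_0_iff) auto
  then show ?thesis by (simp add: inner_commute eq_neg_iff_add_eq_0)
qed

lemma equiangular_regular_simplex:
  fixes V :: "(real^'n) set"
  assumes card: "card V = CARD('n) + 1" and ab: "a \<noteq> b"
    and gram: "\<And>x y. x \<in> V \<Longrightarrow> y \<in> V \<Longrightarrow> x \<bullet> y = (if x = y then a else b)"
  shows "regular_simplex_vertices V"
proof -
  have fin: "finite V" using card by (intro card_ge_0_finite) simp
  have "\<not> affine_dependent V"
  proof
    assume "affine_dependent V"
    then obtain c v where c: "sum c V = 0" "v \<in> V" "c v \<noteq> 0" "(\<Sum>x\<in>V. c x *\<^sub>R x) = 0"
      unfolding affine_dependent_explicit_finite[OF fin] by blast
    have "0 = (\<Sum>x\<in>V. c x *\<^sub>R x) \<bullet> v" using c by simp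
    also have "\<dots> = (\<Sum>x\<in>V. b * c x + (if x = v then (a - b) * c x else 0))"
      unfolding inner_sum_left by (intro sum.cong) (auto simp: gram c(2) algebra_simps)
    also have "\<dots> = (a - b) * c v"
      using c fin by (simp add: sum.distrib sum_distrib_left[symmetric])
    finally show False using c(3) ab by simp
  qed
  moreover have "dist x y = sqrt (2 * a - 2 * b)" if "x \<in> V" "y \<in> V" "x \<noteq> y" for x y
  proof -
    have "(x - y) \<bullet> (x - y) = 2 * a - 2 * b"
      using that gram[of x x] gram[of y y] gram[of x y] gram[of y x] by (simp add: inner_diff_left inner_diff_right)
    then show ?thesis by (simp add: dist_norm norm_eq_sqrt_inner)
  qed
  ultimately show ?thesis using card by (auto simp: regular_simplex_vertices_def)
qed

lemma card_extreme_points_facet: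
  fixes V :: "(real^'n) set"
  assumes V: "regular_simplex_vertices V" and F: "F facet_of (convex hull V)"
  shows "card {v. v extreme_point_of F} = CARD('n)"
proof -
  have indep: "\<not> affine_dependent V" and card: "card V = CARD('n) + 1"
    using V by (auto simp: regular_simplex_vertices_def)
  obtain u where u: "u \<in> V" "F = convex hull (V - {u})"
    using F unfolding facet_of_convex_hull_affine_independent_alt[OF indep] by blast
  have "\<not> affine_dependent (V - {u})" using affine_dependent_subset[of "V - {u}" V] indep by blast
  then have "{v. v extreme_point_of F} = V - {u}"
    using u(2) by (auto simp: extreme_point_of_convex_hull_affine_independent)
  then show ?thesis using card u(1) by simp
qed

text \<open>
  The barycentric coordinates of a point \<open>y\<close> are its suitably normalized distances from the facets; that they
  reproduce \<open>y\<close> is the second moment identity.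
\<close>

lemma simplex_cell_eq_hull:
  fixes X :: "(real^'n) set"
  assumes X: "spherical_design 2 X" and card: "card X = CARD('n) + 1" and \<rho>: "0 < \<rho>"
  shows "{y. \<forall>x\<in>X. x \<bullet> y \<le> \<rho>} = convex hull ((\<lambda>x. (- (real CARD('n) * \<rho>)) *\<^sub>R x) ` X)"
    (is "?P = convex hull (?f ` X)")
proof (intro equalityI)
  let ?n = "real CARD('n)"
  have fin: "finite X" and sph: "X \<subseteq> sphere 0 1" using X by (auto simp: spherical_design_def)
  show "convex hull (?f ` X) \<subseteq> ?P"
  proof (rule hull_minimal)
    show "?f ` X \<subseteq> ?P"
    proof clarify
      fix x y assume xy: "x \<in> X" "y \<in> X"
      then have "norm y = 1" using sph by auto
      then show "y \<bullet> ?f x \<le> \<rho>"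
      proof (cases "x = y")
        case True
        have "0 \<le> ?n * \<rho>" using \<rho> by simp
        then have "- (?n * \<rho>) \<le> \<rho>" using \<rho> by linarith
        then show ?thesis using True \<open>norm y = 1\<close> by (simp add: dot_square_norm)
      next
        case False
        then show ?thesis using gram_of_tight_design[OF X card, of y x] xy by simp
      qed
    qed
    show "convex ?P" using convex_cell[of X "\<lambda>_. \<rho>"] by (simp add: cell_def)
  qed
  show "?P \<subseteq> convex hull (?f ` X)"
  proof
    fix y assume y: "y \<in> ?P"
    have alg: "- ((\<rho> - a) * q) * b = q * (a * b) - \<rho> * q * b" for a b q :: real
      by (simp add: algebra_simps)
    define c where "c x = (\<rho> - x \<bullet> y) / ((?n + 1) * \<rho>)" for x
    have n1: "0 < (?n + 1) * \<rho>" using \<rho> by (intro mult_pos_pos) auto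
    have "(\<Sum>x\<in>X. c x) = (real (card X) * \<rho> - (\<Sum>x\<in>X. x \<bullet> y)) / ((?n + 1) * \<rho>)"
      unfolding c_def sum_divide_distrib[symmetric] by (simp add: sum_subtractf)
    then have c1: "(\<Sum>x\<in>X. c x) = 1"
      using n1 \<rho> by (simp add: design_first_moment[OF X] card add.commute)
    have c0: "0 \<le> c x" if "x \<in> X" for x using y that n1 by (simp add: c_def)
    have "(\<Sum>x\<in>X. c x *\<^sub>R ?f x) \<bullet> w = y \<bullet> w" for w
    proof -
      have "(\<Sum>x\<in>X. c x *\<^sub>R ?f x) \<bullet> w = (\<Sum>x\<in>X. ?n / (?n + 1) * ((x \<bullet> y) * (x \<bullet> w)) - \<rho> * (?n / (?n + 1)) * (x \<bullet> w))"
        unfolding inner_sum_left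
      proof (intro sum.cong refl)
        fix x
        have "c x * (?n * \<rho>) = (\<rho> - x \<bullet> y) * (?n / (?n + 1))" using \<rho> by (simp add: c_def)
        moreover have "(c x *\<^sub>R ?f x) \<bullet> w = - (c x * (?n * \<rho>)) * (x \<bullet> w)" by simp
        ultimately show "(c x *\<^sub>R ?f x) \<bullet> w = ?n / (?n + 1) * ((x \<bullet> y) * (x \<bullet> w)) - \<rho> * (?n / (?n + 1)) * (x \<bullet> w)"
          by (simp only:) (rule alg)
      qed
      also have "\<dots> = ?n / (?n + 1) * (\<Sum>x\<in>X. (x \<bullet> y) * (x \<bullet> w)) - \<rho> * (?n / (?n + 1)) * (\<Sum>x\<in>X. x \<bullet> w)"
        by (simp only: sum_subtractf sum_distrib_left)
      also have "\<dots> = ?n / (?n + 1) * ((?n + 1) / ?n * (y \<bullet> w))"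
        unfolding design_first_moment[OF X] design_second_moment[OF X] card by (simp add: add.commute)
      also have "\<dots> = y \<bullet> w" by (simp add: add_pos_nonneg)
      finally show ?thesis .
    qed
    then have "(\<Sum>x\<in>X. c x *\<^sub>R ?f x) = y" using vector_eq_rdot by blast
    moreover have "(\<Sum>x\<in>X. c x *\<^sub>R ?f x) \<in> convex hull (?f ` X)"
      by (rule convex_sum[OF fin convex_convex_hull c1 c0]) (auto intro: hull_inc)
    ultimately show "y \<in> convex hull (?f ` X)" by simp
  qed
qed

theorem corollary8p2:
  fixes X P :: "(real^'n) set" and U :: "real^'n \<Rightarrow> real^'n" and c r R :: real
  assumes "CARD('n) \<ge> 2"
    and "spherical_design 2 X"
    and "node_transitive X"
    and "minkowski_polytope X P"
    and "steiner_point P = 0"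
    and "c > 0"
    and "orthogonal_transformation U"
    and "polar P = (\<lambda>y. c *\<^sub>R U y) ` P"
    and "r = centered_inradius P"
    and "R = centered_circumradius P"
  shows "r / R \<ge> 1 / real CARD('n) \<and>
    (r / R = 1 / real CARD('n) \<longrightarrow>
       card X = CARD('n) + 1 \<and> regular_simplex_vertices X \<and> regular_simplex P \<and>
       (\<forall>F. F facet_of P \<longrightarrow> card {v. v extreme_point_of F} = CARD('n)) \<and>
       (\<forall>(i::'n) \<xi> v w. gauss_radau_rule (coordinate_distr i) \<xi> v w \<longleftrightarrow>
          \<xi> = 1 / real CARD('n) \<and> v = 1 / (real CARD('n) + 1) \<and>
          w = real CARD('n) / (real CARD('n) + 1)))"
proof -
  let ?n = "real CARD('n)"
  note X = assms(2) and M = assms(4)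
  have fin: "finite X" and neX: "X \<noteq> {}" and sph: "X \<subseteq> sphere 0 1"
    using X by (auto simp: spherical_design_def)
  have unit: "norm x = 1" if "x \<in> X" for x using sph that by auto
  have P: "polytope P" "interior P \<noteq> {}" "facet_normals P = X" using M by (auto simp: minkowski_polytope_def)
  have comp: "compact P" and cvx: "convex P" by (rule polytope_imp_compact polytope_imp_convex, fact)+
  have ne: "P \<noteq> {}" using P(2) by auto
  have "bounded (polar P)"
  proof -
    have "compact ((\<lambda>y. c *\<^sub>R U y) ` P)"
      using comp orthogonal_transformation_linear[OF assms(7)]
      by (intro compact_continuous_image continuous_intros linear_continuous_on)
         (simp_all add: linear_conv_bounded_linear)
    then show ?thesis unfolding assms(8) by (rule compact_imp_bounded)
  qed
  then have int: "0 \<in> interior P" by (rule zero_in_interior_if_bounded_polar[OF cvx P(2)])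
  obtain x0 where x0: "x0 \<in> X" using neX by auto
  define \<rho> where "\<rho> = support_function P x0"
  have h: "support_function P x = \<rho>" if x: "x \<in> X" for x
  proof -
    obtain g where "orthogonal_transformation g" "g ` X = X" "g x0 = x"
      using assms(3) x0 x unfolding node_transitive_def orthogonal_subgroup_def by blast
    then show ?thesis
      using support_function_invariant[OF fin M assms(5) int _ _ x0, of g] by (simp add: \<rho>_def)
  qed
  have Peq: "P = {y. \<forall>x\<in>X. x \<bullet> y \<le> \<rho>}"
    using polytope_eq_cell[OF P(1,2)] h unfolding P(3) cell_def by auto
  obtain e where e: "0 < e" "ball 0 e \<subseteq> P" using int by (meson mem_interior)
  have in_P: "(e/2) *\<^sub>R x0 \<in> P" using e unit[OF x0] by (intro subsetD[OF e(2)]) simp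
  from le_support_function[OF comp this, of x0] have \<rho>: "0 < \<rho>"
    using e unit[OF x0] by (simp add: \<rho>_def dot_square_norm)
  have r: "r = \<rho>" unfolding assms(9) by (rule centered_inradius_eq[OF Peq neX unit]) (use \<rho> in auto)
  obtain v where v: "v \<in> P" "norm v = R" "\<And>y. y \<in> P \<Longrightarrow> norm y \<le> norm v"
    using centered_circumradius_attained[OF comp ne] assms(10) by metis
  have R: "0 < R" using v(3)[OF in_P] v(2) e unit[OF x0] by simp
  have vX: "x \<bullet> v \<le> \<rho>" if "x \<in> X" for x using v(1) that Peq by auto
  have le: "R \<le> ?n * \<rho>" using norm_le_card_mult[OF X vX] R v by auto
  show ?thesis
  proof (intro conjI impI allI)
    show "1 / ?n \<le> r / R" using le R by (simp add: r field_simps)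
  next
    assume "r / R = 1 / ?n"
    then have "norm v = ?n * \<rho>" using R by (simp add: r v(2) field_simps)
    from card_of_extremal_design[OF X vX \<rho> this] have card: "card X = CARD('n) + 1" .
    let ?V = "(\<lambda>x. (- (?n * \<rho>)) *\<^sub>R x) ` X"
    have gram: "x \<bullet> y = (if x = y then 1 else - 1 / ?n)" if "x \<in> X" "y \<in> X" for x y
      using gram_of_tight_design[OF X card] that unit by (auto simp: dot_square_norm)
    have "(1::real) \<noteq> - 1 / ?n" by (metis divide_le_0_iff neg_le_0_iff_le not_one_le_zero of_nat_0_le_iff zero_le_one)
    then show simplexX: "regular_simplex_vertices X"
      by (rule equiangular_regular_simplex[OF card _ gram])
    have V: "regular_simplex_vertices ?V"
    proof (rule equiangular_regular_simplex)
      have "inj_on (\<lambda>x. (- (?n * \<rho>)) *\<^sub>R x) X" using \<rho> by (auto simp: inj_on_def)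
      then show "card ?V = CARD('n) + 1" by (simp add: card_image card)
      show "(?n * \<rho>)^2 * 1 \<noteq> (?n * \<rho>)^2 * (- 1 / ?n)" using \<rho> \<open>(1::real) \<noteq> - 1 / ?n\<close> by (subst mult_cancel_left) simp
      fix a b assume "a \<in> ?V" "b \<in> ?V"
      then obtain x y where "x \<in> X" "y \<in> X" "a = (- (?n * \<rho>)) *\<^sub>R x" "b = (- (?n * \<rho>)) *\<^sub>R y" by auto
      then show "a \<bullet> b = (if a = b then (?n * \<rho>)^2 * 1 else (?n * \<rho>)^2 * (- 1 / ?n))"
        using gram[of x y] \<rho> by (auto simp: power2_eq_square)
    qed
    have hull: "P = convex hull ?V" unfolding Peq by (rule simplex_cell_eq_hull[OF X card \<rho>])
    show "regular_simplex P" using V hull by (auto simp: regular_simplex_def)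
    show "card {v. v extreme_point_of F} = CARD('n)" if "F facet_of P" for F
      using card_extreme_points_facet[OF V] that hull by simp
    show "card X = CARD('n) + 1" by (rule card)
  qed (rule gauss_radau_coordinate_distr)
qed

end
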